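(* Let $K$ be a finite extension of $\mathbb{Q}$, and let $f(x)$ be a quadratic polynomial with coefficients in the ring of integers of $K$. Let $c$ be the critical point of $f$ in $\mathbb{C}$, and suppose that its post-critical orbit $P_c=\{f^m(c)\mid m\ge1\}$ is finite, of cardinality $r=\#P_c$. Consider the action of the profinite arithmetic iterated monodromy group $\mathrm{Gal}_{\rm arith}(f)$ on the path space $\mathcal{P}_2$ of the binary rooted tree $T$ of the solutions to $f^n(x)=t$, $n\ge1$. Then the action has wild asymptotic discriminant, unless $r=1$ or the orbit of $c$ is strictly pre-periodic and $r=2$. More precisely, the following holds: (1) If the orbit of $c$ is strictly periodic and $r=1$, then the action of $\mathrm{Gal}_{\rm arith}(f)$ is stable with infinite discriminant group. (2) If the orbit of $c$ is strictly periodic and $r\ge2$, then the action of $\mathrm{Gal}_{\rm arith}(f)$ is not LQA, and so the asymptotic discriminant of the action is wild. (3) If the orbit of $c$ is strictly pre-periodic and $r=2$, then the action of $\mathrm{Gal}_{\rm arith}(f)$ is stable with infinite discriminant group. (4) If the orbit of $c$ is strictly pre-periodic and $r\ge3$, then the action of $\mathrm{Gal}_{\rm arith}(f)$ is not LQA, and so the asymptotic discriminant of the action is wild.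
   Context: **Orbits.** $f^n$ is the $n$-th iterate of $f$. With $P_c$ finite, the orbit of $c$ is strictly periodic if $c\in P_c$ and strictly pre-periodic if $c\notin P_c$. **Tree and Galois group.** Let $t$ be transcendental over $K$. For $n\ge1$ the polynomial $f^n(x)-t$ is separable and irreducible over $K(t)$; let $K_n$ be the extension of $K(t)$ obtained by adjoining its roots and $\mathcal{K}=\bigcup_nK_n$. The tree $T$ has vertex set $\bigsqcup_{n\ge0}V_n$, with $V_0=\{t\}$ and $V_n$ the set of roots of $f^n(x)=t$; $\beta\in V_{n+1}$ is joined to $\alpha\in V_n$ iff $f(\beta)=\alpha$. Here $T$ is a binary rooted tree. $\mathrm{Gal}_{\rm arith}(f)=\mathrm{Gal}(\mathcal{K}/K(t))=\varprojlim\mathrm{Gal}(K_n/K(t))$, a closed subgroup of $\mathrm{Aut}(T)$ acting transitively on each $V_n$. The path space $\mathcal{P}_2$ is the set of infinite paths from the root, a Cantor set with basic clopen sets formed by all paths through a given vertex, with metric $D(t,w)=2^{-m}$, $m$ the length of the longest common initial segment (and $D(t,t)=0$). **LQA, stable, wild.** An action of a (countable or profinite) group $G$ on a metric space $X$ is locally quasi-analytic (LQA) if there is $\epsilon>0$ such that for any open $U\subset X$ with $\mathrm{diam}(U)<\epsilon$, any $g_1,g_2\in G$ and any nonempty open $V\subset U$, $g_1|_V=g_2|_V$ implies $g_1|_U=g_2|_U$. The action of a closed subgroup of $\mathrm{Aut}(T)$ transitive on all levels is stable (has stable asymptotic discriminant) if it is LQA, and wild (has wild asymptotic discriminant) otherwise.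 **Discriminant group.** For a closed level-transitive subgroup of $\mathrm{Aut}(T)$ take a countable dense subgroup $G$ (the groups below do not depend on this choice). Fix a path $x=(v_n)_{n\ge0}$, let $G_n=\{g\in G\mid g\cdot v_n=v_n\}$ and, for $n\ge m\ge 0$, $C^m_n=\bigcap_{g\in G_m}gG_ng^{-1}$. Put $\mathcal{D}^m_x=\varprojlim_{n\ge m}\{G_{n+1}/C^m_{n+1}\to G_n/C^m_n\}$; inclusions $C^m_n\subset C^k_n$ induce surjections $\mathcal{D}^m_x\to\mathcal{D}^k_x$ for $k>m$. The action is stable iff these surjections are isomorphisms for all $k>m\ge m_0$, for some $m_0$; it is then stable with discriminant group $D$, where $D\cong\mathcal{D}^k_x$ for all large $k$. "Infinite discriminant group" means that $D$ is infinite. *)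

theory Defs
  imports
    "HOL-Algebra.Algebra"
    "HOL-Algebra.Algebraic_Closure_Type"
    "HOL-Analysis.Analysis"
begin

section \<open>Locally quasi-analytic actions\<close>

text \<open>The diameter is taken in the extended reals, so that an unbounded set has diameter \<open>\<infinity>\<close>.\<close>

definition ediam :: "('x \<Rightarrow> 'x \<Rightarrow> real) \<Rightarrow> 'x set \<Rightarrow> ereal" where
  "ediam d U = (SUP p\<in>U \<times> U. ereal (d (fst p) (snd p)))"

definition LQA :: "'x set \<Rightarrow> ('x \<Rightarrow> 'x \<Rightarrow> real) \<Rightarrow> ('g, 'b) monoid_scheme \<Rightarrow> ('g \<Rightarrow> 'x \<Rightarrow> 'x) \<Rightarrow> bool" where
  "LQA M d G \<phi> \<longleftrightarrow> (\<exists>\<epsilon>>0. \<forall>U V. \<forall>g1\<in>carrier G. \<forall>g2\<in>carrier G.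
     openin (Metric_space.mtopology M d) U \<longrightarrow> ediam d U < ereal \<epsilon> \<longrightarrow>
     openin (Metric_space.mtopology M d) V \<longrightarrow> V \<noteq> {} \<longrightarrow> V \<subseteq> U \<longrightarrow>
     (\<forall>x\<in>V. \<phi> g1 x = \<phi> g2 x) \<longrightarrow> (\<forall>x\<in>U. \<phi> g1 x = \<phi> g2 x))"


section \<open>Discriminant groups\<close>

text \<open>
  In this section \<open>G\<close> is a group acting by \<open>\<phi>\<close> on the vertices of a rooted tree, and
  \<open>x = (x 0, x 1, \<dots>)\<close> is an infinite path from the root.
\<close>

definition path_stab :: "('g, 'b) monoid_scheme \<Rightarrow> ('g \<Rightarrow> 'v \<Rightarrow> 'v) \<Rightarrow> (nat \<Rightarrow> 'v) \<Rightarrow> nat \<Rightarrow> 'g set" where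
  "path_stab G \<phi> x n = stabilizer G \<phi> (x n)"

definition path_core ::
    "('g, 'b) monoid_scheme \<Rightarrow> ('g \<Rightarrow> 'v \<Rightarrow> 'v) \<Rightarrow> (nat \<Rightarrow> 'v) \<Rightarrow> nat \<Rightarrow> nat \<Rightarrow> 'g set" where
  "path_core G \<phi> x m n =
     (\<Inter>g\<in>path_stab G \<phi> x m. g <#\<^bsub>G\<^esub> path_stab G \<phi> x n #>\<^bsub>G\<^esub> inv\<^bsub>G\<^esub> g)"

definition path_quot ::
    "('g, 'b) monoid_scheme \<Rightarrow> ('g \<Rightarrow> 'v \<Rightarrow> 'v) \<Rightarrow> (nat \<Rightarrow> 'v) \<Rightarrow> nat \<Rightarrow> nat \<Rightarrow> 'g set monoid" where
  "path_quot G \<phi> x m n = G\<lparr>carrier := path_stab G \<phi> x n\<rparr> Mod path_core G \<phi> x m n"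

text \<open>
  The homomorphisms induced by inclusions \<open>G\<^sub>n\<^sub>+\<^sub>1 \<subseteq> G\<^sub>n\<close> and \<open>C\<^sup>m\<^sub>n \<subseteq> C\<^sup>k\<^sub>n\<close> send a coset \<open>A\<close> of
  the smaller normal subgroup to the coset \<open>C <#> A\<close> of the larger one \<open>C\<close>.
\<close>

definition disc_group ::
    "('g, 'b) monoid_scheme \<Rightarrow> ('g \<Rightarrow> 'v \<Rightarrow> 'v) \<Rightarrow> (nat \<Rightarrow> 'v) \<Rightarrow> nat \<Rightarrow> (nat \<Rightarrow> 'g set) monoid" where
  "disc_group G \<phi> x m = (product_group {m..} (path_quot G \<phi> x m))
     \<lparr>carrier := {s \<in> carrier (product_group {m..} (path_quot G \<phi> x m)).
        \<forall>n\<ge>m. path_core G \<phi> x m n <#>\<^bsub>G\<^esub> s (Suc n) = s n}\<rparr>"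

definition disc_map ::
    "('g, 'b) monoid_scheme \<Rightarrow> ('g \<Rightarrow> 'v \<Rightarrow> 'v) \<Rightarrow> (nat \<Rightarrow> 'v) \<Rightarrow> nat \<Rightarrow> (nat \<Rightarrow> 'g set) \<Rightarrow> nat \<Rightarrow> 'g set"
  where "disc_map G \<phi> x k s = (\<lambda>n\<in>{k..}. path_core G \<phi> x k n <#>\<^bsub>G\<^esub> s n)"

definition has_disc_group ::
    "('g, 'b) monoid_scheme \<Rightarrow> ('g \<Rightarrow> 'v \<Rightarrow> 'v) \<Rightarrow> (nat \<Rightarrow> 'v) \<Rightarrow> ('d, 'e) monoid_scheme \<Rightarrow> bool" where
  "has_disc_group G \<phi> x D \<longleftrightarrow> group D \<and> (\<exists>m0.
     (\<forall>m k. m0 \<le> m \<and> m < k \<longrightarrow>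
        disc_map G \<phi> x k \<in> iso (disc_group G \<phi> x m) (disc_group G \<phi> x k)) \<and>
     (\<forall>k\<ge>m0. D \<cong> disc_group G \<phi> x k))"


section \<open>Groups acting on a rooted tree\<close>

text \<open>
  A rooted tree is given by its levels \<open>V 0\<close>, \<open>V 1\<close>, \dots and by the map \<open>p\<close> sending a vertex of
  level \<open>n + 1\<close> to its neighbour of level \<open>n\<close>. The vertex set is the disjoint union of the levels;
  paths and stabilisers always carry the level as an index, so no tags are needed.
\<close>

definition path_space :: "(nat \<Rightarrow> 'v set) \<Rightarrow> ('v \<Rightarrow> 'v) \<Rightarrow> (nat \<Rightarrow> 'v) set" where
  "path_space V p = {v. \<forall>n. v n \<in> V n \<and> p (v (Suc n)) = v n}"

text \<open>
  Only used for two paths with the same root; the length of a common initial segment is its number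
  of edges.
\<close>

definition path_dist :: "(nat \<Rightarrow> 'v) \<Rightarrow> (nat \<Rightarrow> 'v) \<Rightarrow> real" where
  "path_dist v w = (if v = w then 0 else (1 / 2) ^ (GREATEST m. \<forall>i\<le>m. v i = w i))"

lemma path_dist_le_iff:
  assumes "v 0 = w 0"
  shows "path_dist v w \<le> (1 / 2) ^ n \<longleftrightarrow> (\<forall>i\<le>n. v i = w i)"
proof (cases "v = w")
  case False
  define P where "P m \<longleftrightarrow> (\<forall>i\<le>m. v i = w i)" for m
  obtain k where k: "v k \<noteq> w k" using False by auto
  have bd: "m \<le> k" if "P m" for m using that k unfolding P_def by (meson nat_le_linear)
  have "P 0" using assms by (simp add: P_def)
  then have G: "P (GREATEST m. P m)" by (rule GreatestI_nat) (rule bd)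
  have le: "m \<le> (GREATEST m. P m)" if "P m" for m using that bd by (rule Greatest_le_nat)
  have "path_dist v w = (1 / 2) ^ (GREATEST m. P m)" using False by (simp add: path_dist_def P_def)
  then have "path_dist v w \<le> (1 / 2) ^ n \<longleftrightarrow> n \<le> (GREATEST m. P m)" by simp
  also have "\<dots> \<longleftrightarrow> P n"
  proof
    show "P n" if "n \<le> (GREATEST m. P m)" using G that unfolding P_def by (meson le_trans)
  qed (rule le)
  finally show ?thesis by (simp add: P_def)
qed (simp add: path_dist_def)

lemma path_dist_ultrametric:
  assumes "u 0 = v 0" "v 0 = w 0"
  shows "path_dist u w \<le> max (path_dist u v) (path_dist v w)"
proof (cases "u = v \<or> v = w")
  case False
  then obtain m n where mn: "path_dist u v = (1 / 2) ^ m" "path_dist v w = (1 / 2) ^ n"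
    unfolding path_dist_def by auto
  have "\<forall>i\<le>m. u i = v i" "\<forall>i\<le>n. v i = w i"
    using path_dist_le_iff[of u v m] path_dist_le_iff[of v w n] mn assms by auto
  then have "\<forall>i\<le>min m n. u i = w i" by simp
  then have "path_dist u w \<le> (1 / 2) ^ min m n"
    using path_dist_le_iff[of u w "min m n"] assms by simp
  also have "\<dots> \<le> max ((1 / 2) ^ m) ((1 / 2) ^ n)" by (cases "m \<le> n") (auto simp: min_def)
  finally show ?thesis using mn by simp
qed (auto simp: path_dist_def)

lemma Metric_space_path_dist:
  assumes "V 0 = {root}"
  shows "Metric_space (path_space V p) path_dist"
proof
  show "0 \<le> path_dist u v" for u v :: "nat \<Rightarrow> 'a" by (simp add: path_dist_def)
  show "path_dist u v = path_dist v u" for u v :: "nat \<Rightarrow> 'a"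
    by (simp add: path_dist_def eq_commute)
  show "path_dist u v = 0 \<longleftrightarrow> u = v" for u v :: "nat \<Rightarrow> 'a" by (simp add: path_dist_def)
  fix u v w assume "u \<in> path_space V p" "v \<in> path_space V p" "w \<in> path_space V p"
  then have "u 0 \<in> V 0" "v 0 \<in> V 0" "w 0 \<in> V 0" by (simp_all add: path_space_def)
  then have "u 0 = v 0" "v 0 = w 0" using assms by simp_all
  then have "path_dist u w \<le> max (path_dist u v) (path_dist v w)" by (rule path_dist_ultrametric)
  also have "\<dots> \<le> path_dist u v + path_dist v w" by (simp add: path_dist_def)
  finally show "path_dist u w \<le> path_dist u v + path_dist v w" .
qed

definition path_act :: "('g \<Rightarrow> 'v \<Rightarrow> 'v) \<Rightarrow> 'g \<Rightarrow> (nat \<Rightarrow> 'v) \<Rightarrow> (nat \<Rightarrow> 'v)" where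
  "path_act \<phi> g v = (\<lambda>n. \<phi> g (v n))"

text \<open>
  Basic neighbourhoods of an automorphism of the tree consist of the automorphisms that agree
  with it on the first \<open>n\<close> levels.
\<close>

definition tree_dense_subgroup ::
    "(nat \<Rightarrow> 'v set) \<Rightarrow> ('g, 'b) monoid_scheme \<Rightarrow> ('g \<Rightarrow> 'v \<Rightarrow> 'v) \<Rightarrow> 'g set \<Rightarrow> bool" where
  "tree_dense_subgroup V G \<phi> H \<longleftrightarrow> subgroup H G \<and>
     (\<forall>g\<in>carrier G. \<forall>n. \<exists>h\<in>H. \<forall>j\<le>n. \<forall>v\<in>V j. \<phi> h v = \<phi> g v)"

lemma countable_generate:
  assumes "group G" "S \<subseteq> carrier G" "countable S"
  shows "countable (generate G S)"
proof -
  interpret group G by fact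
  define B where "B = S \<union> m_inv G ` S"
  have BG: "B \<subseteq> carrier G" using assms by (auto simp: B_def)
  define P where "P xs = foldr (\<otimes>\<^bsub>G\<^esub>) xs \<one>\<^bsub>G\<^esub>" for xs
  have P_closed: "P xs \<in> carrier G" if "set xs \<subseteq> B" for xs
    using that BG by (induction xs) (auto simp: P_def)
  have P_app: "P (xs @ ys) = P xs \<otimes>\<^bsub>G\<^esub> P ys" if "set xs \<subseteq> B" "set ys \<subseteq> B" for xs ys
    using that
  proof (induction xs)
    case Nil
    then show ?case using P_closed by (simp add: P_def)
  next
    case (Cons a xs)
    then have "P (a # xs @ ys) = a \<otimes>\<^bsub>G\<^esub> (P xs \<otimes>\<^bsub>G\<^esub> P ys)" by (simp add: P_def)
    also have "\<dots> = (a \<otimes>\<^bsub>G\<^esub> P xs) \<otimes>\<^bsub>G\<^esub> P ys"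
      using Cons.prems BG P_closed by (subst m_assoc) auto
    finally show ?case by (simp add: P_def)
  qed
  have P_single: "P [b] = b" if "b \<in> B" for b using that BG by (auto simp: P_def)
  have "x \<in> P ` lists B" if "x \<in> generate G S" for x
    using that
  proof induction
    case one
    have "P [] = \<one>\<^bsub>G\<^esub>" by (simp add: P_def)
    then show ?case by (metis image_eqI lists.Nil)
  next
    case (incl h)
    then show ?case using P_single[of h] by (intro image_eqI[of _ _ "[h]"]) (auto simp: B_def)
  next
    case (inv h)
    then show ?case using P_single[of "inv\<^bsub>G\<^esub> h"]
      by (intro image_eqI[of _ _ "[inv\<^bsub>G\<^esub> h]"]) (auto simp: B_def)
  next
    case (eng h1 h2)
    then obtain xs ys where "set xs \<subseteq> B" "set ys \<subseteq> B" "h1 = P xs" "h2 = P ys" by auto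
    then show ?case using P_app by (intro image_eqI[of _ _ "xs @ ys"]) auto
  qed
  moreover have "countable (P ` lists B)" using assms(3) by (simp add: B_def)
  ultimately show ?thesis by (meson countable_subset subsetI)
qed

lemma countable_dense_subgroup_exists:
  assumes "group G" and fin: "\<And>n. finite (V n)"
    and act: "\<And>g n v. g \<in> carrier G \<Longrightarrow> v \<in> V n \<Longrightarrow> \<phi> g v \<in> V n"
  shows "\<exists>H. tree_dense_subgroup V G \<phi> H \<and> countable H"
proof -
  interpret group G by fact
  define W where "W n = (\<Union>j\<le>n. V j)" for n
  define \<rho> where "\<rho> n g = restrict (\<phi> g) (W n)" for n g
  have "\<rho> n ` carrier G \<subseteq> W n \<rightarrow>\<^sub>E W n" for n
    using act unfolding \<rho>_def W_def by fastforce
  moreover have "finite (W n \<rightarrow>\<^sub>E W n)" for n using fin by (simp add: W_def finite_PiE)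
  ultimately have finR: "finite (\<rho> n ` carrier G)" for n using finite_subset by blast
  define S where "S = (\<Union>n. inv_into (carrier G) (\<rho> n) ` \<rho> n ` carrier G)"
  have SG: "S \<subseteq> carrier G" unfolding S_def by (auto intro: inv_into_into)
  have cS: "countable S" unfolding S_def using finR by (auto intro: countable_finite)
  have "\<exists>h\<in>generate G S. \<forall>j\<le>n. \<forall>v\<in>V j. \<phi> h v = \<phi> g v" if g: "g \<in> carrier G" for g n
  proof -
    define h where "h = inv_into (carrier G) (\<rho> n) (\<rho> n g)"
    have "h \<in> S" unfolding S_def h_def using g by blast
    moreover have "\<rho> n h = \<rho> n g" unfolding h_def using g by (intro f_inv_into_f) auto
    then have "\<phi> h v = \<phi> g v" if "v \<in> W n" for v using that by (metis \<rho>_def restrict_apply')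
    ultimately show ?thesis by (intro bexI[of _ h]) (auto simp: W_def intro: generate.incl)
  qed
  then have "tree_dense_subgroup V G \<phi> (generate G S)"
    using generate_is_subgroup[OF SG] by (simp add: tree_dense_subgroup_def)
  then show ?thesis using countable_generate[OF \<open>group G\<close> SG cS] by blast
qed

definition tree_LQA ::
    "(nat \<Rightarrow> 'v set) \<Rightarrow> ('v \<Rightarrow> 'v) \<Rightarrow> ('g, 'b) monoid_scheme \<Rightarrow> ('g \<Rightarrow> 'v \<Rightarrow> 'v) \<Rightarrow> bool" where
  "tree_LQA V p G \<phi> \<longleftrightarrow> LQA (path_space V p) path_dist G (path_act \<phi>)"

text \<open>
  The following notions are meant for closed level-transitive groups of tree automorphisms.
\<close>

definition tree_stable ::
    "(nat \<Rightarrow> 'v set) \<Rightarrow> ('v \<Rightarrow> 'v) \<Rightarrow> ('g, 'b) monoid_scheme \<Rightarrow> ('g \<Rightarrow> 'v \<Rightarrow> 'v) \<Rightarrow> bool" where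
  "tree_stable V p G \<phi> \<longleftrightarrow> tree_LQA V p G \<phi>"

definition tree_wild ::
    "(nat \<Rightarrow> 'v set) \<Rightarrow> ('v \<Rightarrow> 'v) \<Rightarrow> ('g, 'b) monoid_scheme \<Rightarrow> ('g \<Rightarrow> 'v \<Rightarrow> 'v) \<Rightarrow> bool" where
  "tree_wild V p G \<phi> \<longleftrightarrow> \<not> tree_stable V p G \<phi>"

text \<open>
  The discriminant group is computed from a countable dense subgroup and a path. Up to isomorphism
  neither matters; the property is required for all choices. Such subgroups exist whenever the
  levels are finite, by lemma \<open>countable_dense_subgroup_exists\<close>.
\<close>

definition tree_infinite_disc_group ::
    "(nat \<Rightarrow> 'v set) \<Rightarrow> ('v \<Rightarrow> 'v) \<Rightarrow> ('g, 'b) monoid_scheme \<Rightarrow> ('g \<Rightarrow> 'v \<Rightarrow> 'v) \<Rightarrow> bool" where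
  "tree_infinite_disc_group V p G \<phi> \<longleftrightarrow>
     (\<forall>H x. tree_dense_subgroup V G \<phi> H \<and> countable H \<and> x \<in> path_space V p \<longrightarrow>
        (\<exists>D :: (nat \<Rightarrow> 'g set) monoid.
           has_disc_group (G\<lparr>carrier := H\<rparr>) \<phi> x D \<and> infinite (carrier D)))"


section \<open>Number fields and the arithmetic iterated monodromy group\<close>

abbreviation CC :: "complex ring" where
  "CC \<equiv> ring_of_type_algebra"

definition number_field :: "complex set \<Rightarrow> bool" where
  "number_field K \<longleftrightarrow> subfield K CC \<and> ring.finite_dimension CC \<rat> K"

definition ring_of_integers :: "complex set \<Rightarrow> complex set" where
  "ring_of_integers K = {z \<in> K. algebraic_int z}"

definition iter_level :: "complex poly \<Rightarrow> complex \<Rightarrow> nat \<Rightarrow> complex set" where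
  "iter_level f t n = {z. (poly f ^^ n) z = t}"

definition base_field :: "complex set \<Rightarrow> complex \<Rightarrow> complex set" where
  "base_field K t = generate_field CC (insert t K)"

definition level_field :: "complex set \<Rightarrow> complex poly \<Rightarrow> complex \<Rightarrow> nat \<Rightarrow> complex set" where
  "level_field K f t n = generate_field CC (base_field K t \<union> iter_level f t n)"

definition tower_field :: "complex set \<Rightarrow> complex poly \<Rightarrow> complex \<Rightarrow> complex set" where
  "tower_field K f t = (\<Union>n\<in>{1..}. level_field K f t n)"

text \<open>Automorphisms are extensional functions on \<open>L\<close>, as in \<^const>\<open>BijGroup\<close>.\<close>

definition gal_group :: "complex set \<Rightarrow> complex set \<Rightarrow> (complex \<Rightarrow> complex) monoid" where
  "gal_group L F = (BijGroup L)
     \<lparr>carrier := {\<sigma> \<in> Bij L. \<sigma> \<in> ring_hom (CC\<lparr>carrier := L\<rparr>) (CC\<lparr>carrier := L\<rparr>) \<and> (\<forall>z\<in>F. \<sigma> z = z)}\<rparr>"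

definition gal_arith :: "complex set \<Rightarrow> complex poly \<Rightarrow> complex \<Rightarrow> (complex \<Rightarrow> complex) monoid" where
  "gal_arith K f t = gal_group (tower_field K f t) (base_field K t)"

abbreviation gal_arith_LQA :: "complex set \<Rightarrow> complex poly \<Rightarrow> complex \<Rightarrow> bool" where
  "gal_arith_LQA K f t \<equiv> tree_LQA (iter_level f t) (poly f) (gal_arith K f t) (\<lambda>\<sigma>. \<sigma>)"

abbreviation gal_arith_stable :: "complex set \<Rightarrow> complex poly \<Rightarrow> complex \<Rightarrow> bool" where
  "gal_arith_stable K f t \<equiv> tree_stable (iter_level f t) (poly f) (gal_arith K f t) (\<lambda>\<sigma>. \<sigma>)"

abbreviation gal_arith_wild :: "complex set \<Rightarrow> complex poly \<Rightarrow> complex \<Rightarrow> bool" where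
  "gal_arith_wild K f t \<equiv> tree_wild (iter_level f t) (poly f) (gal_arith K f t) (\<lambda>\<sigma>. \<sigma>)"

abbreviation gal_arith_infinite_disc_group :: "complex set \<Rightarrow> complex poly \<Rightarrow> complex \<Rightarrow> bool" where
  "gal_arith_infinite_disc_group K f t \<equiv>
     tree_infinite_disc_group (iter_level f t) (poly f) (gal_arith K f t) (\<lambda>\<sigma>. \<sigma>)"

definition post_critical :: "complex poly \<Rightarrow> complex \<Rightarrow> complex set" where
  "post_critical f c = {(poly f ^^ m) c | m. m \<ge> 1}"

end

theory Submission
  imports Defs
begin

text \<open>
  A relation \<open>f\<^sup>j c - w = A * G\<^sup>2\<close>, with \<open>A\<close> in \<open>K\<close> and \<open>G\<close> a product of differences of roots of
  \<open>f\<^sup>j z = w\<close> and \<open>c\<close>, shows that the tower over \<open>w\<close> ramifies at every post-critical point, and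
  it ramifies nowhere else. If \<open>q\<close> is post-critical and its reflection \<open>2 * c - q\<close> is not, then for
  transcendental \<open>u\<close> the tower over \<open>2 * c - u\<close> ramifies at \<open>u = 2 * c - q\<close>, while the tower over
  \<open>u\<close> embeds into the Laurent series in \<open>u - (2 * c - q)\<close>. So some automorphism fixes the subtree
  above \<open>u\<close> and moves the sibling subtree; letting \<open>u\<close> run through the tree, this refutes local
  quasi-analyticity at every scale. Such a \<open>q\<close> exists in the periodic case for \<open>r \<ge> 2\<close>, because \<open>f\<close> is
  injective on the orbit, and in the pre-periodic case for \<open>r \<ge> 3\<close>, because otherwise \<open>f\<close> would be
  at least two-to-one on the orbit, while it misses at most one point of it.

  In the remaining cases \<open>f\<close> is affinely conjugate to \<open>y\<^sup>2\<close> or \<open>y\<^sup>2 - 2\<close>, and the roots on level \<open>n\<close> are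
  indexed by the integers modulo \<open>2 ^ n\<close> in such a way that the Galois group acts by affine maps.
  An affine map is determined by its values on any cylinder, which gives stability. The discriminant
  group contains the stabiliser of a path, and this is infinite because \<open>\<zeta> + \<zeta>\<^sup>-\<^sup>1\<close> has unbounded
  degree for roots of unity \<open>\<zeta>\<close> of two-power order, whereas a path generates a union of purely
  transcendental extensions.
\<close>

section \<open>Subfields and extensions of homomorphisms\<close>

text \<open>\<open>t\<close> is a fixed complex number, so every field of the tower is a set of
  complex numbers, and its automorphisms have to be constructed. They come from adjoining roots one
  at a time along a countable list; the only demand on the target is that the images of the
  annihilating polynomials split there. With the complex numbers as target this yields
  automorphisms, with the Laurent series it yields the unramified embedding, so a single extension
  lemma serves ramification and Galois action alike. Ramification itself is reduced to parity: the
  parameter of the Laurent series would be a constant times a square. The reflection occurs because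
  \<open>u\<close> and \<open>2 * c - u\<close> are the two children of \<open>poly f u\<close>, so
  their subtrees are the two halves of one cylinder. In the stable cases the difficulty is that the
  discriminant group belongs to an arbitrary countable dense subgroup, which need not contain the
  automorphisms fixing the path. These enter as sequences of approximations, and agreement has to be
  tracked level by level, with a loss of precision that is the same at all levels.\<close>

definition subfld :: "'a::field set \<Rightarrow> bool" where
  "subfld F \<longleftrightarrow> 1 \<in> F \<and> (\<forall>x\<in>F. \<forall>y\<in>F. x - y \<in> F \<and> x * y \<in> F) \<and> (\<forall>x\<in>F. inverse x \<in> F)"

text \<open>A total function constrained on \<open>F\<close> only. The clause \<open>h 1 = 1\<close>
  excludes the zero map, so \<open>h\<close> is injective on a subfield.\<close>

definition fhom :: "'a::field set \<Rightarrow> ('a \<Rightarrow> 'b::field) \<Rightarrow> bool" where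
  "fhom F h \<longleftrightarrow> h 1 = 1 \<and> (\<forall>x\<in>F. \<forall>y\<in>F. h (x + y) = h x + h y \<and> h (x * y) = h x * h y)"

text \<open>Polynomials over all subfields live in one type, so passing to a larger subfield is an
  inclusion of sets.\<close>

definition pover :: "'a::field set \<Rightarrow> 'a poly set" where
  "pover F = {p. \<forall>i. Polynomial.coeff p i \<in> F}"

context
  fixes F :: "'a::field set"
  assumes F: "subfld F"
begin

lemma subfld_1: "1 \<in> F"
  and subfld_diff: "x \<in> F \<Longrightarrow> y \<in> F \<Longrightarrow> x - y \<in> F"
  and subfld_mult: "x \<in> F \<Longrightarrow> y \<in> F \<Longrightarrow> x * y \<in> F"
  and subfld_inverse: "x \<in> F \<Longrightarrow> inverse x \<in> F"
  using F by (auto simp: subfld_def)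

lemma subfld_0: "0 \<in> F"
  using subfld_diff[OF subfld_1 subfld_1] by simp

lemma subfld_uminus: "x \<in> F \<Longrightarrow> - x \<in> F"
  using subfld_diff[OF subfld_0] by fastforce

lemma subfld_add: "x \<in> F \<Longrightarrow> y \<in> F \<Longrightarrow> x + y \<in> F"
  using subfld_diff[OF _ subfld_uminus] by fastforce

lemma subfld_divide: "x \<in> F \<Longrightarrow> y \<in> F \<Longrightarrow> x / y \<in> F"
  using subfld_mult subfld_inverse by (simp add: divide_inverse)

lemma subfld_power: "x \<in> F \<Longrightarrow> x ^ n \<in> F"
  by (induction n) (auto intro: subfld_1 subfld_mult)

lemma subfld_of_nat: "of_nat n \<in> F"
  by (induction n) (auto intro: subfld_0 subfld_1 subfld_add)

lemma subfld_numeral: "numeral n \<in> F"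
  using subfld_of_nat[of "numeral n"] by simp

lemma subfld_of_int: "of_int n \<in> F"
  by (cases n) (auto intro!: subfld_of_nat subfld_uminus subfld_diff subfld_1 simp del: of_nat_Suc)

lemma subfld_power_int: "x \<in> F \<Longrightarrow> x powi n \<in> F"
  by (auto simp: power_int_def intro: subfld_power subfld_inverse)

lemma subfld_sum: "(\<And>i. i \<in> I \<Longrightarrow> g i \<in> F) \<Longrightarrow> sum g I \<in> F"
  by (induction I rule: infinite_finite_induct) (auto intro: subfld_0 subfld_add)

lemma subfld_prod_list: "set xs \<subseteq> F \<Longrightarrow> prod_list xs \<in> F"
  by (induction xs) (auto intro: subfld_1 subfld_mult)

section \<open>Polynomials with coefficients in a subfield\<close>

lemma pover_0: "0 \<in> pover F"
  by (simp add: pover_def subfld_0)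

lemma pover_pCons_iff: "pCons a p \<in> pover F \<longleftrightarrow> a \<in> F \<and> p \<in> pover F"
  by (auto simp: pover_def coeff_pCons split: nat.splits)

lemma pover_1: "1 \<in> pover F"
  by (simp add: one_pCons pover_pCons_iff subfld_1 pover_0)

lemma pover_diff: "p \<in> pover F \<Longrightarrow> q \<in> pover F \<Longrightarrow> p - q \<in> pover F"
  by (simp add: pover_def subfld_diff)

lemma pover_uminus: "p \<in> pover F \<Longrightarrow> - p \<in> pover F"
  by (simp add: pover_def subfld_uminus)

lemma pover_add: "p \<in> pover F \<Longrightarrow> q \<in> pover F \<Longrightarrow> p + q \<in> pover F"
  by (simp add: pover_def subfld_add)

lemma pover_mult: "p \<in> pover F \<Longrightarrow> q \<in> pover F \<Longrightarrow> p * q \<in> pover F"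
  by (auto simp: pover_def coeff_mult intro!: subfld_sum subfld_mult)

lemma pover_monom: "a \<in> F \<Longrightarrow> Polynomial.monom a n \<in> pover F"
  by (simp add: pover_def subfld_0)

lemma pover_const: "a \<in> F \<Longrightarrow> [:a:] \<in> pover F"
  by (simp add: pover_pCons_iff pover_0)

lemma pover_X: "[:0, 1:] \<in> pover F"
  by (simp add: pover_pCons_iff subfld_1 subfld_0 pover_0)

lemma pover_smult: "a \<in> F \<Longrightarrow> p \<in> pover F \<Longrightarrow> Polynomial.smult a p \<in> pover F"
  by (simp add: pover_def subfld_mult)

lemma pover_pderiv: "p \<in> pover F \<Longrightarrow> pderiv p \<in> pover F"
  by (simp add: pover_def Polynomial.coeff_pderiv subfld_mult subfld_of_nat del: of_nat_Suc)

lemma pover_pcompose: "p \<in> pover F \<Longrightarrow> q \<in> pover F \<Longrightarrow> pcompose p q \<in> pover F"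
  by (induction p) (auto simp: pcompose_pCons pover_pCons_iff pover_0
      intro!: pover_add pover_mult)

lemma poly_pover_in: "p \<in> pover F \<Longrightarrow> x \<in> F \<Longrightarrow> poly p x \<in> F"
  by (induction p) (auto simp: pover_pCons_iff subfld_0 intro: subfld_add subfld_mult)

text \<open>Cancelling leading terms inverts only the leading coefficient of \<open>d\<close>, so
  quotient and remainder stay over \<open>F\<close>.\<close>

lemma pover_division:
  assumes "p \<in> pover F" "d \<in> pover F" "d \<noteq> 0"
  shows "\<exists>q\<in>pover F. \<exists>r\<in>pover F. p = d * q + r \<and> (r = 0 \<or> Polynomial.degree r < Polynomial.degree d)"
  using assms(1)
proof (induction "Polynomial.degree p" arbitrary: p rule: less_induct)
  case less
  show ?case
  proof (cases "Polynomial.degree p < Polynomial.degree d \<or> p = 0")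
    case True
    then show ?thesis using less.prems pover_0 by (intro bexI[of _ 0] bexI[of _ p]) auto
  next
    case False
    define a where "a = Polynomial.lead_coeff p / Polynomial.lead_coeff d"
    define m where "m = Polynomial.monom a (Polynomial.degree p - Polynomial.degree d)"
    have aF: "a \<in> F" using less.prems assms(2) unfolding a_def by (intro subfld_divide) (auto simp: pover_def)
    have mF: "m \<in> pover F" unfolding m_def by (rule pover_monom[OF aF])
    have a0: "a \<noteq> 0" using False assms(3) by (simp add: a_def)
    have m0: "m \<noteq> 0" using a0 by (simp add: m_def)
    have dm: "Polynomial.degree m = Polynomial.degree p - Polynomial.degree d" using a0
      by (simp add: m_def Polynomial.degree_monom_eq)
    have deg: "Polynomial.degree (d * m) = Polynomial.degree p" using False m0 assms(3) dm
      by (simp add: Polynomial.degree_mult_eq)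
    have "Polynomial.lead_coeff m = a" using dm by (simp add: m_def)
    then have lc: "Polynomial.lead_coeff (d * m) = Polynomial.lead_coeff p" using assms(3)
      by (simp add: Polynomial.lead_coeff_mult a_def)
    define p' where "p' = p - d * m"
    have p': "p' \<in> pover F" unfolding p'_def
      using less.prems mF assms(2) by (intro pover_diff pover_mult)
    have c0: "Polynomial.coeff p' (Polynomial.degree p) = 0" using lc deg by (simp add: p'_def)
    have le: "Polynomial.degree p' \<le> Polynomial.degree p" unfolding p'_def
      by (rule degree_diff_le) (simp_all add: deg)
    show ?thesis
    proof (cases "p' = 0")
      case True
      then show ?thesis using mF pover_0 by (intro bexI[of _ m] bexI[of _ 0]) (auto simp: p'_def)
    next
      case F': False
      then have "Polynomial.degree p' < Polynomial.degree p"
        using c0 le by (metis leading_coeff_0_iff le_neq_implies_less)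
      then obtain q r where qr: "q \<in> pover F" "r \<in> pover F" "p' = d * q + r"
        "r = 0 \<or> Polynomial.degree r < Polynomial.degree d"
        using less.hyps[OF _ p'] by blast
      have "p = d * (q + m) + r" using qr(3) by (simp add: p'_def algebra_simps)
      then show ?thesis using qr mF pover_add by blast
    qed
  qed
qed

lemma minimal_poly_exists:
  assumes "P \<in> pover F" "P \<noteq> 0" "poly P \<alpha> = 0"
  obtains Q where "Q \<in> pover F" "Polynomial.lead_coeff Q = 1" "poly Q \<alpha> = 0"
    "\<And>R. R \<in> pover F \<Longrightarrow> poly R \<alpha> = 0 \<Longrightarrow> Polynomial.degree R < Polynomial.degree Q \<Longrightarrow> R = 0"
proof -
  define S where "S R \<longleftrightarrow> R \<in> pover F \<and> R \<noteq> 0 \<and> poly R \<alpha> = 0" for R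
  obtain R where R: "S R" "\<And>R'. S R' \<Longrightarrow> Polynomial.degree R \<le> Polynomial.degree R'"
    using exists_least_iff[of "\<lambda>n. \<exists>R. S R \<and> Polynomial.degree R = n"] assms
    by (metis S_def not_le)
  define Q where "Q = Polynomial.smult (inverse (Polynomial.lead_coeff R)) R"
  have "R \<noteq> 0" using R by (simp add: S_def)
  then have dQ: "Polynomial.degree Q = Polynomial.degree R" "Polynomial.lead_coeff Q = 1"
    by (simp_all add: Q_def)
  show ?thesis
  proof (rule that)
    show "Q \<in> pover F" unfolding Q_def using R(1)
      by (intro pover_smult subfld_inverse) (auto simp: S_def pover_def)
    show "Polynomial.lead_coeff Q = 1" by fact
    show "poly Q \<alpha> = 0" using R(1) by (simp add: Q_def S_def)
    show "R' = 0" if "R' \<in> pover F" "poly R' \<alpha> = 0" "Polynomial.degree R' < Polynomial.degree Q" for R'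
      using that R(2)[of R'] dQ by (auto simp: S_def)
  qed
qed

section \<open>Simple algebraic extensions\<close>

definition adjoin :: "'a \<Rightarrow> 'a set" where
  "adjoin \<alpha> = {poly p \<alpha> | p. p \<in> pover F}"

lemma adjoin_base: "F \<subseteq> adjoin \<alpha>"
proof
  fix x assume "x \<in> F"
  then have "[:x:] \<in> pover F" "poly [:x:] \<alpha> = x" by (simp_all add: pover_const)
  then show "x \<in> adjoin \<alpha>" unfolding adjoin_def by (metis (mono_tags, lifting) mem_Collect_eq)
qed

lemma adjoin_mem: "\<alpha> \<in> adjoin \<alpha>"
proof -
  have "poly [:0, 1:] \<alpha> = \<alpha>" by simp
  then show ?thesis unfolding adjoin_def using pover_X by (metis (mono_tags, lifting) mem_Collect_eq)
qed

text \<open>Closure under inverses is a descent on the degree: dividing the minimal polynomial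
  \<open>Q\<close> by \<open>p\<close> gives \<open>Q = p * q + r\<close>, so at
  \<open>\<alpha>\<close> the value of \<open>r\<close> is minus that of \<open>p * q\<close>. As
  \<open>q\<close> has smaller degree than \<open>Q\<close>, it does not vanish at
  \<open>\<alpha>\<close>, and an inverse for \<open>r\<close> yields one for
  \<open>p\<close>.\<close>

lemma subfld_adjoin:
  assumes "P \<in> pover F" "P \<noteq> 0" "poly P \<alpha> = 0"
  shows "subfld (adjoin \<alpha>)"
proof -
  obtain Q where Q: "Q \<in> pover F" "Polynomial.lead_coeff Q = 1" "poly Q \<alpha> = 0"
    and min: "\<And>R. R \<in> pover F \<Longrightarrow> poly R \<alpha> = 0 \<Longrightarrow> Polynomial.degree R < Polynomial.degree Q \<Longrightarrow> R = 0"
    by (rule minimal_poly_exists[OF assms]) blast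
  have Q0: "Q \<noteq> 0" using Q(2) by auto
  have inv: "\<exists>q\<in>pover F. poly p \<alpha> * poly q \<alpha> = 1"
    if "p \<in> pover F" "poly p \<alpha> \<noteq> 0" "Polynomial.degree p < Polynomial.degree Q" for p
    using that
  proof (induction "Polynomial.degree p" arbitrary: p rule: less_induct)
    case less
    have p0: "p \<noteq> 0" using less.prems by auto
    show ?case
    proof (cases "Polynomial.degree p = 0")
      case True
      then obtain a where a: "p = [:a:]" using degree_eq_zeroE by blast
      then have "a \<in> F" "a \<noteq> 0" using less.prems by (auto simp: pover_pCons_iff)
      then have "[:inverse a:] \<in> pover F" "poly p \<alpha> * poly [:inverse a:] \<alpha> = 1"
        using a by (auto intro: pover_const subfld_inverse)
      then show ?thesis by blast
    next
      case False
      obtain q r where qr: "q \<in> pover F" "r \<in> pover F" "Q = p * q + r"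
        "r = 0 \<or> Polynomial.degree r < Polynomial.degree p"
        using pover_division[OF Q(1) less.prems(1) p0] by blast
      have e: "poly r \<alpha> = - (poly p \<alpha> * poly q \<alpha>)"
        using Q(3) qr(3) by (simp add: eq_neg_iff_add_eq_0 add.commute)
      have q0: "q \<noteq> 0" using qr less.prems(3) Q0 by auto
      have dpq: "Polynomial.degree (p * q) = Polynomial.degree p + Polynomial.degree q"
        by (simp add: Polynomial.degree_mult_eq p0 q0)
      have "Polynomial.degree Q = Polynomial.degree (p * q)"
      proof (cases "r = 0")
        case False
        then have "Polynomial.degree r < Polynomial.degree (p * q)" using qr(4) dpq by linarith
        then show ?thesis unfolding qr(3) by (rule degree_add_eq_left)
      qed (simp add: qr(3))
      then have "Polynomial.degree q < Polynomial.degree Q" using dpq False by linarith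
      then have "poly q \<alpha> \<noteq> 0" using min[OF qr(1)] q0 by blast
      then have r0: "poly r \<alpha> \<noteq> 0" using e less.prems by simp
      then have "Polynomial.degree r < Polynomial.degree p" using qr(4) by auto
      then obtain s where s: "s \<in> pover F" "poly r \<alpha> * poly s \<alpha> = 1"
        using less.hyps[OF _ qr(2) r0] less.prems(3) by auto
      have "poly p \<alpha> * poly (- (q * s)) \<alpha> = 1" using s(2) e by (simp add: algebra_simps)
      moreover have "- (q * s) \<in> pover F" using s(1) qr(1) by (intro pover_uminus pover_mult)
      ultimately show ?thesis by blast
    qed
  qed
  have "inverse (poly p \<alpha>) \<in> adjoin \<alpha>" if p: "p \<in> pover F" for p
  proof (cases "poly p \<alpha> = 0")
    case True
    then show ?thesis using subfld_0 adjoin_base by auto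
  next
    case False
    obtain q r where qr: "q \<in> pover F" "r \<in> pover F" "p = Q * q + r"
      "r = 0 \<or> Polynomial.degree r < Polynomial.degree Q"
      using pover_division[OF p Q(1) Q0] by blast
    have e: "poly p \<alpha> = poly r \<alpha>" using qr(3) Q(3) by simp
    obtain s where s: "s \<in> pover F" "poly r \<alpha> * poly s \<alpha> = 1"
      using inv[OF qr(2)] e False qr(4) by auto
    have "inverse (poly p \<alpha>) = poly s \<alpha>" using s(2) e by (simp add: inverse_unique)
    then show ?thesis using s(1) by (auto simp: adjoin_def)
  qed
  moreover have "poly p \<alpha> - poly q \<alpha> \<in> adjoin \<alpha> \<and> poly p \<alpha> * poly q \<alpha> \<in> adjoin \<alpha>"
    if "p \<in> pover F" "q \<in> pover F" for p q
    unfolding adjoin_def using pover_diff[OF that] pover_mult[OF that]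
    by (metis (mono_tags, lifting) mem_Collect_eq poly_diff poly_mult)
  moreover have "1 \<in> adjoin \<alpha>" using subfld_1 adjoin_base by auto
  ultimately show ?thesis unfolding subfld_def by (auto simp: adjoin_def)
qed

context
  fixes h :: "'a \<Rightarrow> 'b::field"
  assumes h: "fhom F h"
begin

lemma fhom_1: "h 1 = 1"
  and fhom_add: "x \<in> F \<Longrightarrow> y \<in> F \<Longrightarrow> h (x + y) = h x + h y"
  and fhom_mult: "x \<in> F \<Longrightarrow> y \<in> F \<Longrightarrow> h (x * y) = h x * h y"
  using h by (auto simp: fhom_def)

lemma fhom_0: "h 0 = 0"
  by (metis add.right_neutral add_cancel_left_left fhom_add subfld_0)

lemma fhom_uminus: "x \<in> F \<Longrightarrow> h (- x) = - h x"
  using fhom_add[OF _ subfld_uminus, of x x] fhom_0 by (simp add: eq_neg_iff_add_eq_0 add.commute)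

lemma fhom_diff: "x \<in> F \<Longrightarrow> y \<in> F \<Longrightarrow> h (x - y) = h x - h y"
  using fhom_add[OF _ subfld_uminus, of x y] fhom_uminus[of y] by simp

lemma fhom_nonzero: "x \<in> F \<Longrightarrow> x \<noteq> 0 \<Longrightarrow> h x \<noteq> 0"
  using fhom_mult[of x "inverse x"] subfld_inverse[of x] fhom_1 by auto

lemma fhom_eq_iff: "x \<in> F \<Longrightarrow> y \<in> F \<Longrightarrow> h x = h y \<longleftrightarrow> x = y"
  using fhom_nonzero[of "x - y"] fhom_diff subfld_diff by fastforce

lemma fhom_inverse: "x \<in> F \<Longrightarrow> h (inverse x) = inverse (h x)"
  using fhom_mult[of x "inverse x"] subfld_inverse[of x] fhom_1 fhom_0
  by (cases "x = 0") (auto simp: inverse_unique[symmetric])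

lemma fhom_power: "x \<in> F \<Longrightarrow> h (x ^ n) = h x ^ n"
  by (induction n) (auto simp: fhom_1 fhom_mult subfld_power)

lemma fhom_power_int: "x \<in> F \<Longrightarrow> h (x powi n) = h x powi n"
  by (auto simp: power_int_def fhom_power fhom_inverse subfld_power subfld_inverse)

lemma fhom_of_nat: "h (of_nat n) = of_nat n"
  by (induction n) (auto simp: fhom_0 fhom_1 fhom_add subfld_1 subfld_of_nat)

lemma fhom_sum: "(\<And>i. i \<in> I \<Longrightarrow> g i \<in> F) \<Longrightarrow> h (sum g I) = (\<Sum>i\<in>I. h (g i))"
  by (induction I rule: infinite_finite_induct) (auto simp: fhom_0 fhom_add subfld_sum)

lemma coeff_map_fhom [simp]: "Polynomial.coeff (map_poly h p) i = h (Polynomial.coeff p i)"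
  by (simp add: coeff_map_poly fhom_0)

lemma map_fhom_add: "p \<in> pover F \<Longrightarrow> q \<in> pover F \<Longrightarrow> map_poly h (p + q) = map_poly h p + map_poly h q"
  by (rule poly_eqI) (auto simp: fhom_add pover_def)

lemma map_fhom_diff: "p \<in> pover F \<Longrightarrow> q \<in> pover F \<Longrightarrow> map_poly h (p - q) = map_poly h p - map_poly h q"
  by (rule poly_eqI) (auto simp: fhom_diff pover_def)

lemma map_fhom_mult: "p \<in> pover F \<Longrightarrow> q \<in> pover F \<Longrightarrow> map_poly h (p * q) = map_poly h p * map_poly h q"
  by (rule poly_eqI) (auto simp: coeff_mult fhom_sum fhom_mult subfld_mult pover_def)

lemma map_fhom_pCons: "map_poly h (pCons a p) = pCons (h a) (map_poly h p)"
  by (rule poly_eqI) (auto simp: coeff_pCons split: nat.splits)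

lemma degree_map_fhom: "p \<in> pover F \<Longrightarrow> Polynomial.degree (map_poly h p) = Polynomial.degree p"
proof (rule antisym)
  assume p: "p \<in> pover F"
  show "Polynomial.degree p \<le> Polynomial.degree (map_poly h p)"
  proof (cases "p = 0")
    case False
    then have "h (Polynomial.lead_coeff p) \<noteq> 0"
      using p by (intro fhom_nonzero) (auto simp: pover_def)
    then show ?thesis by (intro le_degree) simp
  qed simp
qed (auto intro!: degree_le simp: Polynomial.coeff_eq_0 fhom_0)

lemma map_fhom_nonzero:
  assumes "p \<in> pover F" "p \<noteq> 0"
  shows "map_poly h p \<noteq> 0"
proof -
  have "h (Polynomial.lead_coeff p) \<noteq> 0"
    using assms by (intro fhom_nonzero) (auto simp: pover_def)
  then show ?thesis by (metis coeff_0 coeff_map_fhom)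
qed

lemma poly_map_fhom: "p \<in> pover F \<Longrightarrow> x \<in> F \<Longrightarrow> poly (map_poly h p) (h x) = h (poly p x)"
  by (induction p)
     (auto simp: map_fhom_pCons pover_pCons_iff fhom_0 fhom_add fhom_mult subfld_mult poly_pover_in)

lemma map_fhom_prod_linear:
  "set xs \<subseteq> F \<Longrightarrow> map_poly h (\<Prod>x\<leftarrow>xs. [:- x, 1:]) = (\<Prod>x\<leftarrow>xs. [:- h x, 1:])"
  and pover_prod_linear: "set xs \<subseteq> F \<Longrightarrow> (\<Prod>x\<leftarrow>xs. [:- x, 1:]) \<in> pover F"
proof (induction xs)
  case (Cons a xs)
  { case 1
    then show ?case using Cons
      by (subst list.simps, subst prod_list.Cons, subst map_fhom_mult)
         (auto simp: map_fhom_pCons pover_pCons_iff pover_0 subfld_uminus subfld_1 fhom_1 fhom_uminus)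
  next
    case 2
    then show ?case using Cons
      by (subst list.simps, subst prod_list.Cons, intro pover_mult)
         (auto simp: pover_pCons_iff pover_0 subfld_uminus subfld_1) }
qed (auto simp: pover_1[unfolded one_pCons] fhom_1 one_pCons map_fhom_pCons)

lemma simple_extension_hom:
  assumes Q: "Q \<in> pover F" "Polynomial.lead_coeff Q = 1" "poly Q \<alpha> = 0"
    and min: "\<And>R. R \<in> pover F \<Longrightarrow> poly R \<alpha> = 0 \<Longrightarrow> Polynomial.degree R < Polynomial.degree Q \<Longrightarrow> R = 0"
    and \<beta>: "poly (map_poly h Q) \<beta> = 0"
  shows "\<exists>g. fhom (adjoin \<alpha>) g \<and> (\<forall>x\<in>F. g x = h x) \<and> g \<alpha> = \<beta>"
proof -
  have Q0: "Q \<noteq> 0" using Q(2) by auto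
  have van: "poly (map_poly h p) \<beta> = 0" if p: "p \<in> pover F" "poly p \<alpha> = 0" for p
  proof -
    obtain q r where qr: "q \<in> pover F" "r \<in> pover F" "p = Q * q + r"
      "r = 0 \<or> Polynomial.degree r < Polynomial.degree Q"
      using pover_division[OF p(1) Q(1) Q0] by blast
    have "poly r \<alpha> = 0" using qr(3) p(2) Q(3) by simp
    then have "r = 0" using min[OF qr(2)] qr(4) by blast
    then have "map_poly h p = map_poly h Q * map_poly h q" using qr(3) map_fhom_mult[OF Q(1) qr(1)] by simp
    then show ?thesis using \<beta> by simp
  qed
  \<comment> \<open>\<open>SOME\<close> picks any polynomial representing \<open>x\<close>;
    \<open>van\<close> makes the value independent of the choice.\<close>
  define g where "g x = poly (map_poly h (SOME p. p \<in> pover F \<and> poly p \<alpha> = x)) \<beta>" for x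
  have g: "g (poly p \<alpha>) = poly (map_poly h p) \<beta>" if p: "p \<in> pover F" for p
  proof -
    define q where "q = (SOME q. q \<in> pover F \<and> poly q \<alpha> = poly p \<alpha>)"
    have q: "q \<in> pover F \<and> poly q \<alpha> = poly p \<alpha>" unfolding q_def by (rule someI[of _ p]) (use p in auto)
    then have "poly (map_poly h (q - p)) \<beta> = 0" using p by (intro van pover_diff) auto
    then show ?thesis using q p by (simp add: g_def q_def[symmetric] map_fhom_diff)
  qed
  have gF: "g x = h x" if "x \<in> F" for x
    using g[OF pover_const[OF that]] by (simp add: map_fhom_pCons)
  have "g \<alpha> = \<beta>" using g[OF pover_X] by (simp add: map_fhom_pCons fhom_0 fhom_1)
  moreover have "g (poly p \<alpha> + poly q \<alpha>) = g (poly p \<alpha>) + g (poly q \<alpha>) \<and>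
      g (poly p \<alpha> * poly q \<alpha>) = g (poly p \<alpha>) * g (poly q \<alpha>)"
    if "p \<in> pover F" "q \<in> pover F" for p q
    using g[OF pover_add[OF that]] g[OF pover_mult[OF that]] that
    by (simp add: g map_fhom_add map_fhom_mult)
  then have "fhom (adjoin \<alpha>) g"
    using gF[OF subfld_1] fhom_1 by (auto simp: fhom_def adjoin_def)
  ultimately show ?thesis using gF by blast
qed

end
end

section \<open>Extension of homomorphisms to countably many algebraic elements\<close>

definition splits :: "'a::field poly \<Rightarrow> bool" where
  "splits R \<longleftrightarrow> (\<exists>a bs. a \<noteq> 0 \<and> R = Polynomial.smult a (\<Prod>b\<leftarrow>bs. [:- b, 1:]))"

text \<open>Stands in for algebraic closedness, which the Laurent series do not have. If
  \<open>D\<close> had no root, every linear factor would divide the cofactor and could be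
  cancelled, until \<open>D\<close> divides 1.\<close>

lemma splits_dvd_root:
  assumes "splits R" "D dvd R" "Polynomial.degree D > 0"
  shows "\<exists>b. poly D b = 0"
proof (rule ccontr)
  assume no: "\<not> ?thesis"
  obtain a bs where a: "a \<noteq> 0" "R = Polynomial.smult a (\<Prod>b\<leftarrow>bs. [:- b, 1:])"
    using assms(1) by (auto simp: splits_def)
  have "D dvd (\<Prod>b\<leftarrow>bs. [:- b, 1:])" using assms(2) a by (simp add: dvd_smult_iff)
  then show False
  proof (induction bs)
    case Nil
    then show False using assms(3) by (auto dest: Polynomial.dvd_imp_degree_le)
  next
    case (Cons b bs)
    then obtain E where E: "[:- b, 1:] * (\<Prod>b\<leftarrow>bs. [:- b, 1:]) = D * E" by (auto elim: dvdE)
    have "poly D b * poly E b = poly ([:- b, 1:] * (\<Prod>b\<leftarrow>bs. [:- b, 1:])) b" by (simp only: E poly_mult)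
    also have "\<dots> = 0" by simp
    finally have "poly E b = 0" using no by auto
    then obtain E' where "E = [:- b, 1:] * E'" using poly_eq_0_iff_dvd by (metis dvdE)
    with E have "[:- b, 1:] * (\<Prod>b\<leftarrow>bs. [:- b, 1:]) = [:- b, 1:] * (D * E')" by (simp only: ac_simps)
    then have "(\<Prod>b\<leftarrow>bs. [:- b, 1:]) = D * E'" by (subst (asm) mult_cancel_left) auto
    then show False using Cons.IH by simp
  qed
qed

lemma complex_poly_splits:
  fixes R :: "complex poly"
  assumes "R \<noteq> 0"
  shows "splits R"
  using assms
proof (induction "Polynomial.degree R" arbitrary: R)
  case 0
  then obtain a where "R = [:a:]" by (metis degree_eq_zeroE)
  then show ?case using 0 unfolding splits_def by (intro exI[of _ a] exI[of _ "[]"]) auto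
next
  case (Suc n)
  then have "\<not> constant (poly R)" by (simp add: constant_degree)
  then obtain b where "poly R b = 0" using fundamental_theorem_of_algebra by blast
  then obtain R' where R': "R = [:- b, 1:] * R'" using poly_eq_0_iff_dvd by (metis dvdE)
  then have "R' \<noteq> 0" using Suc.prems by auto
  then have "Polynomial.degree R = Suc (Polynomial.degree R')" unfolding R' by (subst Polynomial.degree_mult_eq) auto
  then obtain a bs where "a \<noteq> 0" "R' = Polynomial.smult a (\<Prod>b\<leftarrow>bs. [:- b, 1:])"
    using Suc.hyps \<open>R' \<noteq> 0\<close> unfolding splits_def by (metis nat.inject)
  then show ?case unfolding splits_def R' by (intro exI[of _ a] exI[of _ "b # bs"]) auto
qed

lemma pover_mono: "F \<subseteq> E \<Longrightarrow> pover F \<subseteq> pover E"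
  by (auto simp: pover_def)

lemma fhom_mono: "fhom E h \<Longrightarrow> F \<subseteq> E \<Longrightarrow> fhom F h"
  by (auto simp: fhom_def)

lemma subfld_chain_UN:
  assumes E: "\<And>n::nat. subfld (E n)" and mono: "\<And>m n. m \<le> n \<Longrightarrow> E m \<subseteq> E n"
  shows "subfld (\<Union>n. E n)"
  unfolding subfld_def
proof (intro conjI ballI)
  show "1 \<in> (\<Union>n. E n)" using subfld_1[OF E] by auto
  show "inverse x \<in> (\<Union>n. E n)" if "x \<in> (\<Union>n. E n)" for x using that subfld_inverse[OF E] by auto
  fix x y assume "x \<in> (\<Union>n. E n)" "y \<in> (\<Union>n. E n)"
  then obtain m n where "x \<in> E m" "y \<in> E n" by auto
  then have n: "x \<in> E (max m n)" "y \<in> E (max m n)"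
    using mono[of m "max m n"] mono[of n "max m n"] by auto
  show "x - y \<in> (\<Union>n. E n)" using subfld_diff[OF E n] by auto
  show "x * y \<in> (\<Union>n. E n)" using subfld_mult[OF E n] by auto
qed

text \<open>The annihilating polynomial has coefficients in the initial \<open>F\<close>, so its
  image is the same at every stage and its splitting concerns \<open>h\<close> alone. The minimal
  polynomial over \<open>E\<close> divides it, so the image of the minimal polynomial has a root to
  which \<open>\<alpha>\<close> can be sent.\<close>

lemma hom_extension_step:
  assumes F: "subfld F" and h: "fhom F h" and E: "subfld E" "F \<subseteq> E" and g: "fhom E g" "\<forall>x\<in>F. g x = h x"
    and P: "P \<in> pover F" "P \<noteq> 0" "poly P \<alpha> = 0" "splits (map_poly h P)"
  shows "\<exists>E' g'. subfld E' \<and> E \<subseteq> E' \<and> \<alpha> \<in> E' \<and> fhom E' g' \<and> (\<forall>x\<in>E. g' x = g x)"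
proof -
  have PE: "P \<in> pover E" using P(1) pover_mono[OF E(2)] by auto
  obtain Q where Q: "Q \<in> pover E" "Polynomial.lead_coeff Q = 1" "poly Q \<alpha> = 0"
    and min: "\<And>R. R \<in> pover E \<Longrightarrow> poly R \<alpha> = 0 \<Longrightarrow> Polynomial.degree R < Polynomial.degree Q \<Longrightarrow> R = 0"
    by (rule minimal_poly_exists[OF E(1) PE P(2,3)]) blast
  have Q0: "Q \<noteq> 0" using Q(2) by auto
  obtain q r where qr: "q \<in> pover E" "r \<in> pover E" "P = Q * q + r"
    "r = 0 \<or> Polynomial.degree r < Polynomial.degree Q"
    using pover_division[OF E(1) PE Q(1) Q0] by blast
  have "poly r \<alpha> = 0" using qr(3) P(3) Q(3) by simp
  then have "r = 0" using min[OF qr(2)] qr(4) by blast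
  then have "map_poly g P = map_poly g Q * map_poly g q"
    using qr(3) map_fhom_mult[OF E(1) g(1) Q(1) qr(1)] by simp
  moreover have "map_poly g P = map_poly h P"
    using P(1) g(2) by (intro poly_eqI) (auto simp: coeff_map_fhom[OF F h] coeff_map_fhom[OF E(1) g(1)] pover_def)
  ultimately have "map_poly g Q dvd map_poly h P" by (metis dvd_triv_left)
  moreover have "Polynomial.degree Q > 0"
  proof (rule ccontr)
    assume "\<not> ?thesis"
    then obtain b where "Q = [:b:]" using degree_eq_zeroE by auto
    then show False using Q by auto
  qed
  then have "Polynomial.degree (map_poly g Q) > 0" using degree_map_fhom[OF E(1) g(1) Q(1)] by simp
  ultimately obtain \<beta> where "poly (map_poly g Q) \<beta> = 0" using splits_dvd_root[OF P(4)] by blast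
  then obtain g' where "fhom (adjoin E \<alpha>) g'" "\<forall>x\<in>E. g' x = g x"
    using simple_extension_hom[OF E(1) g(1) Q min] by blast
  then show ?thesis
    using subfld_adjoin[OF E(1) PE P(2,3)] adjoin_base[OF E(1)] adjoin_mem[OF E(1)] by blast
qed

lemma hom_extension:
  fixes h :: "'a::field \<Rightarrow> 'b::field"
  assumes F: "subfld F" and h: "fhom F h" and A: "countable A"
    and P: "\<And>\<alpha>. \<alpha> \<in> A \<Longrightarrow> \<exists>P\<in>pover F. P \<noteq> 0 \<and> poly P \<alpha> = 0 \<and> splits (map_poly h P)"
  obtains E g where "subfld E" "F \<subseteq> E" "A \<subseteq> E" "fhom E g" "\<And>x. x \<in> F \<Longrightarrow> g x = h x"
proof (cases "A = {}")
  case True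
  show ?thesis by (rule that[of F h]) (use F h True in auto)
next
  case False
  define e where "e = from_nat_into A"
  have e: "e n \<in> A" for n using False by (simp add: e_def from_nat_into)
  have range_e: "range e = A" using A False by (simp add: e_def range_from_nat_into)
  \<comment> \<open>States are pairs of a subfield and a homomorphism on it; step \<open>n\<close>
    adjoins the \<open>n\<close>-th element of the enumeration.\<close>
  define I where "I s \<longleftrightarrow> subfld (fst s) \<and> F \<subseteq> fst s \<and> fhom (fst s) (snd s) \<and> (\<forall>x\<in>F. snd s x = h x)" for s :: "'a set \<times> ('a \<Rightarrow> 'b)"
  define S where "S n s s' \<longleftrightarrow> fst s \<subseteq> fst s' \<and> e n \<in> fst s' \<and> (\<forall>x\<in>fst s. snd s' x = snd s x)"
    for n and s s' :: "'a set \<times> ('a \<Rightarrow> 'b)"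
  have I0: "I (F, h)" using F h by (simp add: I_def)
  have step: "\<exists>s'. I s' \<and> S n s s'" if "I s" for s n
  proof -
    obtain P where "P \<in> pover F" "P \<noteq> 0" "poly P (e n) = 0" "splits (map_poly h P)"
      using P[OF e[of n]] by blast
    then obtain E' g' where "subfld E'" "fst s \<subseteq> E'" "e n \<in> E'" "fhom E' g'" "\<forall>x\<in>fst s. g' x = snd s x"
      using hom_extension_step[OF F h, of "fst s" "snd s"] \<open>I s\<close> unfolding I_def by metis
    then have "I (E', g') \<and> S n s (E', g')" using \<open>I s\<close> by (auto simp: I_def S_def)
    then show ?thesis by blast
  qed
  obtain s where s: "\<And>n. I (s n)" "\<And>n. S n (s n) (s (Suc n))"
    using dependent_nat_choice[of "\<lambda>_. I" S] I0 step by metis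
  define E where "E n = fst (s n)" for n
  define g where "g n = snd (s n)" for n
  have E: "subfld (E n)" "F \<subseteq> E n" "fhom (E n) (g n)" "\<And>x. x \<in> F \<Longrightarrow> g n x = h x" for n
    using s(1)[of n] by (auto simp: I_def E_def g_def)
  have suc: "E n \<subseteq> E (Suc n)" "e n \<in> E (Suc n)" "\<And>x. x \<in> E n \<Longrightarrow> g (Suc n) x = g n x" for n
    using s(2)[of n] by (auto simp: S_def E_def g_def)
  have mono: "E m \<subseteq> E n" if "m \<le> n" for m n using suc(1) that by (rule lift_Suc_mono_le)
  have agree: "g n x = g m x" if "m \<le> n" "x \<in> E m" for m n x
    using that(1)
  proof (induction n rule: dec_induct)
    case (step i)
    then show ?case using suc(3)[of x i] mono[of m i] that(2) by auto
  qed simp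
  \<comment> \<open>The limit map reads off the first stage containing \<open>x\<close>; by
    \<open>agree\<close> all later stages give the same value.\<close>
  define G where "G x = g (LEAST n. x \<in> E n) x" for x
  have G: "G x = g n x" if "x \<in> E n" for n x
    using agree[of "LEAST n. x \<in> E n" n x] Least_le[of "\<lambda>n. x \<in> E n", OF that]
      LeastI[of "\<lambda>n. x \<in> E n", OF that] by (simp add: G_def)
  have two: "\<exists>n. x \<in> E n \<and> y \<in> E n" if "x \<in> (\<Union>n. E n)" "y \<in> (\<Union>n. E n)" for x y
  proof -
    obtain m n where "x \<in> E m" "y \<in> E n" using \<open>x \<in> _\<close> \<open>y \<in> _\<close> by auto
    then show ?thesis using mono[of m "max m n"] mono[of n "max m n"] by auto
  qed
  show ?thesis
  proof (rule that)
    show "subfld (\<Union>n. E n)" by (rule subfld_chain_UN[OF E(1) mono])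
    show "F \<subseteq> (\<Union>n. E n)" using E(2) by auto
    show "A \<subseteq> (\<Union>n. E n)" unfolding range_e[symmetric] using suc(2) by auto
    have "G (x + y) = G x + G y \<and> G (x * y) = G x * G y"
      if xy: "x \<in> (\<Union>n. E n)" "y \<in> (\<Union>n. E n)" for x y
    proof -
      obtain n where n: "x \<in> E n" "y \<in> E n" using two[OF xy] by blast
      then show ?thesis
        using G[OF n(1)] G[OF n(2)] G[OF subfld_add[OF E(1) n]] G[OF subfld_mult[OF E(1) n]]
          fhom_add[OF E(1) E(3) n] fhom_mult[OF E(1) E(3) n] by simp
    qed
    moreover have "G 1 = 1" using G[OF subfld_1[OF E(1)], of 0] fhom_1[OF E(1) E(3)] by simp
    ultimately show "fhom (\<Union>n. E n) G" unfolding fhom_def by blast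
    show "G x = h x" if "x \<in> F" for x using G[of x 0] E(2,4) that by auto
  qed
qed

lemma conjugate_exists:
  fixes E :: "complex set"
  assumes E: "subfld E" and P: "P \<in> pover E" "P \<noteq> 0" "poly P \<alpha> = 0" and \<alpha>: "\<alpha> \<notin> E"
  obtains E' g where "subfld E'" "E \<subseteq> E'" "\<alpha> \<in> E'" "fhom E' g" "\<And>x. x \<in> E \<Longrightarrow> g x = (x :: complex)" "g \<alpha> \<noteq> \<alpha>"
proof -
  obtain Q where Q: "Q \<in> pover E" "Polynomial.lead_coeff Q = 1" "poly Q \<alpha> = 0"
    and min: "\<And>R. R \<in> pover E \<Longrightarrow> poly R \<alpha> = 0 \<Longrightarrow> Polynomial.degree R < Polynomial.degree Q \<Longrightarrow> R = 0"
    by (rule minimal_poly_exists[OF E P]) blast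
  obtain R where R: "Q = [:- \<alpha>, 1:] * R" using Q(3) poly_eq_0_iff_dvd by (metis dvdE)
  have Q0: "Q \<noteq> 0" using Q(2) by auto
  then have R0: "R \<noteq> 0" using R by auto
  have dQ: "Polynomial.degree Q = Suc (Polynomial.degree R)"
    unfolding R using R0 by (subst Polynomial.degree_mult_eq) auto
  have lR: "Polynomial.lead_coeff R = 1" using Q(2) unfolding R Polynomial.lead_coeff_mult by simp
  have "Polynomial.degree R \<noteq> 0"
  proof
    assume "Polynomial.degree R = 0"
    then have "R = 1" using lR by (metis degree_eq_zeroE lead_coeff_pCons(2) one_pCons)
    then have "Q = [:- \<alpha>, 1:]" using R by simp
    then have "- \<alpha> \<in> E" using Q(1) pover_pCons_iff[OF E] by simp
    then show False using subfld_uminus[OF E] \<alpha> by fastforce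
  qed
  then have "\<not> constant (poly R)" by (simp add: constant_degree)
  then obtain \<beta> where \<beta>: "poly R \<beta> = 0" using fundamental_theorem_of_algebra by blast
  \<comment> \<open>Separability: in characteristic zero the derivative is nonzero and of smaller
    degree than \<open>Q\<close>, so it cannot vanish at \<open>\<alpha>\<close>. Hence the root
    \<open>\<beta>\<close> of the cofactor differs from \<open>\<alpha>\<close>.\<close>
  have "poly (pderiv Q) \<alpha> \<noteq> 0"
  proof
    assume "poly (pderiv Q) \<alpha> = 0"
    then have "pderiv Q = 0" using min[OF pover_pderiv[OF E Q(1)]] dQ Polynomial.degree_pderiv[of Q] by simp
    then show False using dQ by (simp add: pderiv_eq_0_iff)
  qed
  then have "poly R \<alpha> \<noteq> 0" unfolding R pderiv_mult by simp
  then have "\<beta> \<noteq> \<alpha>" using \<beta> by auto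
  have id: "fhom E (\<lambda>x. x)" by (simp add: fhom_def)
  have "map_poly (\<lambda>x. x) Q = Q" by (simp add: map_poly_idI)
  then have "poly (map_poly (\<lambda>x. x) Q) \<beta> = 0" using R \<beta> by simp
  then obtain g where "fhom (adjoin E \<alpha>) g" "\<forall>x\<in>E. g x = x" "g \<alpha> = \<beta>"
    using simple_extension_hom[OF E id Q min] by blast
  then show ?thesis
    using that[OF subfld_adjoin[OF E P] adjoin_base[OF E] adjoin_mem[OF E]] \<open>\<beta> \<noteq> \<alpha>\<close> by auto
qed

section \<open>The Galois group of the tower\<close>

lemma field_CC: "field CC"
  by (rule field_from_type_algebra)

lemma CC_simps [simp]:
  "carrier CC = UNIV" "x \<otimes>\<^bsub>CC\<^esub> y = x * y" "x \<oplus>\<^bsub>CC\<^esub> y = x + y" "\<one>\<^bsub>CC\<^esub> = 1" "\<zero>\<^bsub>CC\<^esub> = 0"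
  by (simp_all add: ring_of_type_algebra_def)

lemma CC_minus [simp]: "\<ominus>\<^bsub>CC\<^esub> x = - x"
proof -
  interpret field CC by (rule field_CC)
  have "x \<oplus>\<^bsub>CC\<^esub> \<ominus>\<^bsub>CC\<^esub> x = \<zero>\<^bsub>CC\<^esub>" by (rule r_neg) simp
  then show ?thesis by (simp add: eq_neg_iff_add_eq_0 add.commute)
qed

lemma CC_inv [simp]: "x \<noteq> 0 \<Longrightarrow> inv\<^bsub>CC\<^esub> x = inverse x"
proof -
  interpret field CC by (rule field_CC)
  assume "x \<noteq> 0"
  then have "x \<in> Units CC" using field_Units by simp
  then have "x \<otimes>\<^bsub>CC\<^esub> inv\<^bsub>CC\<^esub> x = \<one>\<^bsub>CC\<^esub>" by (rule Units_r_inv)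
  then show ?thesis by (simp add: inverse_unique)
qed

lemma subfield_CC_iff: "subfield K CC \<longleftrightarrow> subfld K"
proof -
  interpret field CC by (rule field_CC)
  show ?thesis
  proof
    assume K: "subfield K CC"
    note R = subringE[OF subfieldE(1)[OF K]]
    have "x - y \<in> K" if "x \<in> K" "y \<in> K" for x y
      using R(7)[OF that(1) R(5)[OF that(2)]] by simp
    moreover have "x * y \<in> K" if "x \<in> K" "y \<in> K" for x y using R(6)[OF that] by simp
    moreover have "inverse x \<in> K" if "x \<in> K" for x
      using subfield_m_inv(1)[OF K, of x] that R(2) by (cases "x = 0") auto
    ultimately show "subfld K" using R(3) by (auto simp: subfld_def)
  next
    assume K: "subfld K"
    show "subfield K CC"
    proof (rule subfieldI')
      show "subring K CC"
        by (rule subringI) (auto intro: subfld_1[OF K] subfld_uminus[OF K] subfld_add[OF K] subfld_mult[OF K])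
      show "inv\<^bsub>CC\<^esub> k \<in> K" if "k \<in> K - {\<zero>\<^bsub>CC\<^esub>}" for k
        using that subfld_inverse[OF K] by auto
    qed
  qed
qed

lemma subfld_generate: "subfld (generate_field CC S)"
  using field.generate_field_is_subfield[OF field_CC, of S] by (simp add: subfield_CC_iff)

lemma generate_least: "subfld E \<Longrightarrow> S \<subseteq> E \<Longrightarrow> generate_field CC S \<subseteq> E"
  using field.generate_field_min_subfield1[OF field_CC, of S E] by (simp add: subfield_CC_iff)

lemma generate_incl: "S \<subseteq> generate_field CC S"
  by (auto intro: generate_field.incl)

lemma subfld_gal_group_carrier:
  assumes "subfld L"
  shows "carrier (gal_group L F) = {\<sigma> \<in> Bij L. fhom L \<sigma> \<and> (\<forall>z\<in>F. \<sigma> z = z)}"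
  using Bij_imp_funcset[of _ L] subfld_1[OF assms]
  by (auto simp: gal_group_def ring_hom_def fhom_def)

lemma gal_group_simps:
  "\<sigma> \<in> carrier (gal_group L F) \<Longrightarrow> \<tau> \<in> carrier (gal_group L F) \<Longrightarrow> \<sigma> \<otimes>\<^bsub>gal_group L F\<^esub> \<tau> = compose L \<sigma> \<tau>"
  "\<one>\<^bsub>gal_group L F\<^esub> = (\<lambda>x\<in>L. x)"
  by (auto simp: gal_group_def BijGroup_def)

lemma group_gal_group:
  assumes L: "subfld L" and "F \<subseteq> L"
  shows "group (gal_group L F)"
proof -
  interpret B: group "BijGroup L" by (rule group_BijGroup)
  have cB: "carrier (BijGroup L) = Bij L" by (simp add: BijGroup_def)
  let ?C = "carrier (gal_group L F)"
  note C = subfld_gal_group_carrier[OF L, of F]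
  have "subgroup ?C (BijGroup L)"
  proof (rule B.subgroupI)
    show "?C \<subseteq> carrier (BijGroup L)" by (auto simp: C cB)
    have "(\<lambda>x\<in>L. x) \<in> ?C"
      using \<open>F \<subseteq> L\<close> subfld_1[OF L] subfld_add[OF L] subfld_mult[OF L] by (auto simp: C id_Bij fhom_def)
    then show "?C \<noteq> {}" by auto
  next
    fix \<sigma> assume "\<sigma> \<in> ?C"
    then have \<sigma>: "\<sigma> \<in> Bij L" "fhom L \<sigma>" "\<forall>z\<in>F. \<sigma> z = z" by (auto simp: C)
    have inj: "inj_on \<sigma> L" and im: "\<sigma> ` L = L" using \<sigma>(1) by (auto simp: Bij_def bij_betw_def)
    have inv: "inv_into L \<sigma> x = y" if "y \<in> L" "\<sigma> y = x" for x y
      using inv_into_f_f[OF inj that(1)] that(2) by simp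
    have i: "inv_into L \<sigma> x \<in> L" "\<sigma> (inv_into L \<sigma> x) = x" if "x \<in> L" for x
      using that im by (auto intro: inv_into_into f_inv_into_f)
    have "inv_into L \<sigma> (x + y) = inv_into L \<sigma> x + inv_into L \<sigma> y \<and>
       inv_into L \<sigma> (x * y) = inv_into L \<sigma> x * inv_into L \<sigma> y" if "x \<in> L" "y \<in> L" for x y
      using that i fhom_add[OF L \<sigma>(2)] fhom_mult[OF L \<sigma>(2)] subfld_add[OF L] subfld_mult[OF L]
      by (intro conjI inv) auto
    moreover have "inv_into L \<sigma> 1 = 1" by (rule inv) (use subfld_1[OF L] fhom_1[OF L \<sigma>(2)] in auto)
    moreover have "inv_into L \<sigma> z = z" if "z \<in> F" for z by (rule inv) (use that \<sigma> \<open>F \<subseteq> L\<close> in auto)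
    ultimately have "(\<lambda>x\<in>L. inv_into L \<sigma> x) \<in> ?C"
      using restrict_inv_into_Bij[OF \<sigma>(1)] subfld_1[OF L] subfld_add[OF L] subfld_mult[OF L] \<open>F \<subseteq> L\<close>
      by (auto simp: C fhom_def)
    then show "inv\<^bsub>BijGroup L\<^esub> \<sigma> \<in> ?C" using inv_BijGroup[OF \<sigma>(1)] by simp
  next
    fix \<sigma> \<tau> assume st: "\<sigma> \<in> ?C" "\<tau> \<in> ?C"
    then have "compose L \<sigma> \<tau> \<in> Bij L" by (auto simp: C compose_Bij)
    moreover have "fhom L (compose L \<sigma> \<tau>)" "\<forall>z\<in>F. compose L \<sigma> \<tau> z = z"
      using st Bij_imp_funcset[of \<tau> L] subfld_1[OF L] subfld_add[OF L] subfld_mult[OF L] \<open>F \<subseteq> L\<close>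
      by (auto simp: C fhom_def compose_def Pi_iff)
    ultimately have "compose L \<sigma> \<tau> \<in> ?C" by (simp add: C)
    then show "\<sigma> \<otimes>\<^bsub>BijGroup L\<^esub> \<tau> \<in> ?C" using st by (simp add: BijGroup_def C)
  qed
  then have "group (BijGroup L\<lparr>carrier := ?C\<rparr>)" by (rule B.subgroup_imp_group)
  then show ?thesis by (simp add: gal_group_def)
qed

text \<open>As polynomials, the iterates can be transported by a homomorphism of the coefficients.
  The new \<open>f\<close> is substituted on the inside, so a factorisation for one level yields the
  next by composing each factor with \<open>f\<close>.\<close>

definition iterp :: "'a::comm_semiring_1 poly \<Rightarrow> nat \<Rightarrow> 'a poly" where
  "iterp f n = ((\<lambda>p. pcompose p f) ^^ n) [:0, 1:]"

lemma iterp_0 [simp]: "iterp f 0 = [:0, 1:]"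
  by (simp add: iterp_def)

lemma iterp_Suc [simp]: "iterp f (Suc n) = pcompose (iterp f n) f"
  by (simp add: iterp_def)

lemma poly_iterp: "poly (iterp f n) z = (poly f ^^ n) z"
  by (induction n arbitrary: z) (simp_all add: poly_pcompose funpow_swap1)

lemma pover_iterp: "subfld K \<Longrightarrow> f \<in> pover K \<Longrightarrow> iterp f n \<in> pover K"
  by (induction n) (auto intro: pover_pcompose pover_X)

lemma degree_iterp: "Polynomial.degree (iterp (f :: 'a::idom poly) n) = Polynomial.degree f ^ n"
  by (induction n) (simp_all add: Polynomial.degree_pcompose)

section \<open>Levels, the tower and its automorphisms\<close>

locale quadratic_tower =
  fixes K :: "complex set" and f :: "complex poly"
  assumes K: "subfld K" and fK: "f \<in> pover K" and deg_f: "Polynomial.degree f = 2"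
begin

lemma iterp_minus_nonzero: "iterp f n - [:w:] \<noteq> 0"
proof
  assume "iterp f n - [:w:] = 0"
  then have "Polynomial.degree (iterp f n) = Polynomial.degree [:w:]" by simp
  then show False by (simp add: degree_iterp deg_f)
qed

lemma iter_level_roots: "iter_level f t n = {z. poly (iterp f n - [:t:]) z = 0}"
  by (auto simp: iter_level_def poly_iterp)

lemma finite_iter_level: "finite (iter_level f t n)"
  unfolding iter_level_roots by (intro poly_roots_finite iterp_minus_nonzero)

lemma poly_f_surj: "\<exists>z. poly f z = w"
proof -
  have "Polynomial.degree (f + [:- w:]) = 2" using deg_f by (subst degree_add_eq_left) auto
  also have "f + [:- w:] = f - [:w:]" by (rule poly_eqI) (simp add: coeff_pCons split: nat.splits)
  finally have "Polynomial.degree (f - [:w:]) = 2" .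
  then have "\<not> constant (poly (f - [:w:]))" by (simp add: constant_degree)
  then obtain z where "poly (f - [:w:]) z = 0" using fundamental_theorem_of_algebra by blast
  then show ?thesis by auto
qed

lemma iter_level_add: "z \<in> iter_level f w m \<Longrightarrow> w \<in> iter_level f t n \<Longrightarrow> z \<in> iter_level f t (n + m)"
  by (simp add: iter_level_def funpow_add)

lemma iter_level_image: "z \<in> iter_level f t (Suc n) \<Longrightarrow> poly f z \<in> iter_level f t n"
  by (simp add: iter_level_def funpow_swap1)

lemma poly_f_closed: "subfld E \<Longrightarrow> K \<subseteq> E \<Longrightarrow> z \<in> E \<Longrightarrow> poly f z \<in> E"
  using poly_pover_in[of E f z] fK pover_mono by blast

lemma iter_closed: "subfld E \<Longrightarrow> K \<subseteq> E \<Longrightarrow> z \<in> E \<Longrightarrow> (poly f ^^ n) z \<in> E"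
  by (induction n) (auto intro: poly_f_closed)

lemma subfld_base: "subfld (base_field K t)"
  unfolding base_field_def by (rule subfld_generate)

lemma base_incl: "K \<subseteq> base_field K t" "t \<in> base_field K t"
  using generate_incl[of "insert t K"] by (auto simp: base_field_def)

lemma base_least: "subfld E \<Longrightarrow> K \<subseteq> E \<Longrightarrow> t \<in> E \<Longrightarrow> base_field K t \<subseteq> E"
  unfolding base_field_def by (rule generate_least) auto

lemma level_field_mono: "level_field K f t n \<subseteq> level_field K f t (Suc n)"
proof -
  let ?E = "level_field K f t (Suc n)"
  have E: "subfld ?E" "base_field K t \<subseteq> ?E" "iter_level f t (Suc n) \<subseteq> ?E"
    using generate_incl[of "base_field K t \<union> iter_level f t (Suc n)"]
    by (auto simp: level_field_def subfld_generate)
  have "z \<in> ?E" if z: "z \<in> iter_level f t n" for z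
  proof -
    obtain y where "poly f y = z" using poly_f_surj by blast
    then have "y \<in> iter_level f t (Suc n)" using z by (simp add: iter_level_def funpow_swap1)
    then show ?thesis using poly_f_closed[OF E(1)] base_incl(1) E \<open>poly f y = z\<close> by blast
  qed
  then show ?thesis using E unfolding level_field_def[of _ _ _ n] by (intro generate_least) auto
qed

text \<open>The level fields increase, because a vertex is \<open>f\<close> of a vertex one level
  higher. So it does no harm that \<open>tower_field\<close> starts at level 1.\<close>

lemma tower_eq: "tower_field K f t = generate_field CC (base_field K t \<union> (\<Union>n. iter_level f t n))"
proof
  show "tower_field K f t \<subseteq> generate_field CC (base_field K t \<union> (\<Union>n. iter_level f t n))"
    unfolding tower_field_def level_field_def
    using generate_incl[of "base_field K t \<union> (\<Union>n. iter_level f t n)"]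
    by (intro UN_least generate_least subfld_generate) blast
  let ?E = "level_field K f t"
  have E: "subfld (?E n)" "base_field K t \<subseteq> ?E n" "iter_level f t n \<subseteq> ?E n" for n
    using generate_incl[of "base_field K t \<union> iter_level f t n"]
    by (auto simp: level_field_def subfld_generate)
  have mono: "?E m \<subseteq> ?E n" if "m \<le> n" for m n using level_field_mono that by (rule lift_Suc_mono_le)
  have tw: "tower_field K f t = (\<Union>n. ?E n)"
  proof
    have "Suc n \<in> {1..}" for n by simp
    then have "?E (Suc n) \<subseteq> tower_field K f t" for n unfolding tower_field_def by (rule UN_upper)
    then show "(\<Union>n. ?E n) \<subseteq> tower_field K f t" using level_field_mono by (meson UN_least order_trans)
  qed (auto simp: tower_field_def)
  show "generate_field CC (base_field K t \<union> (\<Union>n. iter_level f t n)) \<subseteq> tower_field K f t"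
  proof (rule generate_least)
    show "base_field K t \<union> (\<Union>n. iter_level f t n) \<subseteq> tower_field K f t"
      unfolding tw using E(2)[of 0] E(3) by blast
    show "subfld (tower_field K f t)" unfolding tw by (rule subfld_chain_UN[OF E(1) mono])
  qed
qed

lemma subfld_tower: "subfld (tower_field K f t)"
  unfolding tower_eq by (rule subfld_generate)

lemma base_tower: "base_field K t \<subseteq> tower_field K f t"
  unfolding tower_eq using generate_incl[of "base_field K t \<union> (\<Union>n. iter_level f t n)"] by auto

lemma K_tower: "K \<subseteq> tower_field K f t"
  using base_tower base_incl(1) by blast

lemma iter_level_tower: "iter_level f t n \<subseteq> tower_field K f t"
  unfolding tower_eq using generate_incl[of "base_field K t \<union> (\<Union>n. iter_level f t n)"] by auto

lemma tower_least:
  "subfld E \<Longrightarrow> base_field K t \<subseteq> E \<Longrightarrow> (\<And>n. iter_level f t n \<subseteq> E) \<Longrightarrow> tower_field K f t \<subseteq> E"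
  unfolding tower_eq by (rule generate_least) auto

lemma gal_arith_carrier:
  "carrier (gal_arith K f t) =
     {\<sigma> \<in> Bij (tower_field K f t). fhom (tower_field K f t) \<sigma> \<and> (\<forall>z\<in>base_field K t. \<sigma> z = z)}"
  unfolding gal_arith_def by (rule subfld_gal_group_carrier[OF subfld_tower])

lemma group_gal_arith: "group (gal_arith K f t)"
  unfolding gal_arith_def by (rule group_gal_group[OF subfld_tower base_tower])

lemma hom_poly_f:
  assumes E: "subfld E" "K \<subseteq> E" "fhom E g" "\<forall>x\<in>K. g x = x" and z: "z \<in> E"
  shows "g (poly f z) = poly f (g z)"
proof -
  have fE: "f \<in> pover E" using fK pover_mono[OF E(2)] by blast
  have "map_poly g f = f" using fK E(4) by (intro poly_eqI) (auto simp: coeff_map_fhom[OF E(1,3)] pover_def)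
  then show ?thesis using poly_map_fhom[OF E(1,3) fE z] by simp
qed

lemma hom_iter:
  assumes E: "subfld E" "K \<subseteq> E" "fhom E g" "\<forall>x\<in>K. g x = x" and z: "z \<in> E"
  shows "g ((poly f ^^ n) z) = (poly f ^^ n) (g z)"
  by (induction n) (simp_all add: hom_poly_f[OF E] iter_closed[OF E(1,2) z])

text \<open>\<open>g\<close> commutes with \<open>f\<close> and fixes \<open>t\<close>, so it maps
  the level into itself; being injective on a finite set it is onto.\<close>

lemma hom_level:
  assumes E: "subfld E" "base_field K t \<subseteq> E" "iter_level f t n \<subseteq> E" "fhom E g" "\<forall>x\<in>base_field K t. g x = x"
  shows "g ` iter_level f t n = iter_level f t n"
proof -
  have KE: "K \<subseteq> E" "\<forall>x\<in>K. g x = x" "g t = t" using E base_incl[of t] by auto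
  have "g z \<in> iter_level f t n" if z: "z \<in> iter_level f t n" for z
  proof -
    have "(poly f ^^ n) (g z) = g ((poly f ^^ n) z)"
      using hom_iter[OF E(1) KE(1) E(4) KE(2), of z n] z E(3) by auto
    then show ?thesis using z KE(3) by (simp add: iter_level_def)
  qed
  moreover have "inj_on g (iter_level f t n)"
    using E(3) fhom_eq_iff[OF E(1,4)] by (auto simp: inj_on_def)
  ultimately show ?thesis
    by (intro card_subset_eq finite_iter_level) (auto simp: card_image)
qed

text \<open>Normality of the tower. The elements whose image stays in the tower form a subfield, and
  so does the image of the tower; both contain the generators, which makes the restriction a map
  into and onto the tower.\<close>

lemma restrict_hom_gal:
  assumes E: "subfld E" "tower_field K f t \<subseteq> E" "fhom E g" "\<forall>x\<in>base_field K t. g x = x"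
  shows "restrict g (tower_field K f t) \<in> carrier (gal_arith K f t)"
proof -
  let ?L = "tower_field K f t"
  note L = subfld_tower[of t]
  have gL: "fhom ?L g" using fhom_mono[OF E(3,2)] .
  have lev: "g ` iter_level f t n = iter_level f t n" for n
    by (rule hom_level[OF L base_tower iter_level_tower gL E(4)])
  have "subfld {x \<in> ?L. g x \<in> ?L}"
    unfolding subfld_def using subfld_1[OF L] subfld_diff[OF L] subfld_mult[OF L] subfld_inverse[OF L]
      fhom_1[OF L gL] fhom_diff[OF L gL] fhom_mult[OF L gL] fhom_inverse[OF L gL] by auto
  then have "?L \<subseteq> {x \<in> ?L. g x \<in> ?L}"
    by (rule tower_least) (use base_tower iter_level_tower E(4) lev in \<open>fastforce+\<close>)
  then have into: "g ` ?L \<subseteq> ?L" by auto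
  have "subfld (g ` ?L)"
    unfolding subfld_def
  proof (intro conjI ballI)
    show "1 \<in> g ` ?L" using subfld_1[OF L] fhom_1[OF L gL] by (metis imageI)
    show "inverse x \<in> g ` ?L" if "x \<in> g ` ?L" for x
      using that fhom_inverse[OF L gL] subfld_inverse[OF L] by (metis (no_types, lifting) imageE imageI)
    fix x y assume "x \<in> g ` ?L" "y \<in> g ` ?L"
    then obtain x' y' where xy: "x = g x'" "y = g y'" "x' \<in> ?L" "y' \<in> ?L" by auto
    show "x - y \<in> g ` ?L" using fhom_diff[OF L gL] subfld_diff[OF L] xy by (metis imageI)
    show "x * y \<in> g ` ?L" using fhom_mult[OF L gL] subfld_mult[OF L] xy by (metis imageI)
  qed
  moreover have "base_field K t \<subseteq> g ` ?L" using base_tower E(4) by (metis image_iff subset_iff)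
  moreover have "iter_level f t n \<subseteq> g ` ?L" for n using lev[of n] iter_level_tower by (metis image_mono)
  ultimately have onto: "?L \<subseteq> g ` ?L" by (rule tower_least)
  have "inj_on g ?L" using fhom_eq_iff[OF L gL] by (auto simp: inj_on_def)
  then have "restrict g ?L \<in> Bij ?L"
    using into onto by (auto simp: Bij_def bij_betw_def inj_on_restrict_eq)
  then show ?thesis unfolding gal_arith_carrier
    using gL base_tower[of t] E(4) subfld_1[OF L] subfld_add[OF L] subfld_mult[OF L]
    by (auto simp: fhom_def)
qed

text \<open>The source of all automorphisms that move something: \<open>\<alpha>\<close> goes to
  another conjugate over \<open>E\<close>, the embedding is extended over all vertices, and the
  result is cut down to the tower.\<close>

lemma gal_exists:
  assumes E: "subfld E" "base_field K t \<subseteq> E" and \<alpha>: "\<alpha> \<in> tower_field K f t" "\<alpha> \<notin> E"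
    and P: "P \<in> pover E" "P \<noteq> 0" "poly P \<alpha> = 0"
  shows "\<exists>\<sigma>\<in>carrier (gal_arith K f t). (\<forall>x\<in>E \<inter> tower_field K f t. \<sigma> x = x) \<and> \<sigma> \<alpha> \<noteq> \<alpha>"
proof -
  obtain E' g where E': "subfld E'" "E \<subseteq> E'" "\<alpha> \<in> E'" "fhom E' g" "\<And>x. x \<in> E \<Longrightarrow> g x = x" "g \<alpha> \<noteq> \<alpha>"
    using conjugate_exists[OF E(1) P \<alpha>(2)] by metis
  have ct: "countable (\<Union>n. iter_level f t n)" using finite_iter_level by (auto intro: countable_finite)
  have lev: "\<exists>P\<in>pover E'. P \<noteq> 0 \<and> poly P z = 0 \<and> splits (map_poly g P)" if "z \<in> iter_level f t n" for z n
  proof (intro bexI conjI)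
    show PE: "iterp f n - [:t:] \<in> pover E'"
      using E(2) E'(2) base_incl[of t] pover_iterp[OF K fK, of n] pover_mono[of K E']
      by (intro pover_diff[OF E'(1)] pover_const[OF E'(1)]) auto
    show "poly (iterp f n - [:t:]) z = 0" using that by (simp add: iter_level_roots)
    show "splits (map_poly g (iterp f n - [:t:]))"
      by (intro complex_poly_splits map_fhom_nonzero[OF E'(1,4) PE] iterp_minus_nonzero)
  qed (rule iterp_minus_nonzero)
  have ann: "\<exists>P\<in>pover E'. P \<noteq> 0 \<and> poly P z = 0 \<and> splits (map_poly g P)"
    if "z \<in> (\<Union>n. iter_level f t n)" for z
    using that by (elim UN_E) (rule lev)
  obtain E2 h where h: "subfld E2" "E' \<subseteq> E2" "(\<Union>n. iter_level f t n) \<subseteq> E2" "fhom E2 h"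
    "\<And>x. x \<in> E' \<Longrightarrow> h x = g x"
    by (rule hom_extension[OF E'(1,4) ct ann]) (assumption | rule that)+
  have LE: "tower_field K f t \<subseteq> E2" using E(2) E'(2) h(2,3) by (intro tower_least[OF h(1)]) blast+
  have base_id: "\<forall>x\<in>base_field K t. h x = x"
  proof
    fix x assume "x \<in> base_field K t"
    then have "x \<in> E" "x \<in> E'" using E(2) E'(2) by blast+
    then show "h x = x" using E'(5) h(5) by simp
  qed
  show ?thesis
  proof (intro bexI conjI)
    show "restrict h (tower_field K f t) \<in> carrier (gal_arith K f t)"
      by (rule restrict_hom_gal[OF h(1) LE h(4) base_id])
    show "\<forall>x\<in>E \<inter> tower_field K f t. restrict h (tower_field K f t) x = x"
    proof
      fix x assume "x \<in> E \<inter> tower_field K f t"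
      then have "x \<in> E" "x \<in> E'" "x \<in> tower_field K f t" using E'(2) by blast+
      then show "restrict h (tower_field K f t) x = x" using E'(5) h(5) by simp
    qed
    show "restrict h (tower_field K f t) \<alpha> \<noteq> \<alpha>" using \<alpha>(1) E'(3,6) h(5) by simp
  qed
qed

end

section \<open>Transcendental elements\<close>

definition algover :: "'a::field set \<Rightarrow> 'a \<Rightarrow> bool" where
  "algover K z \<longleftrightarrow> (\<exists>q\<in>pover K. q \<noteq> 0 \<and> poly q z = 0)"

lemma CC_pow [simp]: "x [^]\<^bsub>CC\<^esub> (n::nat) = x ^ n"
  by (induction n) (simp_all add: nat_pow_def mult.commute)

text \<open>Polynomials of the algebra library are lists with the leading coefficient first, hence
  the reversal.\<close>

lemma CC_eval: "ring.eval CC p x = poly (Poly (rev p)) x"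
proof -
  interpret field CC by (rule field_CC)
  show ?thesis
    by (induction p) (simp_all add: Poly_snoc poly_monom)
qed

lemma algebraic_CC_iff:
  assumes K: "subfld K"
  shows "ring.transcendental CC K z \<longleftrightarrow> \<not> algover K z"
proof -
  interpret field CC by (rule field_CC)
  have Kr: "subring K CC" using K subfieldE(1) by (simp add: subfield_CC_iff[symmetric])
  show ?thesis
  proof
    assume tr: "ring.transcendental CC K z"
    show "\<not> algover K z"
    proof
      assume "algover K z"
      then obtain q where q: "q \<in> pover K" "q \<noteq> 0" "poly q z = 0" by (auto simp: algover_def)
      let ?p = "rev (coeffs q)"
      have "polynomial\<^bsub>CC\<^esub> K ?p"
        using q(1,2) unfolding polynomial_def
        by (auto simp: hd_rev last_coeffs_eq_coeff_degree in_set_conv_nth coeffs_nth pover_def length_coeffs_degree)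
      then have p: "?p \<in> carrier (univ_poly CC K)" by (simp add: univ_poly_carrier)
      have "eval ?p z = \<zero>\<^bsub>CC\<^esub>" using q(3) by (simp add: CC_eval)
      then have "?p = []" using eval_transcendental[of K z ?p] tr p by (simp add: over_def)
      then show False using q(2) by simp
    qed
  next
    assume na: "\<not> algover K z"
    show "ring.transcendental CC K z"
    proof (rule ccontr)
      assume "\<not> ring.transcendental CC K z"
      then have "(algebraic over K) z" by (simp add: over_def)
      then obtain p where p: "p \<in> carrier (univ_poly CC K)" "p \<noteq> []" "eval p z = \<zero>\<^bsub>CC\<^esub>"
        using algebraicE[OF Kr, of z] by auto
      have s: "set p \<subseteq> K" "hd p \<noteq> 0" using p(1,2) by (auto simp: univ_poly_carrier[symmetric] polynomial_def)
      have "Poly (rev p) \<in> pover K"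
        using s(1) subfld_0[OF K] by (auto simp: pover_def coeff_Poly_eq nth_default_def)
          (metis length_rev nth_mem set_rev subsetD)
      moreover have "Polynomial.coeff (Poly (rev p)) (length p - 1) = hd p"
        using p(2) by (simp add: coeff_Poly_eq nth_default_def rev_nth hd_conv_nth)
      then have "Poly (rev p) \<noteq> 0" using s(2) by (metis coeff_0)
      ultimately show False using na p(3) by (auto simp: algover_def CC_eval)
    qed
  qed
qed

lemma algover_fin_dim:
  assumes K: "subfld K" and E: "subfld E" "ring.finite_dimension CC K E" and z: "z \<in> E"
  shows "algover K z"
proof -
  interpret field CC by (rule field_CC)
  have "(algebraic over K) z"
    using finite_dimension_imp_algebraic[of K E z] K E z subfieldE(1)[of E CC] by (simp add: subfield_CC_iff)
  then show ?thesis using algebraic_CC_iff[OF K, of z] by (simp add: over_def)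
qed

lemma fin_dim_adjoin:
  assumes K: "subfld K" and z: "algover K z"
  obtains E where "subfld E" "K \<subseteq> E" "z \<in> E" "ring.finite_dimension CC K E" "E \<subseteq> adjoin K z"
proof -
  interpret field CC by (rule field_CC)
  have KC: "subfield K CC" by (simp add: subfield_CC_iff K)
  have alg: "(algebraic over K) z" using z algebraic_CC_iff[OF K, of z] by (simp add: over_def)
  let ?E = "simple_extension K z"
  show ?thesis
  proof (rule that)
    show "subfld ?E"
      using simple_extension_is_subfield[OF KC, of z] alg by (simp add: subfield_CC_iff)
    show "K \<subseteq> ?E" using simple_extension_incl[OF subfieldE(3)[OF KC]] by simp
    show "z \<in> ?E" using simple_extension_mem[OF subfieldE(1)[OF KC]] by simp
    show "finite_dimension K ?E" using finite_dimension_simple_extension[OF KC, of z] alg by simp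
    show "?E \<subseteq> adjoin K z"
    proof
      fix x assume "x \<in> ?E"
      then show "x \<in> adjoin K z"
      proof induction
        case zero
        then show ?case using subfld_0[OF K] adjoin_base[OF K] by auto
      next
        case (lin k1 k2)
        then obtain p where p: "p \<in> pover K" "k1 = poly p z" by (auto simp: adjoin_def[OF K])
        have "pCons k2 p \<in> pover K" using p lin(2) by (simp add: pover_pCons_iff[OF K])
        moreover have "poly (pCons k2 p) z = k1 * z + k2" by (simp add: p mult.commute add.commute)
        ultimately show ?case unfolding adjoin_def[OF K] CC_simps by (metis (mono_tags, lifting) mem_Collect_eq)
      qed
    qed
  qed
qed

lemma algover_trans:
  assumes K: "subfld K" and E: "subfld E" "K \<subseteq> E" "ring.finite_dimension CC K E" and z: "algover E z"
  shows "algover K z"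
proof -
  interpret field CC by (rule field_CC)
  obtain E' where E': "subfld E'" "z \<in> E'" "finite_dimension E E'"
    using fin_dim_adjoin[OF E(1) z] by metis
  have "finite_dimension K E'"
    using telescopic_base_dim(1)[OF _ _ E(3) E'(3)] K E(1) by (simp add: subfield_CC_iff)
  then show ?thesis by (rule algover_fin_dim[OF K E'(1) _ E'(2)])
qed

text \<open>Used contrapositively: a vertex above a transcendental \<open>t\<close> is
  transcendental, because \<open>t\<close> is a polynomial in it.\<close>

lemma algover_poly:
  assumes K: "subfld K" and z: "algover K z" and F: "F \<in> pover K"
  shows "algover K (poly F (z::complex))"
proof -
  obtain E where E: "subfld E" "K \<subseteq> E" "z \<in> E" "ring.finite_dimension CC K E"
    using fin_dim_adjoin[OF K z] by metis
  have "poly F z \<in> E" using poly_pover_in[OF E(1) _ E(3)] F pover_mono[OF E(2)] by blast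
  then show ?thesis by (rule algover_fin_dim[OF K E(1,4)])
qed

section \<open>Rational functions in a transcendental element\<close>

definition ratfun :: "'a::field set \<Rightarrow> 'a \<Rightarrow> 'a set" where
  "ratfun K u = {poly p u / poly q u | p q. p \<in> pover K \<and> q \<in> pover K \<and> poly q u \<noteq> 0}"

context
  fixes K :: "'a::field set" and u :: 'a
  assumes K: "subfld K"
begin

lemma ratfunI: "p \<in> pover K \<Longrightarrow> q \<in> pover K \<Longrightarrow> poly q u \<noteq> 0 \<Longrightarrow> poly p u / poly q u \<in> ratfun K u"
  by (auto simp: ratfun_def)

lemma subfld_ratfun: "subfld (ratfun K u)"
  unfolding subfld_def
proof (intro conjI ballI)
  show "1 \<in> ratfun K u" using ratfunI[of 1 1] pover_1[OF K] by simp
  fix x assume x: "x \<in> ratfun K u"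
  then obtain p q where pq: "p \<in> pover K" "q \<in> pover K" "poly q u \<noteq> 0" "x = poly p u / poly q u"
    by (auto simp: ratfun_def)
  show "inverse x \<in> ratfun K u"
  proof (cases "poly p u = 0")
    case True
    then show ?thesis using x pq by simp
  next
    case False
    then show ?thesis using ratfunI[of q p] pq by simp
  qed
  fix y assume y: "y \<in> ratfun K u"
  then obtain p' q' where pq': "p' \<in> pover K" "q' \<in> pover K" "poly q' u \<noteq> 0" "y = poly p' u / poly q' u"
    by (auto simp: ratfun_def)
  have "x - y = poly (p * q' - p' * q) u / poly (q * q') u" unfolding pq(4) pq'(4) using pq(3) pq'(3) by (simp add: field_simps)
  then show "x - y \<in> ratfun K u"
    using ratfunI[of "p * q' - p' * q" "q * q'"] pover_mult[OF K] pover_diff[OF K] pq pq' by simp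
  have "x * y = poly (p * p') u / poly (q * q') u" unfolding pq(4) pq'(4) using pq(3) pq'(3) by (simp add: field_simps)
  then show "x * y \<in> ratfun K u"
    using ratfunI[of "p * p'" "q * q'"] pover_mult[OF K] pq pq' by simp
qed

lemma ratfun_base: "K \<subseteq> ratfun K u"
  using ratfunI[of "[:_:]" 1] pover_1[OF K] pover_const[OF K] by auto

lemma ratfun_mem: "u \<in> ratfun K u"
  using ratfunI[of "[:0, 1:]" 1] pover_1[OF K] pover_X[OF K] by simp

text \<open>The value is read off a chosen representation as a fraction. Cross-multiplication and
  \<open>inj\<close> turn equality of two fractions into an identity of polynomials, which survives
  the homomorphism; by \<open>U\<close> no denominator becomes zero.\<close>

lemma transcendental_extension_hom:
  fixes h :: "'a \<Rightarrow> 'b::field"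
  assumes h: "fhom K h" and u: "\<not> algover K u"
    and U: "\<And>q. q \<in> pover K \<Longrightarrow> q \<noteq> 0 \<Longrightarrow> poly (map_poly h q) U \<noteq> 0"
  shows "\<exists>g. fhom (ratfun K u) g \<and> (\<forall>x\<in>K. g x = h x) \<and> g u = U"
proof -
  let ?e = "\<lambda>p. poly (map_poly h p) U"
  define S where "S x s \<longleftrightarrow> fst s \<in> pover K \<and> snd s \<in> pover K \<and> poly (snd s) u \<noteq> 0 \<and> x = poly (fst s) u / poly (snd s) u"
    for x and s :: "'a poly \<times> 'a poly"
  define g where "g x = (let s = SOME s. S x s in ?e (fst s) / ?e (snd s))" for x
  have inj: "p = q" if "p \<in> pover K" "q \<in> pover K" "poly p u = poly q u" for p q
    using u that pover_diff[OF K that(1,2)] by (auto simp: algover_def)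
  have ne: "?e q \<noteq> 0" if "q \<in> pover K" "poly q u \<noteq> 0" for q using U[OF that(1)] that(2) by force
  have g: "g (poly p u / poly q u) = ?e p / ?e q" if "p \<in> pover K" "q \<in> pover K" "poly q u \<noteq> 0" for p q
  proof -
    define s where "s = (SOME s. S (poly p u / poly q u) s)"
    have "S (poly p u / poly q u) (p, q)" using that by (simp add: S_def)
    then have s: "S (poly p u / poly q u) s" unfolding s_def by (rule someI)
    then have "poly (p * snd s) u = poly (fst s * q) u" using that by (simp add: S_def field_simps)
    then have "p * snd s = fst s * q" using s that by (intro inj pover_mult[OF K]) (auto simp: S_def)
    then have "?e p * ?e (snd s) = ?e (fst s) * ?e q"
      using map_fhom_mult[OF K h that(1), of "snd s"] map_fhom_mult[OF K h _ that(2), of "fst s"] s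
      by (simp add: S_def flip: poly_mult)
    then have "?e (fst s) / ?e (snd s) = ?e p / ?e q" using ne[OF that(2,3)] ne[of "snd s"] s
      by (simp add: S_def field_simps)
    then show ?thesis by (simp add: g_def s_def Let_def)
  qed
  have "g (x + y) = g x + g y \<and> g (x * y) = g x * g y" if xy: "x \<in> ratfun K u" "y \<in> ratfun K u" for x y
  proof -
    obtain p q where pq: "p \<in> pover K" "q \<in> pover K" "poly q u \<noteq> 0" "x = poly p u / poly q u"
      using xy(1) by (auto simp: ratfun_def)
    obtain p' q' where pq': "p' \<in> pover K" "q' \<in> pover K" "poly q' u \<noteq> 0" "y = poly p' u / poly q' u"
      using xy(2) by (auto simp: ratfun_def)
    note M = pover_mult[OF K] pover_add[OF K]
    have 1: "x + y = poly (p * q' + p' * q) u / poly (q * q') u" unfolding pq(4) pq'(4) using pq(3) pq'(3) by (simp add: field_simps)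
    have 2: "x * y = poly (p * p') u / poly (q * q') u" unfolding pq(4) pq'(4) using pq(3) pq'(3) by (simp add: field_simps)
    have "g (x + y) = ?e (p * q' + p' * q) / ?e (q * q')"
      unfolding 1 by (rule g) (use pq pq' M in auto)
    moreover have "g (x * y) = ?e (p * p') / ?e (q * q')" unfolding 2 by (rule g) (use pq pq' M in auto)
    moreover have "?e (p * q' + p' * q) = ?e p * ?e q' + ?e p' * ?e q"
      "?e (p * p') = ?e p * ?e p'" "?e (q * q') = ?e q * ?e q'"
      using pq(1,2) pq'(1,2) M by (simp_all add: map_fhom_add[OF K h] map_fhom_mult[OF K h])
    moreover have "g x = ?e p / ?e q" "g y = ?e p' / ?e q'"
      unfolding pq(4) pq'(4) using g pq(1-3) pq'(1-3) by blast+
    ultimately show ?thesis using ne[OF pq(2,3)] ne[OF pq'(2,3)] by (simp add: add_frac_eq)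
  qed
  moreover have gK: "g x = h x" if "x \<in> K" for x
    using g[OF pover_const[OF K that] pover_1[OF K]]
    by (simp add: map_fhom_pCons[OF K h] fhom_1[OF K h] one_pCons)
  moreover have "g 1 = 1" using gK[OF subfld_1[OF K]] fhom_1[OF K h] by simp
  moreover have "g u = U"
    using g[OF pover_X[OF K] pover_1[OF K]]
    by (simp add: map_fhom_pCons[OF K h] fhom_1[OF K h] fhom_0[OF K h] one_pCons)
  ultimately show ?thesis unfolding fhom_def by blast
qed

end

lemma (in quadratic_tower) base_eq_ratfun: "base_field K t = ratfun K t"
proof
  show "base_field K t \<subseteq> ratfun K t"
    using base_least[OF subfld_ratfun[OF K] ratfun_base[OF K] ratfun_mem[OF K]] .
  show "ratfun K t \<subseteq> base_field K t"
    using poly_pover_in[OF subfld_base[of t], of _ t] pover_mono[OF base_incl(1)[of t]] base_incl(2)[of t]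
    by (auto simp: ratfun_def intro!: subfld_divide[OF subfld_base])
qed

text \<open>
  In \<open>Metric_space_path_dist\<close> the name \<open>root\<close> denotes the library function for \<open>n\<close>-th roots,
  so that lemma covers a single vertex type only.
\<close>

lemma path_metric:
  assumes "V 0 = {x\<^sub>0}"
  shows "Metric_space (path_space V p) path_dist"
proof
  show "0 \<le> path_dist u v" for u v :: "nat \<Rightarrow> 'a" by (simp add: path_dist_def)
  show "path_dist u v = path_dist v u" for u v :: "nat \<Rightarrow> 'a"
    by (simp add: path_dist_def eq_commute)
  show "path_dist u v = 0 \<longleftrightarrow> u = v" for u v :: "nat \<Rightarrow> 'a" by (simp add: path_dist_def)
  fix u v w assume "u \<in> path_space V p" "v \<in> path_space V p" "w \<in> path_space V p"
  then have "u 0 \<in> V 0" "v 0 \<in> V 0" "w 0 \<in> V 0" by (simp_all add: path_space_def)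
  then have "path_dist u w \<le> max (path_dist u v) (path_dist v w)"
    using assms by (intro path_dist_ultrametric) simp_all
  also have "\<dots> \<le> path_dist u v + path_dist v w" by (simp add: path_dist_def)
  finally show "path_dist u w \<le> path_dist u v + path_dist v w" .
qed

section \<open>Ramification over a reflected post-critical point\<close>

lemma poly_prod_linear:
  fixes g :: "'a \<Rightarrow> 'b::comm_ring_1"
  shows "poly (\<Prod>b\<leftarrow>bs. [:- g b, 1:]) x = (\<Prod>b\<leftarrow>bs. x - g b)"
  by (induction bs) (simp_all add: algebra_simps)

lemma map_fhom_pcompose:
  assumes F: "subfld F" and h: "fhom F h" and p: "p \<in> pover F" and q: "q \<in> pover F"
  shows "map_poly h (pcompose p q) = pcompose (map_poly h p) (map_poly h q)"
  using p
proof (induction p)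
  case 0
  then show ?case by (simp add: fhom_0[OF F h])
next
  case (pCons a p)
  then have a: "a \<in> F" "p \<in> pover F" by (simp_all add: pover_pCons_iff[OF F])
  then show ?case
    using pCons.IH pover_const[OF F a(1)] pover_mult[OF F q pover_pcompose[OF F a(2) q]]
    by (simp add: pcompose_pCons map_fhom_pCons[OF F h] map_fhom_add[OF F h]
        map_fhom_mult[OF F h q] pover_pcompose[OF F a(2) q])
qed

lemma map_fhom_iterp:
  assumes F: "subfld F" and h: "fhom F h" and f: "f \<in> pover F"
  shows "map_poly h (iterp f n) = iterp (map_poly h f) n"
proof (induction n)
  case 0
  then show ?case by (simp add: map_fhom_pCons[OF F h] fhom_0[OF F h] fhom_1[OF F h])
next
  case (Suc n)
  then show ?case using map_fhom_pcompose[OF F h pover_iterp[OF F f] f] by simp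
qed

text \<open>
  Used for \<open>S = UNIV\<close> over the complex numbers, and for the power series whose constant term lies
  off the post-critical set.
\<close>

lemma iterp_factorization:
  fixes g :: "'b::field poly"
  assumes g: "g = Polynomial.smult a ([:- c, 1:]\<^sup>2) + [:v:]" and a: "a \<noteq> 0"
    and S: "\<And>b. b \<in> S \<Longrightarrow> \<exists>y\<in>S. 2 * c - y \<in> S \<and> a * (y - c)\<^sup>2 + v = b"
    and z: "z \<in> S"
  shows "\<exists>bs. length bs = 2 ^ n \<and> set bs \<subseteq> S \<and> (\<forall>b\<in>set bs. (poly g ^^ n) b = z) \<and>
    iterp g n - [:z:] = Polynomial.smult (a ^ (2 ^ n - 1)) (\<Prod>b\<leftarrow>bs. [:- b, 1:])"
proof (induction n)
  case 0
  show ?case using z by (intro exI[of _ "[z]"]) simp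
next
  case (Suc n)
  then obtain bs where bs: "length bs = 2 ^ n" "set bs \<subseteq> S" "\<forall>b\<in>set bs. (poly g ^^ n) b = z"
    "iterp g n - [:z:] = Polynomial.smult (a ^ (2 ^ n - 1)) (\<Prod>b\<leftarrow>bs. [:- b, 1:])" by blast
  obtain y where y: "\<And>b. b \<in> S \<Longrightarrow> y b \<in> S \<and> 2 * c - y b \<in> S \<and> a * (y b - c)\<^sup>2 + v = b"
    using S by metis
  define cs where "cs = concat (map (\<lambda>b. [y b, 2 * c - y b]) bs)"
  have pg: "poly g x = a * (x - c)\<^sup>2 + v" for x by (simp add: g power2_eq_square algebra_simps)
  have lin: "pcompose [:- b, 1:] g = Polynomial.smult a ([:- y b, 1:] * [:- (2 * c - y b), 1:])" if "b \<in> S" for b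
  proof -
    have "b = a * (y b - c)\<^sup>2 + v" using y[OF that] by simp
    then have "pcompose [:- b, 1:] g = g - [:a * (y b - c)\<^sup>2 + v:]" by (simp add: pcompose_pCons)
    also have "\<dots> = Polynomial.smult a ([:- y b, 1:] * [:- (2 * c - y b), 1:])"
      by (simp add: g power2_eq_square algebra_simps)
    finally show ?thesis .
  qed
  have prod: "pcompose (\<Prod>b\<leftarrow>bs. [:- b, 1:]) g =
      Polynomial.smult (a ^ length bs) (\<Prod>b\<leftarrow>concat (map (\<lambda>b. [y b, 2 * c - y b]) bs). [:- b, 1:])"
    if "set bs \<subseteq> S" for bs
    using that
  proof (induction bs)
    case (Cons b bs)
    then show ?case using lin[of b] by (simp add: pcompose_mult mult_ac del: mult_pCons_left mult_pCons_right)
  qed (simp add: pcompose_1)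
  have "iterp g (Suc n) - [:z:] = pcompose (iterp g n - [:z:]) g" by (simp add: pcompose_diff)
  also have "\<dots> = Polynomial.smult (a ^ (2 ^ n - 1) * a ^ (2 ^ n)) (\<Prod>b\<leftarrow>cs. [:- b, 1:])"
    unfolding bs(4) using prod[OF bs(2)] bs(1) by (simp add: pcompose_smult cs_def)
  \<comment> \<open>Each of the \<open>2 ^ n\<close> linear factors has contributed one more
    \<open>a\<close>.\<close>
  also have "a ^ (2 ^ n - 1) * a ^ (2 ^ n) = a ^ (2 ^ Suc n - 1)"
    by (simp flip: power_add) (metis Nat.add_diff_assoc2 mult_2 one_le_numeral one_le_power)
  finally have fac: "iterp g (Suc n) - [:z:] = Polynomial.smult (a ^ (2 ^ Suc n - 1)) (\<Prod>b\<leftarrow>cs. [:- b, 1:])" .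
  have "length (concat (map (\<lambda>b. [y b, 2 * c - y b]) bs)) = 2 * length bs" for bs
    by (induction bs) auto
  then have len: "length cs = 2 ^ Suc n" using bs(1) by (simp add: cs_def)
  have sub: "set cs \<subseteq> S" using bs(2) y by (auto simp: cs_def)
  have "(poly g ^^ Suc n) x = z" if "x \<in> set cs" for x
  proof -
    obtain b where b: "b \<in> set bs" "x = y b \<or> x = 2 * c - y b" using \<open>x \<in> set cs\<close> by (auto simp: cs_def)
    then have "b \<in> S" using bs(2) by auto
    have "(c - y b)\<^sup>2 = (y b - c)\<^sup>2" by (rule power2_commute)
    then have "poly g x = b" using b(2) y[OF \<open>b \<in> S\<close>] by (auto simp: pg)
    then show ?thesis using bs(3) b(1) by (simp add: funpow_swap1)
  qed
  then show ?case using len sub fac by blast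
qed

lemma fls_const_hom: "fhom A (fls_const :: complex \<Rightarrow> complex fls)"
  by (simp add: fhom_def fls_plus_const)

text \<open>The order of vanishing is 1 on the left and even on the right.\<close>

lemma fls_X_not_square: "fls_X \<noteq> fls_const A * (G :: complex fls)\<^sup>2"
proof
  assume e: "fls_X = fls_const A * G\<^sup>2"
  then have "A \<noteq> 0" "G \<noteq> 0" by auto
  then have "fls_subdegree (fls_const A * G\<^sup>2) = 2 * fls_subdegree G"
    by (simp add: power2_eq_square)
  then have "1 = 2 * fls_subdegree G" unfolding e[symmetric] by simp
  then show False by presburger
qed

text \<open>\<open>q\<close> splits over the complex numbers, and in each factor the coefficient of
  the parameter is 1.\<close>

lemma fls_const_X_transcendental:
  assumes "q \<noteq> 0"
  shows "poly (map_poly (fls_const :: complex \<Rightarrow> complex fls) q) (fls_const w + fls_X) \<noteq> 0"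
proof -
  obtain a bs where a: "a \<noteq> 0" "q = Polynomial.smult a (\<Prod>b\<leftarrow>bs. [:- b, 1:])"
    using complex_poly_splits[OF assms] by (auto simp: splits_def)
  have U: "subfld (UNIV :: complex set)" by (simp add: subfld_def)
  have "q = [:a:] * (\<Prod>b\<leftarrow>bs. [:- b, 1:])" using a(2) by simp
  then have "map_poly fls_const q = map_poly fls_const [:a:] * map_poly fls_const (\<Prod>b\<leftarrow>bs. [:- b, 1:])"
    using map_fhom_mult[OF U fls_const_hom, of "[:a:]"] by (simp add: pover_def)
  also have "\<dots> = [:fls_const a:] * (\<Prod>b\<leftarrow>bs. [:- fls_const b, 1:])"
    using map_fhom_prod_linear[OF U fls_const_hom, of bs] by (simp add: map_fhom_pCons[OF U fls_const_hom])
  finally have "poly (map_poly fls_const q) (fls_const w + fls_X) =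
      fls_const a * (\<Prod>b\<leftarrow>bs. fls_const w + fls_X - fls_const b)"
    by (simp add: poly_prod_linear)
  moreover have "fls_const w + fls_X - fls_const b \<noteq> 0" for b :: complex
  proof
    assume "fls_const w + fls_X - fls_const b = 0"
    then have "fls_nth (fls_const w + fls_X - fls_const b) 1 = 0" by simp
    then show False by simp
  qed
  ultimately show ?thesis using a(1) by (auto simp: prod_list_zero_iff)
qed

lemma fps_complex_sqrt:
  fixes z :: "complex fps"
  assumes "fps_nth z 0 \<noteq> 0"
  shows "\<exists>y. y\<^sup>2 = z"
proof -
  \<comment> \<open>The power series radical expects a choice of roots of the constant term for
    every exponent; only exponent two occurs here.\<close>
  define r where "r n w = csqrt w" for n :: nat and w
  have "r (Suc 1) (fps_nth z 0) ^ Suc 1 = fps_nth z 0" by (simp add: r_def flip: power2_eq_square)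
  then have "fps_radical r (Suc 1) z ^ Suc 1 = z" using power_radical[of z r 1] assms by simp
  then show ?thesis by (metis Suc_1)
qed

locale critical_tower = quadratic_tower +
  fixes c :: complex
  assumes crit: "poly (pderiv f) c = 0"
begin

definition a where "a = Polynomial.lead_coeff f"
definition v where "v = poly f c"

lemma a_nonzero: "a \<noteq> 0"
  by (metis a_def deg_f degree_0 leading_coeff_0_iff zero_neq_numeral)

lemma a_in_K: "a \<in> K"
  using fK by (simp add: a_def pover_def)

lemma f_coeffs: "f = [:Polynomial.coeff f 0, Polynomial.coeff f 1, a:]"
proof (rule poly_eqI)
  fix n
  show "Polynomial.coeff f n = Polynomial.coeff [:Polynomial.coeff f 0, Polynomial.coeff f 1, a:] n"
    using deg_f by (auto simp: coeff_pCons a_def numeral_2_eq_2 Polynomial.coeff_eq_0 split: nat.splits)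
qed

lemma c_eq: "Polynomial.coeff f 1 = - 2 * a * c"
proof -
  have "pderiv f = [:Polynomial.coeff f 1, 2 * a:]" by (subst f_coeffs) (simp add: pderiv_pCons)
  then show ?thesis using crit by (simp add: eq_neg_iff_add_eq_0 algebra_simps)
qed

lemma c_in_K: "c \<in> K"
proof -
  have "c = Polynomial.coeff f 1 / (- 2 * a)" using c_eq a_nonzero by simp
  moreover have "Polynomial.coeff f 1 / (- 2 * a) \<in> K"
    using fK a_in_K by (intro subfld_divide[OF K] subfld_mult[OF K] subfld_uminus[OF K] subfld_numeral[OF K])
      (auto simp: pover_def)
  ultimately show ?thesis by simp
qed

lemma f_square: "f = Polynomial.smult a ([:- c, 1:]\<^sup>2) + [:v:]"
proof -
  have "v = Polynomial.coeff f 0 - a * c\<^sup>2"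
    unfolding v_def by (subst f_coeffs) (simp add: c_eq[unfolded One_nat_def] power2_eq_square algebra_simps)
  then show ?thesis
    by (subst f_coeffs) (simp add: c_eq[unfolded One_nat_def] power2_eq_square algebra_simps)
qed

lemma poly_f: "poly f x = a * (x - c)\<^sup>2 + v"
  by (subst f_square) (simp add: power2_eq_square algebra_simps)

lemma v_in_K: "v \<in> K"
  unfolding v_def using poly_f_closed[OF K _ c_in_K] by simp

lemma reflect: "poly f (2 * c - x) = poly f x"
  by (simp add: poly_f power2_commute)

lemma poly_f_eq_iff: "poly f x = poly f y \<longleftrightarrow> x = y \<or> x = 2 * c - y"
proof -
  have "poly f x = poly f y \<longleftrightarrow> (x - c)\<^sup>2 = (y - c)\<^sup>2" using a_nonzero by (simp add: poly_f)
  also have "\<dots> \<longleftrightarrow> x - c = y - c \<or> x - c = - (y - c)" by (rule power2_eq_iff)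
  also have "\<dots> \<longleftrightarrow> x = y \<or> x = 2 * c - y" by (auto simp: algebra_simps)
  finally show ?thesis .
qed

text \<open>Evaluate the factorisation of \<open>iterp f m - [:w:]\<close> at the critical value
  \<open>v\<close>: if \<open>y\<close> is a preimage of a root \<open>b\<close>, then
  \<open>v - b\<close> is \<open>- a\<close> times the square of \<open>y - c\<close>. The field
  \<open>E\<close> is left open because the relation over \<open>w\<close> is later read inside the
  tower over a different point.\<close>

lemma critical_value_product:
  obtains A G where "A \<in> K" "(poly f ^^ Suc m) c - w = A * G\<^sup>2"
    "\<And>E. subfld E \<Longrightarrow> K \<subseteq> E \<Longrightarrow> iter_level f w (Suc m) \<subseteq> E \<Longrightarrow> G \<in> E"
proof -
  have "\<exists>y\<in>UNIV. 2 * c - y \<in> UNIV \<and> a * (y - c)\<^sup>2 + v = b" for b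
    using poly_f_surj[of b] by (simp add: poly_f)
  then obtain bs where bs: "length bs = 2 ^ m" "\<forall>b\<in>set bs. (poly f ^^ m) b = w"
    "iterp f m - [:w:] = Polynomial.smult (a ^ (2 ^ m - 1)) (\<Prod>b\<leftarrow>bs. [:- b, 1:])"
    using iterp_factorization[OF f_square a_nonzero, of UNIV w m] by blast
  obtain y where y: "\<And>b. poly f (y b) = b" using poly_f_surj by metis
  have vb: "v - b = - a * (y b - c)\<^sup>2" for b using y[of b] by (simp add: poly_f algebra_simps)
  have pr: "(\<Prod>b\<leftarrow>bs. v - b) = (- a) ^ length bs * (\<Prod>b\<leftarrow>bs. y b - c)\<^sup>2" for bs
    unfolding vb by (induction bs) (simp_all add: power_mult_distrib mult_ac)
  have "(poly f ^^ Suc m) c - w = poly (iterp f m - [:w:]) v"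
    by (simp add: poly_iterp v_def funpow_swap1)
  also have "\<dots> = a ^ (2 ^ m - 1) * (\<Prod>b\<leftarrow>bs. v - b)" unfolding bs(3) by (simp add: poly_prod_linear)
  also have "\<dots> = (a ^ (2 ^ m - 1) * (- a) ^ length bs) * (\<Prod>b\<leftarrow>bs. y b - c)\<^sup>2" unfolding pr by simp
  finally have e: "(poly f ^^ Suc m) c - w = (a ^ (2 ^ m - 1) * (- a) ^ length bs) * (\<Prod>b\<leftarrow>bs. y b - c)\<^sup>2" .
  show ?thesis
  proof (rule that[OF _ e])
    show "a ^ (2 ^ m - 1) * (- a) ^ length bs \<in> K"
      by (intro subfld_mult[OF K] subfld_power[OF K] subfld_uminus[OF K] a_in_K)
    fix E assume E: "subfld E" "K \<subseteq> E" "iter_level f w (Suc m) \<subseteq> E"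
    have "y b - c \<in> E" if "b \<in> set bs" for b
    proof -
      have "y b \<in> iter_level f w (Suc m)" using bs(2) that y by (simp add: iter_level_def funpow_swap1)
      then show ?thesis using E c_in_K by (intro subfld_diff[OF E(1)]) auto
    qed
    then show "(\<Prod>b\<leftarrow>bs. y b - c) \<in> E" by (intro subfld_prod_list[OF E(1)]) auto
  qed
qed

lemma post_critical_forward: "p \<in> post_critical f c \<Longrightarrow> poly f p \<in> post_critical f c"
  unfolding post_critical_def using funpow.simps(2) by (smt (verit) comp_apply le_SucI mem_Collect_eq)

lemma v_post_critical: "v \<in> post_critical f c"
  unfolding post_critical_def v_def by (auto intro!: exI[of _ 1])

text \<open>
  The local parameter at a point \<open>q\<close> outside the post-critical set embeds the tower into the
  Laurent series, because no ramification occurs there.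
\<close>

lemma unramified_embedding:
  assumes u: "\<not> algover K u" and q: "q \<notin> post_critical f c"
  obtains E \<theta> where "subfld E" "tower_field K f u \<subseteq> E" "fhom E \<theta>"
    "\<And>x. x \<in> K \<Longrightarrow> \<theta> x = fls_const x" "\<theta> u = fls_const q + fls_X"
proof -
  let ?U = "fls_const q + fls_X :: complex fls"
  obtain h where h: "fhom (ratfun K u) h" "\<forall>x\<in>K. h x = fls_const x" "h u = ?U"
    using transcendental_extension_hom[OF K fls_const_hom u, of ?U] fls_const_X_transcendental by blast
  have B: "subfld (base_field K u)" "fhom (base_field K u) h" using h(1) subfld_base by (auto simp: base_eq_ratfun)
  have fB: "f \<in> pover (base_field K u)" using fK pover_mono[OF base_incl(1)] by blast
  have mf: "map_poly h f = Polynomial.smult (fls_const a) ([:- fls_const c, 1:]\<^sup>2) + [:fls_const v:]"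
  proof -
    have "map_poly h f = map_poly fls_const f"
      using fK h(2) by (intro poly_eqI) (auto simp: coeff_map_fhom[OF B] coeff_map_poly pover_def)
    also have "\<dots> = map_poly fls_const [:a * c\<^sup>2 + v, - 2 * a * c, a:]"
      by (subst f_square) (simp add: power2_eq_square algebra_simps)
    also have "\<dots> = Polynomial.smult (fls_const a) ([:- fls_const c, 1:]\<^sup>2) + [:fls_const v:]"
      by (simp add: map_poly_pCons power2_eq_square algebra_simps fls_plus_const)
        (simp add: fls_plus_const flip: fls_const_mult_const)
    finally show ?thesis .
  qed
  \<comment> \<open>Closed under preimages: \<open>f\<close> maps the constant term of a preimage to
    that of \<open>z\<close>, and \<open>f\<close> preserves the post-critical set. Since
    \<open>v\<close> is post-critical, \<open>z\<close> minus \<open>v\<close> has nonzero constant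
    term, so the square root is again a power series.\<close>
  define S where "S = {fps_to_fls z | z :: complex fps. fps_nth z 0 \<notin> post_critical f c}"
  have S: "\<exists>y\<in>S. 2 * fls_const c - y \<in> S \<and> fls_const a * (y - fls_const c)\<^sup>2 + fls_const v = b" if bS: "b \<in> S" for b
  proof -
    obtain z where z: "b = fps_to_fls z" "fps_nth z 0 \<notin> post_critical f c" using bS by (auto simp: S_def)
    have "fps_nth z 0 \<noteq> v" using z(2) v_post_critical by auto
    then obtain w where w: "w\<^sup>2 = fps_const (1 / a) * (z - fps_const v)"
      using fps_complex_sqrt[of "fps_const (1 / a) * (z - fps_const v)"] a_nonzero by auto
    define y where "y = w + fps_const c"
    have e: "fps_const a * (y - fps_const c)\<^sup>2 + fps_const v = z"
      using a_nonzero by (simp add: y_def w flip: mult.assoc)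
    have "poly f (fps_nth y 0) = fps_nth (fps_const a * (y - fps_const c)\<^sup>2 + fps_const v) 0"
      by (simp add: poly_f fps_nth_power_0)
    also have "\<dots> = fps_nth z 0" by (simp only: e)
    finally have "poly f (fps_nth y 0) = fps_nth z 0" .
    then have y0: "fps_nth y 0 \<notin> post_critical f c" "fps_nth (fps_const (2 * c) - y) 0 \<notin> post_critical f c"
      using z(2) post_critical_forward[of "fps_nth y 0"] post_critical_forward[of "2 * c - fps_nth y 0"]
      by (auto simp: reflect)
    have "fls_const a * (fps_to_fls y - fls_const c)\<^sup>2 + fls_const v = fps_to_fls (fps_const a * (y - fps_const c)\<^sup>2 + fps_const v)"
      by (simp add: fls_times_fps_to_fls fps_to_fls_power)
    then have "fls_const a * (fps_to_fls y - fls_const c)\<^sup>2 + fls_const v = b" by (simp add: e z(1))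
    moreover have "fps_to_fls y \<in> S" using y0 by (auto simp: S_def)
    moreover have "2 * fls_const c - fps_to_fls y = fps_to_fls (fps_const (2 * c) - y)"
      by (simp flip: fls_const_mult_const)
    then have "2 * fls_const c - fps_to_fls y \<in> S" using y0(2) unfolding S_def by blast
    ultimately show ?thesis by blast
  qed
  have "?U = fps_to_fls (fps_const q + fps_X)" by simp
  moreover have "fps_nth (fps_const q + fps_X) 0 \<notin> post_critical f c" using q by simp
  ultimately have US: "?U \<in> S" unfolding S_def by blast
  have "fls_const a \<noteq> 0" using a_nonzero by simp
  note fac = iterp_factorization[OF mf this S US]
  have ct: "countable (\<Union>n. iter_level f u n)" using finite_iter_level by (auto intro: countable_finite)
  have lev: "\<exists>P\<in>pover (base_field K u). P \<noteq> 0 \<and> poly P z = 0 \<and> splits (map_poly h P)" if "z \<in> iter_level f u n" for z n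
  proof (intro bexI conjI)
    have i: "iterp f n \<in> pover (base_field K u)" "[:u:] \<in> pover (base_field K u)"
      using pover_iterp[OF B(1) fB] pover_const[OF B(1) base_incl(2)] by auto
    then show "iterp f n - [:u:] \<in> pover (base_field K u)" by (rule pover_diff[OF B(1)])
    show "poly (iterp f n - [:u:]) z = 0" using that by (simp add: iter_level_roots)
    have "map_poly h (iterp f n - [:u:]) = iterp (map_poly h f) n - [:?U:]"
      using map_fhom_diff[OF B i] map_fhom_iterp[OF B fB] h(3)
      by (simp add: map_fhom_pCons[OF B])
    then show "splits (map_poly h (iterp f n - [:u:]))"
      using fac[of n] a_nonzero unfolding splits_def by (metis power_not_zero fls_const_eq_0_iff)
  qed (rule iterp_minus_nonzero)
  have ann: "\<exists>P\<in>pover (base_field K u). P \<noteq> 0 \<and> poly P z = 0 \<and> splits (map_poly h P)"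
    if "z \<in> (\<Union>n. iter_level f u n)" for z
    using that by (elim UN_E) (rule lev)
  obtain E g where E: "subfld E" "base_field K u \<subseteq> E" "(\<Union>n. iter_level f u n) \<subseteq> E" "fhom E g"
    "\<And>x. x \<in> base_field K u \<Longrightarrow> g x = h x"
    by (rule hom_extension[OF B ct ann]) (assumption | rule that)+
  have T: "tower_field K f u \<subseteq> E" using E(2,3) by (intro tower_least[OF E(1)]) blast+
  have gK: "g x = fls_const x" if "x \<in> K" for x
    using E(5)[of x] h(2) that base_incl(1)[of u] by auto
  have gu: "g u = ?U" using E(5)[OF base_incl(2)] h(3) by simp
  show ?thesis by (rule that[OF E(1) T E(4) gK gu])
qed

text \<open>If all these roots lay in the tower over \<open>u\<close>, then \<open>u - ?q\<close>
  would be an element of \<open>K\<close> times a square there. The embedding at \<open>?q\<close>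
  sends it to \<open>fls_X\<close>, contradicting parity.\<close>

lemma ramified_root_notin_tower:
  assumes u: "\<not> algover K u" and p: "2 * c - (poly f ^^ Suc m) c \<notin> post_critical f c"
  shows "\<exists>y\<in>iter_level f (2 * c - u) (Suc m). y \<notin> tower_field K f u"
proof (rule ccontr)
  assume "\<not> ?thesis"
  then have sub: "iter_level f (2 * c - u) (Suc m) \<subseteq> tower_field K f u" by auto
  obtain A G where AG: "A \<in> K" "(poly f ^^ Suc m) c - (2 * c - u) = A * G\<^sup>2" "G \<in> tower_field K f u"
    using critical_value_product[of m "2 * c - u"] subfld_tower[of u] K_tower[of u] sub by metis
  let ?q = "2 * c - (poly f ^^ Suc m) c"
  obtain E \<theta> where E: "subfld E" "tower_field K f u \<subseteq> E" "fhom E \<theta>"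
    "\<And>x. x \<in> K \<Longrightarrow> \<theta> x = fls_const x" "\<theta> u = fls_const ?q + fls_X"
    using unramified_embedding[OF u p] by metis
  have q: "?q \<in> K"
    using iter_closed[OF K _ c_in_K, of "Suc m"] c_in_K
    by (intro subfld_diff[OF K] subfld_mult[OF K] subfld_numeral[OF K]) auto
  have inE: "A \<in> E" "G \<in> E" "u \<in> E" "?q \<in> E"
    using AG q E(2) K_tower[of u] base_tower[of u] base_incl(2)[of u] by blast+
  have "u - ?q = A * G\<^sup>2" using AG(2) by (simp add: algebra_simps)
  then have "\<theta> u - \<theta> ?q = \<theta> A * (\<theta> G)\<^sup>2"
    using fhom_diff[OF E(1,3) inE(3,4)] fhom_mult[OF E(1,3) inE(1) subfld_power[OF E(1) inE(2)]]
      fhom_power[OF E(1,3) inE(2)] by simp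
  then have "fls_X = fls_const A * (\<theta> G)\<^sup>2" using E(4)[OF q] E(4)[OF AG(1)] E(5) by simp
  then show False using fls_X_not_square by blast
qed

text \<open>The same parity argument at \<open>v\<close>, inside the base field:
  \<open>u - v\<close> equals \<open>a\<close> times the square of \<open>y - c\<close>, and
  expanding in \<open>u - v\<close> gives order 1.\<close>

lemma preimage_notin_base:
  assumes "\<not> algover K u" "poly f y = u"
  shows "y \<notin> base_field K u"
proof
  assume y: "y \<in> base_field K u"
  obtain h where h: "fhom (ratfun K u) h" "\<forall>x\<in>K. h x = fls_const x" "h u = fls_const v + fls_X"
    using transcendental_extension_hom[OF K fls_const_hom assms(1), of "fls_const v + fls_X"]
      fls_const_X_transcendental by blast
  have B: "subfld (base_field K u)" "fhom (base_field K u) h" using h(1) subfld_base by (auto simp: base_eq_ratfun)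
  have inB: "a \<in> base_field K u" "c \<in> base_field K u" "v \<in> base_field K u" "u \<in> base_field K u"
    using a_in_K c_in_K v_in_K base_incl[of u] by auto
  have "u = a * (y - c)\<^sup>2 + v" using assms(2) by (simp add: poly_f)
  then have "u - v = a * (y - c)\<^sup>2" by simp
  then have "h u - h v = h a * (h (y - c))\<^sup>2"
    using fhom_diff[OF B inB(4,3)] fhom_mult[OF B inB(1) subfld_power[OF B(1)]]
      fhom_power[OF B] subfld_diff[OF B(1) y inB(2)] by simp
  then have "fls_X = fls_const a * (h (y - c))\<^sup>2" using h v_in_K a_in_K by simp
  then show False using fls_X_not_square by blast
qed

end

section \<open>Actions that are not locally quasi-analytic\<close>

lemma path_cylinder_open:
  assumes V: "V 0 = {x\<^sub>0}"
  shows "openin (Metric_space.mtopology (path_space V p) path_dist) {w \<in> path_space V p. w n = x}"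
proof -
  interpret M: Metric_space "path_space V p" path_dist by (rule path_metric[of V x\<^sub>0 p, OF V])
  show ?thesis
    unfolding M.openin_mtopology
  proof (intro conjI allI impI)
    fix w assume w: "w \<in> {w \<in> path_space V p. w n = x}"
    have "w' n = w n" if w': "w' \<in> M.mball w ((1/2)^n)" for w'
    proof -
      have "w \<in> path_space V p" "w' \<in> path_space V p" using w w' by auto
      then have "w 0 \<in> V 0" "w' 0 \<in> V 0" by (auto simp: path_space_def)
      then have "w 0 = w' 0" using V by simp
      moreover have "path_dist w w' \<le> (1/2)^n" using w' by simp
      ultimately show ?thesis using path_dist_le_iff[of w w' n] by simp
    qed
    then show "\<exists>r>0. M.mball w r \<subseteq> {w \<in> path_space V p. w n = x}"
      using w by (intro exI[of _ "(1/2)^n"]) auto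
  qed auto
qed

lemma path_cylinder_ediam:
  assumes V: "V 0 = {x\<^sub>0}"
  shows "ediam path_dist {w \<in> path_space V p. w n = x} \<le> ereal ((1/2)^n)"
  unfolding ediam_def
proof (rule SUP_least)
  fix s assume s: "s \<in> {w \<in> path_space V p. w n = x} \<times> {w \<in> path_space V p. w n = x}"
  have down: "w i = (p ^^ (n - i)) x" if "w \<in> path_space V p" "w n = x" "i \<le> n" for w i
    using that(3)
  proof (induction i rule: inc_induct)
    case base
    then show ?case using that by simp
  next
    case (step i)
    have "w i = p (w (Suc i))" using that(1) by (simp add: path_space_def)
    moreover have "n - i = Suc (n - Suc i)" using step by simp
    ultimately show ?case using step by simp
  qed
  have "fst s \<in> path_space V p" "fst s n = x" "snd s \<in> path_space V p" "snd s n = x" using s by auto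
  then have "\<forall>i\<le>n. fst s i = snd s i" by (metis down)
  then have "path_dist (fst s) (snd s) \<le> (1/2)^n" using path_dist_le_iff[of "fst s" "snd s" n] by simp
  then show "ereal (path_dist (fst s) (snd s)) \<le> ereal ((1/2)^n)" by simp
qed

context quadratic_tower
begin

lemma iter_level_0: "iter_level f t 0 = {t}"
  by (auto simp: iter_level_def)

lemma path_through:
  assumes y: "y \<in> iter_level f t N"
  shows "\<exists>w\<in>path_space (iter_level f t) (poly f). w N = y"
proof -
  obtain g where g: "\<And>w. poly f (g w) = w" using poly_f_surj by metis
  have fg: "(poly f ^^ k) ((g ^^ k) z) = z" for k z
    by (induction k arbitrary: z) (simp_all add: funpow_swap1 g)
  define w where "w i = (if i \<le> N then (poly f ^^ (N - i)) y else (g ^^ (i - N)) y)" for i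
  have "w \<in> path_space (iter_level f t) (poly f)"
    unfolding path_space_def
  proof (intro CollectI allI conjI)
    fix n
    show "poly f (w (Suc n)) = w n"
    proof (cases "Suc n \<le> N")
      case True
      then have "N - n = Suc (N - Suc n)" by simp
      then show ?thesis using True by (simp add: w_def)
    next
      case False
      then have "Suc n - N = Suc (n - N)" by simp
      then show ?thesis using False g by (auto simp: w_def)
    qed
    show "w n \<in> iter_level f t n"
    proof (cases "n \<le> N")
      case True
      then have "(poly f ^^ n) ((poly f ^^ (N - n)) y) = (poly f ^^ N) y"
        by (simp flip: comp_apply[of "poly f ^^ n"] funpow_add)
      then show ?thesis using y True by (simp add: w_def iter_level_def)
    next
      case False
      then have "n = N + (n - N)" by simp
      then have "(poly f ^^ n) z = (poly f ^^ N) ((poly f ^^ (n - N)) z)" for z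
        by (metis comp_apply funpow_add)
      then show ?thesis using y False fg by (simp add: w_def iter_level_def)
    qed
  qed
  moreover have "w N = y" by (simp add: w_def)
  ultimately show ?thesis by blast
qed

lemma iter_transcendental:
  assumes "\<not> algover K t" "u \<in> iter_level f t n"
  shows "\<not> algover K u"
proof
  assume "algover K u"
  then have "algover K (poly (iterp f n) u)" by (rule algover_poly[OF K _ pover_iterp[OF K fK]])
  then show False using assms by (simp add: poly_iterp iter_level_def)
qed

lemma iter_level_nonempty: "\<exists>z. z \<in> iter_level f t n"
proof (induction n)
  case (Suc n)
  then obtain z where "z \<in> iter_level f t n" ..
  moreover obtain y where "poly f y = z" using poly_f_surj by blast
  ultimately show ?case by (auto simp: iter_level_def funpow_swap1 intro!: exI[of _ y])
qed (simp add: iter_level_0)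

end

context critical_tower
begin

text \<open>The violating pair consists of \<open>\<sigma>\<close> and the identity, with
  \<open>?U\<close> the cylinder of \<open>x\<close> and \<open>?V\<close> that of its child
  \<open>u\<close>.\<close>

lemma not_LQA:
  assumes t: "\<not> algover K t" and p: "2 * c - (poly f ^^ Suc m) c \<notin> post_critical f c"
  shows "\<not> gal_arith_LQA K f t"
proof
  let ?P = "path_space (iter_level f t) (poly f)" and ?G = "gal_arith K f t"
  assume "gal_arith_LQA K f t"
  then obtain \<epsilon> where \<epsilon>: "\<epsilon> > 0" and L: "\<forall>U V. \<forall>g1\<in>carrier ?G. \<forall>g2\<in>carrier ?G.
      openin (Metric_space.mtopology ?P path_dist) U \<longrightarrow> ediam path_dist U < ereal \<epsilon> \<longrightarrow>
      openin (Metric_space.mtopology ?P path_dist) V \<longrightarrow> V \<noteq> {} \<longrightarrow> V \<subseteq> U \<longrightarrow>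
      (\<forall>x\<in>V. path_act (\<lambda>\<sigma>. \<sigma>) g1 x = path_act (\<lambda>\<sigma>. \<sigma>) g2 x) \<longrightarrow>
      (\<forall>x\<in>U. path_act (\<lambda>\<sigma>. \<sigma>) g1 x = path_act (\<lambda>\<sigma>. \<sigma>) g2 x)"
    unfolding tree_LQA_def LQA_def by (elim exE conjE)
  obtain n where n: "(1/2)^n < \<epsilon>" using real_arch_pow_inv[OF \<epsilon>, of "1/2"] by auto
  obtain x where x: "x \<in> iter_level f t n" using iter_level_nonempty by blast
  obtain u where u: "poly f u = x" using poly_f_surj by blast
  have ut: "u \<in> iter_level f t (Suc n)" using u x by (simp add: iter_level_def funpow_swap1)
  have utr: "\<not> algover K u" by (rule iter_transcendental[OF t ut])
  obtain y where y: "y \<in> iter_level f (2 * c - u) (Suc m)" "y \<notin> tower_field K f u"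
    using ramified_root_notin_tower[OF utr p] by blast
  have u': "2 * c - u \<in> iter_level f t (Suc n)" using ut by (simp add: iter_level_def funpow_swap1 reflect)
  have yt: "y \<in> iter_level f t (Suc n + Suc m)" using iter_level_add[OF y(1) u'] .
  let ?E = "tower_field K f u"
  note E = subfld_tower[of u]
  have uE: "u \<in> ?E" using base_tower base_incl(2) by blast
  have "t \<in> ?E" using iter_closed[OF E K_tower uE, of "Suc n"] ut by (simp add: iter_level_def)
  then have bE: "base_field K t \<subseteq> ?E" using base_least[OF E K_tower] by blast
  have P: "iterp f (Suc m) - [:2 * c - u:] \<in> pover ?E"
    using pover_iterp[OF E, of f "Suc m"] fK pover_mono[OF K_tower[of u]] c_in_K K_tower[of u] uE
    by (intro pover_diff[OF E] pover_const[OF E] subfld_diff[OF E] subfld_mult[OF E] subfld_numeral[OF E]) auto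
  have "poly (iterp f (Suc m) - [:2 * c - u:]) y = 0"
    using y(1) by (simp only: iter_level_roots mem_Collect_eq)
  then obtain \<sigma> where \<sigma>: "\<sigma> \<in> carrier ?G" "\<forall>z\<in>?E \<inter> tower_field K f t. \<sigma> z = z" "\<sigma> y \<noteq> y"
    using gal_exists[OF E bE _ y(2) P iterp_minus_nonzero] yt iter_level_tower[of t] by blast
  interpret G: group ?G by (rule group_gal_arith)
  have one: "\<one>\<^bsub>?G\<^esub> z = z" if "z \<in> iter_level f t i" for z i
    using that iter_level_tower[of t i] unfolding gal_arith_def gal_group_simps by auto
  let ?U = "{w \<in> ?P. w n = x}" and ?V = "{w \<in> ?P. w (Suc n) = u}"
  have VU: "?V \<subseteq> ?U" using u by (auto simp: path_space_def)
  have fixV: "path_act (\<lambda>\<sigma>. \<sigma>) \<sigma> w = path_act (\<lambda>\<sigma>. \<sigma>) \<one>\<^bsub>?G\<^esub> w" if w: "w \<in> ?V" for w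
  proof -
    have wl: "w i \<in> iter_level f t i" and wp: "poly f (w (Suc i)) = w i" for i
      using w by (auto simp: path_space_def)
    have it: "(poly f ^^ k) (w (i + k)) = w i" for i k
      by (induction k) (simp_all add: funpow_swap1 wp)
    \<comment> \<open>Up to level \<open>Suc n\<close> the vertices of \<open>w\<close> are iterates
      of \<open>u\<close>, beyond it they are iterated preimages of \<open>u\<close>.\<close>
    have wE: "w i \<in> ?E" for i
    proof (cases "i \<le> Suc n")
      case True
      then have "w i = (poly f ^^ (Suc n - i)) u" using it[of "Suc n - i" i] w by simp
      then show ?thesis using iter_closed[OF E K_tower uE] by simp
    next
      case False
      then have "(poly f ^^ (i - Suc n)) (w i) = u" using it[of "i - Suc n" "Suc n"] w by simp
      then show ?thesis using iter_level_tower[of u "i - Suc n"] by (auto simp: iter_level_def)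
    qed
    show ?thesis
      using \<sigma>(2) wE wl one iter_level_tower[of t] unfolding path_act_def by (intro ext) (metis IntI subsetD)
  qed
  obtain w where w: "w \<in> ?P" "w (Suc n + Suc m) = y" using path_through[OF yt] by blast
  have wp: "poly f (w (Suc i)) = w i" for i using w by (auto simp: path_space_def)
  have it: "(poly f ^^ k) (w (i + k)) = w i" for i k
    by (induction k) (simp_all add: funpow_swap1 wp)
  have "w (Suc n) = 2 * c - u" using it[of "Suc m" "Suc n"] w(2) y(1) by (simp add: iter_level_def)
  then have "w n = x" using wp[of n] u reflect by simp
  then have wU: "w \<in> ?U" using w by simp
  obtain w' where "w' \<in> ?V" using path_through[OF ut] by blast
  then have "?V \<noteq> {}" by blast
  have "ediam path_dist ?U < ereal \<epsilon>"
    by (rule le_less_trans[OF path_cylinder_ediam[of "iter_level f t" t "poly f" n x, OF iter_level_0]]) (use n in simp)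
  moreover have "openin (Metric_space.mtopology ?P path_dist) ?U"
    by (rule path_cylinder_open[of "iter_level f t" t "poly f", OF iter_level_0])
  moreover have "openin (Metric_space.mtopology ?P path_dist) ?V"
    by (rule path_cylinder_open[of "iter_level f t" t "poly f", OF iter_level_0])
  moreover have "\<forall>w\<in>?V. path_act (\<lambda>\<sigma>. \<sigma>) \<sigma> w = path_act (\<lambda>\<sigma>. \<sigma>) \<one>\<^bsub>?G\<^esub> w"
    by (rule ballI) (rule fixV)
  ultimately have "\<forall>w\<in>?U. path_act (\<lambda>\<sigma>. \<sigma>) \<sigma> w = path_act (\<lambda>\<sigma>. \<sigma>) \<one>\<^bsub>?G\<^esub> w"
    using L[THEN spec[of _ ?U], THEN spec[of _ ?V], THEN bspec[of _ _ \<sigma>, OF _ \<sigma>(1)],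
        THEN bspec[of _ _ "\<one>\<^bsub>?G\<^esub>", OF _ G.one_closed]] \<open>?V \<noteq> {}\<close> VU
    by (elim impE) assumption+
  then have "path_act (\<lambda>\<sigma>. \<sigma>) \<sigma> w = path_act (\<lambda>\<sigma>. \<sigma>) \<one>\<^bsub>?G\<^esub> w" using wU by (rule bspec)
  then have "\<sigma> y = \<one>\<^bsub>?G\<^esub> y" unfolding path_act_def w(2)[symmetric] by metis
  then show False using one[OF yt] \<sigma>(3) by simp
qed

section \<open>Asymmetry of the post-critical set\<close>

lemma post_critical_image: "poly f ` post_critical f c \<subseteq> post_critical f c"
  using post_critical_forward by blast

text \<open>Periodicity makes \<open>f\<close> map the finite post-critical set onto itself, hence
  injectively. A point and its reflection have the same image, so if both are post-critical they
  coincide and equal \<open>c\<close>.\<close>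

lemma unsymmetric_periodic:
  assumes fin: "finite (post_critical f c)" and c: "c \<in> post_critical f c" and r: "card (post_critical f c) \<ge> 2"
  shows "\<exists>q\<in>post_critical f c. 2 * c - q \<notin> post_critical f c"
proof -
  let ?P = "post_critical f c"
  obtain k where k: "k \<ge> 1" "c = (poly f ^^ k) c" using c by (auto simp: post_critical_def)
  have "?P \<subseteq> poly f ` ?P"
  proof
    fix x assume "x \<in> ?P"
    then obtain m where m: "m \<ge> 1" "x = (poly f ^^ m) c" by (auto simp: post_critical_def)
    have "x = (poly f ^^ m) ((poly f ^^ k) c)" using m k by simp
    also have "\<dots> = (poly f ^^ (m + k)) c" by (simp add: funpow_add)
    also have "m + k = Suc (m + k - 1)" using k by simp
    finally have "x = poly f ((poly f ^^ (m + k - 1)) c)" by simp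
    moreover have "m + k - 1 \<ge> 1" using m k by simp
    ultimately show "x \<in> poly f ` ?P" unfolding post_critical_def by blast
  qed
  then have inj: "inj_on (poly f) ?P"
    using fin post_critical_image by (intro eq_card_imp_inj_on) (auto simp: subset_antisym)
  \<comment> \<open>\<open>c\<close> is its own reflection, so a second point is needed.\<close>
  obtain q where q: "q \<in> ?P" "q \<noteq> c"
  proof -
    have "\<not> ?P \<subseteq> {c}" using r card_mono[of "{c}" ?P] by auto
    then show ?thesis using that by blast
  qed
  have "2 * c - q \<notin> ?P"
  proof
    assume "2 * c - q \<in> ?P"
    then have "2 * c - q = q" using inj q(1) reflect by (auto simp: inj_on_def)
    then have "c = q" by (simp add: algebra_simps)
    then show False using q(2) by simp
  qed
  then show ?thesis using q by blast
qed

text \<open>Let \<open>P\<close> be the set and suppose it is symmetric. As \<open>c\<close> is not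
  in it, every fibre over \<open>f(P)\<close> has at least two points, so
  \<open>2 |f(P)| \<le> |P|\<close>. But only \<open>v\<close> can fail to lie in
  \<open>f(P)\<close>, so \<open>|P| \<le> |f(P)| + 1\<close>, and together
  \<open>|P| \<le> 2\<close>.\<close>

lemma unsymmetric_preperiodic:
  assumes fin: "finite (post_critical f c)" and c: "c \<notin> post_critical f c" and r: "card (post_critical f c) \<ge> 3"
  shows "\<exists>q\<in>post_critical f c. 2 * c - q \<notin> post_critical f c"
proof (rule ccontr)
  let ?P = "post_critical f c"
  assume no: "\<not> ?thesis"
  have "?P \<subseteq> insert v (poly f ` ?P)"
  proof
    fix x assume "x \<in> ?P"
    then obtain m where m: "m \<ge> 1" "x = (poly f ^^ m) c" by (auto simp: post_critical_def)
    show "x \<in> insert v (poly f ` ?P)"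
    proof (cases "m = 1")
      case True
      then show ?thesis using m by (simp add: v_def)
    next
      case False
      then have "x = poly f ((poly f ^^ (m - 1)) c)" "m - 1 \<ge> 1" using m by (auto simp flip: funpow.simps(2) comp_apply[of "poly f"])
      then show ?thesis unfolding post_critical_def by blast
    qed
  qed
  then have 1: "card ?P \<le> Suc (card (poly f ` ?P))"
    using fin card_mono[of "insert v (poly f ` ?P)" ?P] by (simp add: card_insert_if split: if_splits)
  have fib: "card {x \<in> ?P. poly f x = y} \<ge> 2" if "y \<in> poly f ` ?P" for y
  proof -
    obtain x where x: "x \<in> ?P" "poly f x = y" using \<open>y \<in> _\<close> by auto
    have "2 * c - x \<in> ?P" using no x by auto
    moreover have "2 * c - x \<noteq> x" using x(1) c by (auto simp: algebra_simps)
    ultimately have "{x, 2 * c - x} \<subseteq> {x \<in> ?P. poly f x = y}" "card {x, 2 * c - x} = 2"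
      using x reflect by auto
    then show ?thesis using card_mono[of "{x \<in> ?P. poly f x = y}" "{x, 2 * c - x}"] fin by auto
  qed
  have "card ?P = (\<Sum>y\<in>poly f ` ?P. card {x \<in> ?P. poly f x = y})"
    using sum.image_gen[OF fin, of "\<lambda>_. 1::nat" "poly f"] by simp
  also have "\<dots> \<ge> (\<Sum>y\<in>poly f ` ?P. 2)" by (rule sum_mono) (rule fib)
  finally have "2 * card (poly f ` ?P) \<le> card ?P" by simp
  then show False using 1 r by simp
qed

lemma not_LQA_of_unsymmetric:
  assumes t: "\<not> algover K t" and q: "\<exists>q\<in>post_critical f c. 2 * c - q \<notin> post_critical f c"
  shows "\<not> gal_arith_LQA K f t"
proof -
  obtain m where m: "m \<ge> 1" "2 * c - (poly f ^^ m) c \<notin> post_critical f c"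
    using q by (auto simp: post_critical_def)
  then show ?thesis using not_LQA[OF t, of "m - 1"] by simp
qed

end

section \<open>Discriminant groups of tree actions\<close>

locale tree_act = group G for G :: "('g, 'b) monoid_scheme" (structure) +
  fixes V :: "nat \<Rightarrow> 'v set" and p :: "'v \<Rightarrow> 'v" and \<phi> :: "'g \<Rightarrow> 'v \<Rightarrow> 'v" and x\<^sub>0 :: 'v
  assumes V0: "V 0 = {x\<^sub>0}"
    and act_in: "\<lbrakk>g \<in> carrier G; w \<in> V n\<rbrakk> \<Longrightarrow> \<phi> g w \<in> V n"
    and act_p: "\<lbrakk>g \<in> carrier G; w \<in> V (Suc n)\<rbrakk> \<Longrightarrow> p (\<phi> g w) = \<phi> g (p w)"
    and act_one: "w \<in> V n \<Longrightarrow> \<phi> \<one> w = w"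
    and act_mult: "\<lbrakk>g \<in> carrier G; h \<in> carrier G; w \<in> V n\<rbrakk> \<Longrightarrow> \<phi> (g \<otimes> h) w = \<phi> g (\<phi> h w)"
begin

lemma act_inv: "\<lbrakk>g \<in> carrier G; w \<in> V n\<rbrakk> \<Longrightarrow> \<phi> (inv g) (\<phi> g w) = w"
  using act_mult[of "inv g" g w n] act_one by simp

lemma act_inv': "\<lbrakk>g \<in> carrier G; w \<in> V n\<rbrakk> \<Longrightarrow> \<phi> g (\<phi> (inv g) w) = w"
  using act_mult[of g "inv g" w n] act_one by simp

end

locale tree_act_path = tree_act +
  fixes x :: "nat \<Rightarrow> 'c"
  assumes x: "x \<in> path_space V p"
begin

abbreviation S where "S \<equiv> path_stab G \<phi> x"
abbreviation C where "C \<equiv> path_core G \<phi> x"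

lemma x_in: "x n \<in> V n" and x_p: "p (x (Suc n)) = x n"
  using x by (auto simp: path_space_def)

lemma S_iff: "g \<in> S n \<longleftrightarrow> g \<in> carrier G \<and> \<phi> g (x n) = x n"
  by (simp add: path_stab_def stabilizer_def)

lemma S_carrier: "g \<in> S n \<Longrightarrow> g \<in> carrier G"
  by (simp add: S_iff)

lemma S_subgroup: "subgroup (S n) G"
proof (rule subgroupI)
  show "S n \<subseteq> carrier G" by (auto simp: S_iff)
  have "\<one> \<in> S n" using act_one[OF x_in] by (simp add: S_iff)
  then show "S n \<noteq> {}" by auto
  show "inv g \<in> S n" if "g \<in> S n" for g using that act_inv[OF _ x_in, of g n] by (simp add: S_iff)
  show "g \<otimes> h \<in> S n" if "g \<in> S n" "h \<in> S n" for g h using that act_mult[OF _ _ x_in] by (simp add: S_iff)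
qed

lemma S_anti: "m \<le> n \<Longrightarrow> S n \<subseteq> S m"
proof (induction n rule: dec_induct)
  case (step n)
  have "S (Suc n) \<subseteq> S n" using act_p[OF _ x_in] by (auto simp: S_iff x_p) (metis x_p)
  then show ?case using step by blast
qed simp

text \<open>The conjugate of \<open>S n\<close> by \<open>g\<close> is the stabiliser of
  \<open>\<phi> g (x n)\<close>. So the core is the pointwise stabiliser of the orbit of
  \<open>x n\<close> under \<open>S m\<close>, and all later arguments use this form.\<close>

lemma core_iff: "c \<in> C m n \<longleftrightarrow> c \<in> carrier G \<and> (\<forall>g\<in>S m. \<phi> c (\<phi> g (x n)) = \<phi> g (x n))"
proof -
  have conj: "c \<in> g <# S n #> inv g \<longleftrightarrow> c \<in> carrier G \<and> \<phi> c (\<phi> g (x n)) = \<phi> g (x n)" if g: "g \<in> carrier G" for g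
  proof
    assume "c \<in> g <# S n #> inv g"
    then obtain s where s: "s \<in> S n" "c = g \<otimes> s \<otimes> inv g" by (auto simp: l_coset_def r_coset_def)
    have gx: "\<phi> g (x n) \<in> V n" using act_in[OF g x_in] .
    have "\<phi> c (\<phi> g (x n)) = \<phi> (g \<otimes> s) (\<phi> (inv g) (\<phi> g (x n)))"
      unfolding s(2) using g s(1) by (intro act_mult[OF _ _ gx]) (auto simp: S_iff)
    also have "\<dots> = \<phi> (g \<otimes> s) (x n)" using act_inv[OF g x_in] by simp
    also have "\<dots> = \<phi> g (x n)" using act_mult[OF g _ x_in, of s n] s(1) by (simp add: S_iff)
    finally show "c \<in> carrier G \<and> \<phi> c (\<phi> g (x n)) = \<phi> g (x n)" using s g by (simp add: S_iff)
  next
    assume c: "c \<in> carrier G \<and> \<phi> c (\<phi> g (x n)) = \<phi> g (x n)"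
    let ?s = "inv g \<otimes> (c \<otimes> g)"
    have "\<phi> ?s (x n) = \<phi> (inv g) (\<phi> c (\<phi> g (x n)))"
      using act_mult[OF _ _ x_in, of "inv g" "c \<otimes> g" n] act_mult[OF _ g x_in, of c n] c g by simp
    then have "?s \<in> S n" using c g act_inv[OF g x_in] by (simp add: S_iff)
    moreover have "g \<otimes> ?s \<otimes> inv g = c" using c g by (simp add: m_assoc inv_solve_left')
      (simp flip: m_assoc)
    ultimately show "c \<in> g <# S n #> inv g" unfolding l_coset_def r_coset_def by blast
  qed
  have "c \<in> C m n \<longleftrightarrow> (\<forall>g\<in>S m. c \<in> g <# S n #> inv g)" by (simp add: path_core_def)
  also have "\<dots> \<longleftrightarrow> (\<forall>g\<in>S m. c \<in> carrier G \<and> \<phi> c (\<phi> g (x n)) = \<phi> g (x n))"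
    using conj S_carrier by blast
  also have "\<dots> \<longleftrightarrow> c \<in> carrier G \<and> (\<forall>g\<in>S m. \<phi> c (\<phi> g (x n)) = \<phi> g (x n))"
    using subgroup.one_closed[OF S_subgroup[of m]] by blast
  finally show ?thesis .
qed

lemma core_carrier: "c \<in> C m n \<Longrightarrow> c \<in> carrier G"
  by (simp add: core_iff)

lemma gx_in: "g \<in> S m \<Longrightarrow> \<phi> g (x n) \<in> V n"
  by (rule act_in[OF S_carrier x_in])

lemma core_subgroup: "subgroup (C m n) G"
proof (rule subgroupI)
  show "C m n \<subseteq> carrier G" by (auto simp: core_iff)
  have "\<one> \<in> C m n" using act_one[OF gx_in] by (auto simp: core_iff)
  then show "C m n \<noteq> {}" by auto
  show "inv c \<in> C m n" if "c \<in> C m n" for c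
    using that act_inv[OF _ gx_in, of c] by (auto simp: core_iff) (metis)
  show "c \<otimes> d \<in> C m n" if "c \<in> C m n" "d \<in> C m n" for c d
    using that act_mult[OF _ _ gx_in] by (auto simp: core_iff)
qed

lemma core_sub_S: "C m n \<subseteq> S n"
proof
  fix c assume "c \<in> C m n"
  then show "c \<in> S n" using subgroup.one_closed[OF S_subgroup[of m]] act_one[OF x_in]
    by (auto simp: core_iff S_iff dest: bspec[of _ _ \<one>])
qed

lemma core_mono: "m \<le> k \<Longrightarrow> C m n \<subseteq> C k n"
  by (meson core_iff S_anti subsetD subsetI)

lemma core_Suc: "C m (Suc n) \<subseteq> C m n"
proof
  fix c assume c: "c \<in> C m (Suc n)"
  have "\<phi> c (\<phi> g (x n)) = \<phi> g (x n)" if g: "g \<in> S m" for g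
  proof -
    have "\<phi> g (x n) = p (\<phi> g (x (Suc n)))" using act_p[OF S_carrier[OF g] x_in] by (simp add: x_p)
    then show ?thesis using act_p[OF core_carrier[OF c] gx_in[OF g, of "Suc n"]] c g by (simp add: core_iff)
  qed
  then show "c \<in> C m n" using c by (simp add: core_iff)
qed

text \<open>An element of \<open>S n\<close> lies in \<open>S m\<close>, so it permutes the orbit
  whose points the core fixes.\<close>

lemma core_normal:
  assumes "m \<le> n"
  shows "C m n \<lhd> (G\<lparr>carrier := S n\<rparr>)"
proof -
  interpret Sn: group "G\<lparr>carrier := S n\<rparr>" by (rule subgroup_imp_group[OF S_subgroup])
  have sub: "subgroup (C m n) (G\<lparr>carrier := S n\<rparr>)"
    by (rule subgroup_incl[OF core_subgroup S_subgroup core_sub_S])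
  have "h \<otimes> c \<otimes> inv h \<in> C m n" if h: "h \<in> S n" and c: "c \<in> C m n" for h c
  proof -
    have hG: "h \<in> carrier G" and cG: "c \<in> carrier G" using h c by (auto simp: S_iff core_iff)
    have "\<phi> (h \<otimes> c \<otimes> inv h) (\<phi> g (x n)) = \<phi> g (x n)" if g: "g \<in> S m" for g
    proof -
      have gV: "\<phi> g (x n) \<in> V n" by (rule gx_in[OF g])
      have "inv h \<otimes> g \<in> S m" using S_subgroup[of m] S_anti[OF assms] h g
        by (meson subgroup.m_closed subgroup.m_inv_closed subsetD)
      then have "\<phi> c (\<phi> (inv h \<otimes> g) (x n)) = \<phi> (inv h \<otimes> g) (x n)" using c by (simp add: core_iff)
      moreover have "\<phi> (inv h \<otimes> g) (x n) = \<phi> (inv h) (\<phi> g (x n))"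
        by (rule act_mult[OF inv_closed[OF hG] S_carrier[OF g] x_in])
      ultimately have "\<phi> c (\<phi> (inv h) (\<phi> g (x n))) = \<phi> (inv h) (\<phi> g (x n))" by simp
      moreover have iV: "\<phi> (inv h) (\<phi> g (x n)) \<in> V n" by (rule act_in[OF inv_closed[OF hG] gV])
      ultimately show ?thesis
        using act_mult[OF _ _ gV, of "h \<otimes> c" "inv h"] act_mult[OF hG cG iV] act_inv'[OF hG gV] hG cG by simp
    qed
    then show ?thesis using hG cG by (simp add: core_iff)
  qed
  then show ?thesis
    using Sn.normal_inv_iff sub m_inv_consistent[OF S_subgroup] by simp
qed

lemma core_mult_coset:
  assumes "N \<subseteq> M" "subgroup N G" "subgroup M G" "h \<in> carrier G"
  shows "M <#> (N #> h) = M #> h"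
proof -
  have "M <#> (N #> h) = (M <#> N) #> h"
    using setmult_rcos_assoc[of M N h] assms subgroup.subset by metis
  also have "M <#> N = M"
  proof
    show "M <#> N \<subseteq> M" using assms(1) subgroup.m_closed[OF assms(3)] by (auto simp: set_mult_def)
    show "M \<subseteq> M <#> N"
    proof
      fix y assume "y \<in> M"
      then have "y = y \<otimes> \<one>" "\<one> \<in> N" using subgroup.subset[OF assms(3)] subgroup.one_closed[OF assms(2)] by auto
      then show "y \<in> M <#> N" using \<open>y \<in> M\<close> unfolding set_mult_def by blast
    qed
  qed
  finally show ?thesis .
qed

lemma coset_eq_iff:
  assumes "subgroup N G" "g \<in> carrier G" "h \<in> carrier G"
  shows "N #> g = N #> h \<longleftrightarrow> g \<otimes> inv h \<in> N"
proof
  assume "N #> g = N #> h"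
  then have "N #> (g \<otimes> inv h) = N" using coset_mult_inv2 assms subgroup.subset by metis
  then show "g \<otimes> inv h \<in> N" using coset_join1 assms by simp
next
  assume "g \<otimes> inv h \<in> N"
  then have "N #> (g \<otimes> inv h) = N" using coset_join2 assms by simp
  then show "N #> g = N #> h" using coset_mult_inv1 assms subgroup.subset by metis
qed

lemma core_coset_sub:
  assumes "C k n' \<subseteq> C m n" "g \<in> carrier G" "h \<in> carrier G" "C k n' #> g = C k n' #> h"
  shows "C m n #> g = C m n #> h"
  using assms coset_eq_iff[OF core_subgroup] by blast

lemma core_rcos_sum:
  assumes "m \<le> n" "g \<in> S n" "h \<in> S n"
  shows "(C m n #> g) <#> (C m n #> h) = C m n #> (g \<otimes> h)"
  using normal.rcos_sum[OF core_normal[OF assms(1)], of g h] assms by (simp add: r_coset_def set_mult_def)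

lemma path_quot_carrier: "carrier (path_quot G \<phi> x m n) = {C m n #> h | h. h \<in> S n}"
  by (auto simp: path_quot_def carrier_FactGroup r_coset_def)

lemma path_quot_mult: "A \<otimes>\<^bsub>path_quot G \<phi> x m n\<^esub> B = A <#> B"
  by (simp add: path_quot_def set_mult_def)

lemma path_quot_one: "\<one>\<^bsub>path_quot G \<phi> x m n\<^esub> = C m n"
  by (simp add: path_quot_def)

lemma path_quot_group: "m \<le> n \<Longrightarrow> group (path_quot G \<phi> x m n)"
  unfolding path_quot_def by (rule normal.factorgroup_is_group[OF core_normal])

text \<open>Compatible sequences of cosets, given by representatives: compatibility becomes a
  condition on consecutive terms of \<open>h\<close>. The same \<open>h\<close> represents the image
  under \<open>disc_map\<close>, so these maps need no further computation with cosets.\<close>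

definition represents :: "nat \<Rightarrow> (nat \<Rightarrow> 'a) \<Rightarrow> (nat \<Rightarrow> 'a set) \<Rightarrow> bool" where
  "represents m h s \<longleftrightarrow> s \<in> extensional {m..} \<and>
     (\<forall>n\<ge>m. h n \<in> S n \<and> s n = C m n #> h n \<and> h (Suc n) \<otimes> inv (h n) \<in> C m n)"

lemma representsD:
  assumes "represents m h s" "n \<ge> m"
  shows "h n \<in> S n" "h n \<in> carrier G" "s n = C m n #> h n" "h (Suc n) \<otimes> inv (h n) \<in> C m n"
  using assms S_carrier[of "h n" n] by (auto simp: represents_def)

lemma disc_group_carrier: "carrier (disc_group G \<phi> x m) = {s. \<exists>h. represents m h s}"
proof (intro equalityI subsetI CollectI)
  fix s assume s: "s \<in> carrier (disc_group G \<phi> x m)"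
  have e: "s \<in> extensional {m..}" and q: "\<And>n. n \<ge> m \<Longrightarrow> s n \<in> carrier (path_quot G \<phi> x m n)"
    and c: "\<And>n. n \<ge> m \<Longrightarrow> C m n <#> s (Suc n) = s n"
    using s by (auto simp: disc_group_def PiE_def)
  have "\<forall>n. \<exists>g. n \<ge> m \<longrightarrow> g \<in> S n \<and> s n = C m n #> g" using q by (auto simp: path_quot_carrier)
  then obtain h where h: "\<And>n. n \<ge> m \<Longrightarrow> h n \<in> S n \<and> s n = C m n #> h n" by metis
  have "h (Suc n) \<otimes> inv (h n) \<in> C m n" if "n \<ge> m" for n
  proof -
    have hG: "h n \<in> carrier G" "h (Suc n) \<in> carrier G" using h[of n] h[of "Suc n"] that S_carrier by auto
    have "C m n #> h n = C m n <#> (C m (Suc n) #> h (Suc n))" using c[OF that] h[of n] h[of "Suc n"] that by simp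
    also have "\<dots> = C m n #> h (Suc n)" by (rule core_mult_coset[OF core_Suc core_subgroup core_subgroup hG(2)])
    finally have "C m n #> h (Suc n) = C m n #> h n" by simp
    then show ?thesis using coset_eq_iff[OF core_subgroup hG(2,1)] by simp
  qed
  then have "represents m h s" using e h by (simp add: represents_def)
  then show "\<exists>h. represents m h s" by blast
next
  fix s assume "s \<in> {s. \<exists>h. represents m h s}"
  then obtain h where h: "represents m h s" by auto
  have "C m n <#> s (Suc n) = s n" if "n \<ge> m" for n
  proof -
    have hG: "h n \<in> carrier G" "h (Suc n) \<in> carrier G" using representsD(2)[OF h] that by auto
    have "C m n <#> (C m (Suc n) #> h (Suc n)) = C m n #> h (Suc n)"
      by (rule core_mult_coset[OF core_Suc core_subgroup core_subgroup hG(2)])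
    also have "\<dots> = C m n #> h n" using coset_eq_iff[OF core_subgroup hG(2,1)] h that by (simp add: represents_def)
    finally show ?thesis using h that by (simp add: represents_def)
  qed
  moreover have "s n \<in> carrier (path_quot G \<phi> x m n)" if "n \<ge> m" for n
    using h that by (auto simp: represents_def path_quot_carrier)
  ultimately show "s \<in> carrier (disc_group G \<phi> x m)"
    using h by (auto simp: disc_group_def PiE_def represents_def)
qed

lemma disc_group_mult: "s \<otimes>\<^bsub>disc_group G \<phi> x m\<^esub> s' = (\<lambda>n\<in>{m..}. s n <#> s' n)"
  by (simp add: disc_group_def path_quot_mult)

lemma represents_mult:
  assumes "represents m h s" "represents m h' s'"
  shows "represents m (\<lambda>n. h n \<otimes> h' n) (s \<otimes>\<^bsub>disc_group G \<phi> x m\<^esub> s')"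
proof -
  have "h (Suc n) \<otimes> h' (Suc n) \<otimes> inv (h n \<otimes> h' n) \<in> C m n" if n: "n \<ge> m" for n
  proof -
    have S: "h n \<in> S n" "h' n \<in> S n" "h (Suc n) \<in> S n" "h' (Suc n) \<in> S n"
      using assms n S_anti[of n "Suc n"] by (auto simp: represents_def)
    note G = S[THEN S_carrier]
    have e: "C m n #> h (Suc n) = C m n #> h n" "C m n #> h' (Suc n) = C m n #> h' n"
      using assms n coset_eq_iff[OF core_subgroup G(3,1)] coset_eq_iff[OF core_subgroup G(4,2)]
      by (auto simp: represents_def)
    have "C m n #> (h (Suc n) \<otimes> h' (Suc n)) = C m n #> (h n \<otimes> h' n)"
      using core_rcos_sum[OF n S(3,4)] core_rcos_sum[OF n S(1,2)] e by simp
    then show ?thesis using coset_eq_iff[OF core_subgroup] G by simp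
  qed
  moreover have "s n <#> s' n = C m n #> (h n \<otimes> h' n)" if n: "n \<ge> m" for n
    using core_rcos_sum[OF n] assms n by (simp add: represents_def)
  ultimately show ?thesis
    using assms subgroup.m_closed[OF S_subgroup] by (auto simp: represents_def disc_group_mult)
qed

lemma disc_group_group: "group (disc_group G \<phi> x m)"
proof -
  let ?Q = "path_quot G \<phi> x m" and ?D = "disc_group G \<phi> x m"
  interpret P: group "product_group {m..} ?Q"
    by (rule product_group) (simp add: path_quot_group)
  have "subgroup (carrier ?D) (product_group {m..} ?Q)"
  proof (rule P.subgroupI)
    show "carrier ?D \<subseteq> carrier (product_group {m..} ?Q)" by (auto simp: disc_group_def)
    have "represents m (\<lambda>_. \<one>) (\<lambda>n\<in>{m..}. C m n #> \<one>)"
      using subgroup.one_closed[OF S_subgroup] subgroup.one_closed[OF core_subgroup] by (auto simp: represents_def)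
    then show "carrier ?D \<noteq> {}" unfolding disc_group_carrier by blast
    have DP: "s \<otimes>\<^bsub>product_group {m..} ?Q\<^esub> s' = s \<otimes>\<^bsub>?D\<^esub> s'" for s s' by (simp add: disc_group_def)
    show "s \<otimes>\<^bsub>product_group {m..} ?Q\<^esub> s' \<in> carrier ?D" if "s \<in> carrier ?D" "s' \<in> carrier ?D" for s s'
      using that represents_mult[of m _ s _ s'] unfolding DP disc_group_carrier by blast
    fix s assume s: "s \<in> carrier ?D"
    then obtain h where h: "represents m h s" by (auto simp: disc_group_carrier)
    define s' where "s' = (\<lambda>n\<in>{m..}. C m n #> inv (h n))"
    have "inv (h (Suc n)) \<otimes> inv (inv (h n)) \<in> C m n" if n: "n \<ge> m" for n
    proof -
      have S: "h n \<in> S n" "h (Suc n) \<in> S n" using h n S_anti[of n "Suc n"] by (auto simp: represents_def)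
      have c: "inv (h (Suc n) \<otimes> inv (h n)) \<in> C m n"
        using h n subgroup.m_inv_closed[OF core_subgroup] by (auto simp: represents_def)
      then have c': "h n \<otimes> inv (h (Suc n)) \<in> C m n" using S[THEN S_carrier] by (simp add: inv_mult_group)
      interpret Sn: group "G\<lparr>carrier := S n\<rparr>" by (rule subgroup_imp_group[OF S_subgroup])
      have iS: "inv (h n) \<in> S n" using subgroup.m_inv_closed[OF S_subgroup S(1)] .
      have "inv (h n) \<otimes> (h n \<otimes> inv (h (Suc n))) \<otimes> inv (inv (h n)) \<in> C m n"
        using normal.inv_op_closed2[OF core_normal[OF n], of "inv (h n)" "h n \<otimes> inv (h (Suc n))"] c' iS
          m_inv_consistent[OF S_subgroup iS] by simp
      then show ?thesis using S[THEN S_carrier] by (simp flip: m_assoc)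
    qed
    then have s': "represents m (\<lambda>n. inv (h n)) s'"
      using h subgroup.m_inv_closed[OF S_subgroup] by (auto simp: represents_def s'_def)
    then have s'D: "s' \<in> carrier ?D" by (auto simp: disc_group_carrier)
    have "s' \<otimes>\<^bsub>product_group {m..} ?Q\<^esub> s = \<one>\<^bsub>product_group {m..} ?Q\<^esub>"
    proof -
      have "s' n <#> s n = C m n" if n: "n \<ge> m" for n
      proof -
        have "s' n <#> s n = C m n #> (inv (h n) \<otimes> h n)"
          using h s' n core_rcos_sum[OF n] by (simp add: represents_def)
        also have "\<dots> = C m n" using h n S_carrier subgroup.subset[OF core_subgroup]
          by (auto simp: represents_def coset_mult_one)
        finally show ?thesis .
      qed
      then show ?thesis by (auto simp: path_quot_mult path_quot_one intro!: restrict_ext)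
    qed
    moreover have "s' \<in> carrier (product_group {m..} ?Q)" "s \<in> carrier (product_group {m..} ?Q)"
      using s'D s by (auto simp: disc_group_def)
    ultimately have "inv\<^bsub>product_group {m..} ?Q\<^esub> s = s'" by (intro P.inv_equality)
    then show "inv\<^bsub>product_group {m..} ?Q\<^esub> s \<in> carrier ?D" using s'D by simp
  qed
  then have "group ((product_group {m..} ?Q)\<lparr>carrier := carrier ?D\<rparr>)" by (rule P.subgroup_imp_group)
  then show ?thesis by (simp add: disc_group_def)
qed

lemma represents_disc_map:
  assumes h: "represents m h s" and mk: "m \<le> k"
  shows "represents k h (disc_map G \<phi> x k s)"
proof -
  have "C k n <#> s n = C k n #> h n" if n: "n \<ge> k" for n
    using core_mult_coset[OF core_mono[OF mk] core_subgroup core_subgroup, of "h n" n]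
      representsD[OF h, of n] mk n by simp
  moreover have "h (Suc n) \<otimes> inv (h n) \<in> C k n" if "n \<ge> k" for n
    using representsD(4)[OF h, of n] subsetD[OF core_mono[OF mk]] mk that by simp
  ultimately show ?thesis
    using h mk by (auto simp: represents_def disc_map_def)
qed

lemma represents_shift:
  assumes h: "represents m h s" and n: "n \<ge> m"
  shows "C m n #> h (n + d) = C m n #> h n"
proof (induction d)
  case (Suc d)
  have hG: "h (n + d) \<in> carrier G" "h (Suc (n + d)) \<in> carrier G"
    using representsD(2)[OF h] n by auto
  have "C m (n + e) \<subseteq> C m n" for e
    by (induction e) (use core_Suc in auto)
  moreover have "h (Suc (n + d)) \<otimes> inv (h (n + d)) \<in> C m (n + d)" using representsD(4)[OF h] n by simp
  ultimately have "h (Suc (n + d)) \<otimes> inv (h (n + d)) \<in> C m n" by blast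
  then have "C m n #> h (Suc (n + d)) = C m n #> h (n + d)" using coset_eq_iff[OF core_subgroup hG(2,1)] by blast
  then show ?case using Suc by simp
qed simp

lemma represents_eqI:
  assumes "represents m h s" "represents m h' s'" "\<And>n. n \<ge> m \<Longrightarrow> C m n #> h n = C m n #> h' n"
  shows "s = s'"
  using assms by (intro extensionalityI[of s "{m..}" s']) (auto simp: represents_def)

text \<open>
  The hypothesis says that an automorphism trivial below \<open>x k\<close> is trivial below \<open>x m\<close>, in a
  quantitative form that also allows lifting elements of the discriminant group.
\<close>

lemma disc_map_iso:
  assumes mk: "m \<le> k" and rigid: "\<And>n. n \<ge> m \<Longrightarrow> C k (n + (k - m)) \<subseteq> C m n"
  shows "disc_map G \<phi> x k \<in> iso (disc_group G \<phi> x m) (disc_group G \<phi> x k)"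
proof (rule isoI)
  let ?f = "disc_map G \<phi> x k" and ?D = "disc_group G \<phi> x m" and ?E = "disc_group G \<phi> x k"
  have into: "?f s \<in> carrier ?E" if "s \<in> carrier ?D" for s
    using that represents_disc_map[OF _ mk, of _ s] unfolding disc_group_carrier by blast
  show "?f \<in> hom ?D ?E"
  proof (rule homI)
    fix s s' assume "s \<in> carrier ?D" "s' \<in> carrier ?D"
    then obtain h h' where h: "represents m h s" "represents m h' s'" by (auto simp: disc_group_carrier)
    show "?f (s \<otimes>\<^bsub>?D\<^esub> s') = ?f s \<otimes>\<^bsub>?E\<^esub> ?f s'"
      by (rule represents_eqI[OF represents_disc_map[OF represents_mult[OF h] mk]
          represents_mult[OF represents_disc_map[OF h(1) mk] represents_disc_map[OF h(2) mk]]]) simp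
  qed (rule into)
  have "inj_on ?f (carrier ?D)"
  proof (rule inj_onI)
    fix s s' assume "s \<in> carrier ?D" "s' \<in> carrier ?D" and e: "?f s = ?f s'"
    then obtain h h' where h: "represents m h s" "represents m h' s'" by (auto simp: disc_group_carrier)
    note r = represents_disc_map[OF h(1) mk] represents_disc_map[OF h(2) mk]
    show "s = s'"
    proof (rule represents_eqI[OF h])
      fix n assume n: "n \<ge> m"
      let ?n = "n + (k - m)"
      have "?n \<ge> k" using n mk by simp
      then have "C k ?n #> h ?n = C k ?n #> h' ?n" "h ?n \<in> carrier G" "h' ?n \<in> carrier G"
        using r e S_carrier by (auto simp: represents_def)
      then have "C m n #> h ?n = C m n #> h' ?n" using core_coset_sub[OF rigid[OF n]] by blast
      then show "C m n #> h n = C m n #> h' n" using represents_shift[OF h(1) n] represents_shift[OF h(2) n] by simp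
    qed
  qed
  moreover have "?f ` carrier ?D = carrier ?E"
  proof (intro equalityI subsetI)
    fix t assume "t \<in> carrier ?E"
    then obtain h where h: "represents k h t" by (auto simp: disc_group_carrier)
    \<comment> \<open>The lift reads the given sequence \<open>k - m\<close> levels ahead;
      \<open>rigid\<close> turns compatibility modulo the larger core there into compatibility
      modulo \<open>C m n\<close>.\<close>
    define h' where "h' n = h (n + (k - m))" for n
    define s where "s = (\<lambda>n\<in>{m..}. C m n #> h' n)"
    have "h' n \<in> S n \<and> h' (Suc n) \<otimes> inv (h' n) \<in> C m n" if "n \<ge> m" for n
    proof -
      have "n + (k - m) \<ge> k" using that mk by simp
      then show ?thesis
        using h rigid[OF that] S_anti[of n "n + (k - m)"] by (auto simp: represents_def h'_def)
    qed
    then have s: "represents m h' s" by (auto simp: represents_def s_def)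
    have "?f s = t"
      by (rule represents_eqI[OF represents_disc_map[OF s mk] h]) (simp add: h'_def represents_shift[OF h])
    moreover have "s \<in> carrier ?D" using s by (auto simp: disc_group_carrier)
    ultimately show "t \<in> ?f ` carrier ?D" by blast
  qed (use into in auto)
  ultimately show "bij_betw ?f (carrier ?D) (carrier ?E)" by (simp add: bij_betw_def)
qed

lemma has_disc_group_rigid:
  assumes "\<And>m k n. m < k \<Longrightarrow> n \<ge> m \<Longrightarrow> C k (n + (k - m)) \<subseteq> C m n"
  shows "has_disc_group G \<phi> x (disc_group G \<phi> x 0)"
proof -
  have iso: "disc_map G \<phi> x k \<in> iso (disc_group G \<phi> x m) (disc_group G \<phi> x k)" if "m < k" for m k
    using that assms by (intro disc_map_iso) auto
  moreover have "disc_group G \<phi> x 0 \<cong> disc_group G \<phi> x k" for k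
  proof (cases "k = 0")
    case True
    then show ?thesis using iso_refl by simp
  next
    case False
    then show ?thesis using iso[of 0 k] by (auto simp: is_iso_def)
  qed
  ultimately show ?thesis
    unfolding has_disc_group_def using disc_group_group by blast
qed

end

section \<open>Affine actions\<close>

text \<open>
  Coordinates based at a path \<open>x\<close>: level \<open>n\<close> is identified with the integers modulo \<open>2 ^ n\<close>, the
  path being zero, such that the group acts by affine maps.
\<close>

definition affine_coords ::
    "(nat \<Rightarrow> 'v set) \<Rightarrow> ('v \<Rightarrow> 'v) \<Rightarrow> ('g, 'b) monoid_scheme \<Rightarrow> ('g \<Rightarrow> 'v \<Rightarrow> 'v) \<Rightarrow>
      (nat \<Rightarrow> 'v) \<Rightarrow> (nat \<Rightarrow> int \<Rightarrow> 'v) \<Rightarrow> bool" where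
  "affine_coords V p G \<phi> x Y \<longleftrightarrow>
     (\<forall>n. Y n 0 = x n \<and> range (Y n) = V n) \<and>
     (\<forall>n i j. Y n i = Y n j \<longleftrightarrow> 2 ^ n dvd i - j) \<and>
     (\<forall>n i. p (Y (Suc n) i) = Y n i) \<and>
     (\<forall>g\<in>carrier G. \<forall>n. \<exists>\<alpha> \<beta>. \<forall>i. \<phi> g (Y n i) = Y n (\<alpha> * i + \<beta>))"

context tree_act
begin

context
  fixes x :: "nat \<Rightarrow> 'v" and Y :: "nat \<Rightarrow> int \<Rightarrow> 'v"
  assumes Y: "affine_coords V p G \<phi> x Y"
begin

lemma Y_0: "Y n 0 = x n"
  and Y_range: "range (Y n) = V n"
  and Y_eq: "Y n i = Y n j \<longleftrightarrow> 2 ^ n dvd i - j"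
  and Y_p: "p (Y (Suc n) i) = Y n i"
  and Y_affine: "g \<in> carrier G \<Longrightarrow> \<exists>\<alpha> \<beta>. \<forall>i. \<phi> g (Y n i) = Y n (\<alpha> * i + \<beta>)"
  using Y unfolding affine_coords_def by blast+

lemma Y_in: "Y n i \<in> V n"
  using Y_range by auto

lemma Y_path: "(\<lambda>n. Y n i) \<in> path_space V p"
  by (simp add: path_space_def Y_in Y_p)

lemma Y_act_down:
  assumes "g \<in> carrier G" "\<phi> g (Y N i) = Y N j" "n \<le> N"
  shows "\<phi> g (Y n i) = Y n j"
  using assms(3)
proof (induction n rule: inc_induct)
  case (step n)
  have "\<phi> g (Y n i) = p (\<phi> g (Y (Suc n) i))" using act_p[OF assms(1) Y_in, of n i] by (simp add: Y_p)
  then show ?case using step by (simp add: Y_p)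
qed (rule assms(2))

text \<open>On level \<open>N\<close> let \<open>c\<close> act by
  \<open>i \<mapsto> \<alpha> * i + \<beta>\<close>. Fixing 0 means that \<open>2 ^ N\<close>
  divides \<open>\<beta>\<close>; fixing \<open>2 ^ k * s\<close> with \<open>s\<close> odd then
  means that \<open>2 ^ (N - k)\<close> divides \<open>\<alpha> - 1\<close>. So multiples of
  \<open>2 ^ m\<close> are fixed modulo \<open>2 ^ n\<close> as long as
  \<open>n \<le> N - k + m\<close>.\<close>

lemma Y_rigid:
  assumes c: "c \<in> carrier G" "\<phi> c (Y N 0) = Y N 0" "\<phi> c (Y N (2 ^ k * s)) = Y N (2 ^ k * s)"
    and s: "odd s" and kN: "k \<le> N" and n: "n \<le> N" "n + k \<le> N + m"
  shows "\<phi> c (Y n (2 ^ m * j)) = Y n (2 ^ m * j)"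
proof -
  obtain \<alpha> \<beta> where ab: "\<And>i. \<phi> c (Y N i) = Y N (\<alpha> * i + \<beta>)" using Y_affine[OF c(1), of N] by blast
  have \<beta>: "2 ^ N dvd \<beta>" using c(2) ab[of 0] Y_eq[of N \<beta> 0] by simp
  have "2 ^ N dvd \<alpha> * (2 ^ k * s) + \<beta> - 2 ^ k * s" using c(3) ab Y_eq by metis
  then have "2 ^ N dvd (\<alpha> * (2 ^ k * s) + \<beta> - 2 ^ k * s) - \<beta>" using \<beta> by (rule dvd_diff)
  also have "(\<alpha> * (2 ^ k * s) + \<beta> - 2 ^ k * s) - \<beta> = ((\<alpha> - 1) * 2 ^ k) * s" by (simp add: algebra_simps)
  finally have "2 ^ N dvd (\<alpha> - 1) * 2 ^ k"
    using s coprime_dvd_mult_left_iff[of "2 ^ N" s] by simp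
  then have "2 ^ (N - k) * 2 ^ k dvd (\<alpha> - 1) * 2 ^ k" using kN by (simp flip: power_add)
  then have "2 ^ (N - k) dvd \<alpha> - 1" by simp
  then have "2 ^ (N - k) * 2 ^ m dvd (\<alpha> - 1) * 2 ^ m" by (intro mult_dvd_mono) auto
  then have "2 ^ (N - k + m) dvd (\<alpha> - 1) * 2 ^ m" by (simp add: power_add)
  moreover have "(2::int) ^ n dvd 2 ^ (N - k + m)" using n kN by (intro le_imp_power_dvd) simp
  ultimately have "2 ^ n dvd (\<alpha> - 1) * 2 ^ m" by (metis dvd_trans)
  then have "2 ^ n dvd (\<alpha> - 1) * 2 ^ m * j" by simp
  moreover have "2 ^ n dvd \<beta>" using \<beta> n(1) le_imp_power_dvd dvd_trans by blast
  ultimately have "2 ^ n dvd (\<alpha> - 1) * 2 ^ m * j + \<beta>" by (rule dvd_add)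
  also have "(\<alpha> - 1) * 2 ^ m * j + \<beta> = \<alpha> * (2 ^ m * j) + \<beta> - 2 ^ m * j" by (simp add: algebra_simps)
  finally have "Y n (\<alpha> * (2 ^ m * j) + \<beta>) = Y n (2 ^ m * j)" by (simp add: Y_eq)
  then show ?thesis using Y_act_down[OF c(1) ab n(1)] by simp
qed

lemma Y_stab_dvd:
  assumes "g \<in> carrier G" "\<phi> g (Y m 0) = Y m 0" "m \<le> n"
  shows "\<exists>j. \<phi> g (Y n 0) = Y n (2 ^ m * j)"
proof -
  obtain b where b: "\<phi> g (Y n 0) = Y n b" using act_in[OF assms(1) Y_in, of n 0] Y_range by (metis imageE)
  have "Y m b = Y m 0" using Y_act_down[OF assms(1) b assms(3)] assms(2) by simp
  then have "2 ^ m dvd b" using Y_eq[of m b 0] by simp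
  then show ?thesis using b by (auto elim: dvdE)
qed

text \<open>Agreement with the path up to level \<open>k\<close> and not beyond means that the
  coordinate is divisible by exactly \<open>2 ^ k\<close>.\<close>

lemma Y_move_odd:
  assumes "g \<in> carrier G" "\<phi> g (Y k 0) = Y k 0" "\<phi> g (Y (Suc k) 0) \<noteq> Y (Suc k) 0" "k < n"
  shows "\<exists>s. odd s \<and> \<phi> g (Y n 0) = Y n (2 ^ k * s)"
proof -
  obtain s where s: "\<phi> g (Y n 0) = Y n (2 ^ k * s)" using Y_stab_dvd[OF assms(1,2), of n] assms(4) by auto
  have "Y (Suc k) (2 ^ k * s) \<noteq> Y (Suc k) 0"
    using Y_act_down[OF assms(1) s, of "Suc k"] assms(3,4) by simp
  then have "\<not> 2 ^ Suc k dvd 2 ^ k * s" by (simp only: Y_eq diff_zero not_False_eq_True)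
  then have "\<not> 2 ^ k * 2 dvd 2 ^ k * s" by (simp only: power_Suc2 not_False_eq_True)
  then have "odd s" by simp
  then show ?thesis using s by blast
qed

text \<open>On the multiples of \<open>2 ^ N\<close> an affine map of level \<open>n + N\<close>
  shows its slope only modulo \<open>2 ^ n\<close>. This is why the comparison takes place
  \<open>N\<close> levels above \<open>w\<close>.\<close>

lemma affine_agree:
  assumes g: "g1 \<in> carrier G" "g2 \<in> carrier G"
    and e: "\<And>n j. \<phi> g1 (Y n (2 ^ N * j)) = \<phi> g2 (Y n (2 ^ N * j))" and w: "w \<in> V n"
  shows "\<phi> g1 w = \<phi> g2 w"
proof -
  let ?M = "n + N"
  obtain a1 b1 where 1: "\<And>i. \<phi> g1 (Y ?M i) = Y ?M (a1 * i + b1)" using Y_affine[OF g(1)] by metis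
  obtain a2 b2 where 2: "\<And>i. \<phi> g2 (Y ?M i) = Y ?M (a2 * i + b2)" using Y_affine[OF g(2)] by metis
  have b: "2 ^ ?M dvd b1 - b2" using e[of ?M 0] 1[of 0] 2[of 0] Y_eq[of ?M b1 b2] by simp
  have "2 ^ ?M dvd (a1 * (2 ^ N * 1) + b1) - (a2 * (2 ^ N * 1) + b2)" using e[of ?M 1] 1 2 Y_eq by metis
  then have "2 ^ ?M dvd ((a1 * (2 ^ N * 1) + b1) - (a2 * (2 ^ N * 1) + b2)) - (b1 - b2)" using b by (rule dvd_diff)
  also have "((a1 * (2 ^ N * 1) + b1) - (a2 * (2 ^ N * 1) + b2)) - (b1 - b2) = (a1 - a2) * 2 ^ N"
    by (simp add: algebra_simps)
  finally have "2 ^ n * 2 ^ N dvd (a1 - a2) * 2 ^ N" by (simp add: power_add)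
  then have a: "2 ^ n dvd a1 - a2" by simp
  obtain i where i: "w = Y n i" using w Y_range by (metis imageE)
  have "2 ^ n dvd (a1 - a2) * i" using a by simp
  moreover have "2 ^ n dvd b1 - b2" using b by (simp add: power_add dvd_mult_left)
  ultimately have "2 ^ n dvd (a1 - a2) * i + (b1 - b2)" by (rule dvd_add)
  also have "(a1 - a2) * i + (b1 - b2) = (a1 * i + b1) - (a2 * i + b2)" by (simp add: algebra_simps)
  finally have "Y n (a1 * i + b1) = Y n (a2 * i + b2)" by (simp add: Y_eq)
  then show ?thesis using Y_act_down[OF g(1) 1, of n] Y_act_down[OF g(2) 2, of n] i by simp
qed

end
end

locale affine_tree = tree_act +
  assumes coords: "x \<in> path_space V p \<Longrightarrow> \<exists>Y. affine_coords V p G \<phi> x Y"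
begin

lemma affine_LQA: "tree_LQA V p G \<phi>"
  unfolding tree_LQA_def LQA_def
\<comment> \<open>Any \<epsilon> would do: agreement on a nonempty open set will force agreement on
  all paths.\<close>
proof (intro exI[of _ 1] conjI allI ballI impI)
  interpret M: Metric_space "path_space V p" path_dist by (rule path_metric[of V x\<^sub>0 p, OF V0])
  fix U W g1 g2 w
  assume g: "g1 \<in> carrier G" "g2 \<in> carrier G"
    and U: "openin M.mtopology U" and W: "openin M.mtopology W" "W \<noteq> {}"
    and e: "\<forall>w\<in>W. path_act \<phi> g1 w = path_act \<phi> g2 w" and w: "w \<in> U"
  obtain x where x: "x \<in> W" using W(2) by auto
  obtain r where r: "r > 0" "M.mball x r \<subseteq> W" using W(1) x unfolding M.openin_mtopology by blast
  obtain N where N: "(1/2)^N < r" using real_arch_pow_inv[OF r(1), of "1/2"] by auto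
  have xP: "x \<in> path_space V p" using W(1) x openin_subset by fastforce
  obtain Y where Y: "affine_coords V p G \<phi> x Y" using coords[OF xP] by blast
  \<comment> \<open>Paths of constant coordinate \<open>2 ^ N * j\<close> coincide with
    \<open>x\<close> up to level \<open>N\<close>, so they lie in the ball on which the two actions
    agree.\<close>
  have "\<phi> g1 (Y n (2 ^ N * j)) = \<phi> g2 (Y n (2 ^ N * j))" for n j
  proof -
    let ?y = "\<lambda>n. Y n (2 ^ N * j)"
    have yP: "?y \<in> path_space V p" by (rule Y_path[OF Y])
    have "x i = ?y i" if "i \<le> N" for i
    proof -
      have "(2::int) ^ i dvd 2 ^ N" by (rule le_imp_power_dvd[OF that])
      then have "(2::int) ^ i dvd 0 - 2 ^ N * j" by (simp add: dvd_mult2)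
      then have "Y i 0 = ?y i" using Y_eq[OF Y] by blast
      then show ?thesis using Y_0[OF Y] by simp
    qed
    then have "path_dist x ?y \<le> (1/2)^N" by (subst path_dist_le_iff) auto
    then have "?y \<in> M.mball x r" using N xP yP by simp
    then have "path_act \<phi> g1 ?y = path_act \<phi> g2 ?y" using r(2) e by blast
    then show ?thesis unfolding path_act_def by metis
  qed
  moreover have "w \<in> path_space V p" using w openin_subset[OF U] unfolding M.topspace_mtopology by blast
  then have "w n \<in> V n" for n by (auto simp: path_space_def)
  ultimately have "\<phi> g1 (w n) = \<phi> g2 (w n)" for n using affine_agree[OF Y g, of N "w n" n] by blast
  then show "path_act \<phi> g1 w = path_act \<phi> g2 w" by (simp add: path_act_def)
qed simp

lemma affine_infinite_disc_group:
  assumes trans: "\<And>x k. x \<in> path_space V p \<Longrightarrow> \<exists>g\<in>carrier G. \<phi> g (x k) = x k \<and> \<phi> g (x (Suc k)) \<noteq> x (Suc k)"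
    and inf: "\<And>x. x \<in> path_space V p \<Longrightarrow> infinite {g \<in> carrier G. \<forall>n. \<phi> g (x n) = x n}"
    and faithful: "\<And>g h. \<lbrakk>g \<in> carrier G; h \<in> carrier G; \<forall>n. \<forall>w\<in>V n. \<phi> g w = \<phi> h w\<rbrakk> \<Longrightarrow> g = h"
  shows "tree_infinite_disc_group V p G \<phi>"
  unfolding tree_infinite_disc_group_def
proof (intro allI impI)
  fix H x assume Hx: "tree_dense_subgroup V G \<phi> H \<and> countable H \<and> x \<in> path_space V p"
  then have H: "subgroup H G" and x: "x \<in> path_space V p"
    and dense: "\<And>g n. g \<in> carrier G \<Longrightarrow> \<exists>h\<in>H. \<forall>j\<le>n. \<forall>w\<in>V j. \<phi> h w = \<phi> g w"
    by (auto simp: tree_dense_subgroup_def)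
  let ?A = "G\<lparr>carrier := H\<rparr>"
  note HG = subgroup.mem_carrier[OF H]
  interpret A: group ?A by (rule subgroup_imp_group[OF H])
  interpret A: tree_act_path ?A V p \<phi> x\<^sub>0 x
    by unfold_locales (use V0 act_in act_p act_one act_mult x HG in auto)
  obtain Y where Y: "affine_coords V p G \<phi> x Y" using coords[OF x] by blast
  have YA: "affine_coords V p ?A \<phi> x Y" using Y HG by (simp add: affine_coords_def)
  \<comment> \<open>The property of \<open>g\<close> involves only levels \<open>k\<close> and
    \<open>Suc k\<close>, so it passes to an approximation in \<open>H\<close>.\<close>
  have move: "\<exists>h\<in>A.S k. \<exists>s. odd s \<and> \<phi> h (x n) = Y n (2 ^ k * s)" if "k < n" for k n
  proof -
    obtain g where g: "g \<in> carrier G" "\<phi> g (x k) = x k" "\<phi> g (x (Suc k)) \<noteq> x (Suc k)" using trans[OF x] by blast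
    obtain h where h: "h \<in> H" "\<forall>j\<le>Suc k. \<forall>w\<in>V j. \<phi> h w = \<phi> g w" using dense[OF g(1)] by blast
    have "\<phi> h (x k) = \<phi> g (x k)" "\<phi> h (x (Suc k)) = \<phi> g (x (Suc k))"
      using h(2)[rule_format, of k "x k"] h(2)[rule_format, of "Suc k" "x (Suc k)"] A.x_in by auto
    then have "\<phi> h (x k) = x k" "\<phi> h (x (Suc k)) \<noteq> x (Suc k)" using g by auto
    then show ?thesis
      using A.Y_move_odd[OF YA, of h k n] h(1) that by (auto simp: Y_0[OF Y] A.S_iff)
  qed
  have rigid: "A.C k (n + (k - m)) \<subseteq> A.C m n" if mk: "m < k" and n: "n \<ge> m" for m k n
  proof
    let ?N = "n + (k - m)"
    fix c assume c: "c \<in> A.C k ?N"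
    have cH: "c \<in> H" using A.core_carrier[OF c] by simp
    have cS: "c \<in> A.S ?N" using A.core_sub_S c by blast
    have "\<phi> c (\<phi> g (x n)) = \<phi> g (x n)" if g: "g \<in> A.S m" for g
    proof (cases "n = m")
      case True
      \<comment> \<open>Here \<open>?N = k\<close>, so no level above \<open>k\<close> is available
        to move the path; but \<open>g\<close> and \<open>c\<close> both fix
        \<open>x m\<close>.\<close>
      have "c \<in> A.S m" using cS A.S_anti[of m ?N] n by auto
      then show ?thesis using g True by (simp add: A.S_iff)
    next
      case False
      then have "k < ?N" using n mk by simp
      then obtain h s where h: "h \<in> A.S k" "odd s" "\<phi> h (x ?N) = Y ?N (2 ^ k * s)"
        using move by blast
      obtain j where j: "\<phi> g (x n) = Y n (2 ^ m * j)"
        using A.Y_stab_dvd[OF YA, of g m n] g n by (auto simp: Y_0[OF Y] A.S_iff)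
      have "\<phi> c (Y ?N (2 ^ k * s)) = Y ?N (2 ^ k * s)" using c h(1) by (simp add: A.core_iff flip: h(3))
      moreover have "\<phi> c (Y ?N 0) = Y ?N 0" using cS by (simp add: A.S_iff Y_0[OF Y])
      ultimately show ?thesis unfolding j
        using A.Y_rigid[OF YA, of c ?N k s n m j] cH h(2) n mk by simp
    qed
    then show "c \<in> A.C m n" using cH by (simp add: A.core_iff)
  qed
  \<comment> \<open>Some element moves \<open>x n\<close> to an odd coordinate, and an affine map
    fixing 0 and an odd coordinate is the identity modulo \<open>2 ^ n\<close>.\<close>
  have full: "\<phi> c w = w" if c: "c \<in> A.C 0 n" and w: "w \<in> V n" for c n w
  proof (cases "n = 0")
    case True
    then show ?thesis using w act_in[of c w 0] A.core_carrier[OF c] HG by (simp add: V0)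
  next
    case False
    then obtain h s where h: "h \<in> A.S 0" "odd s" "\<phi> h (x n) = Y n (2 ^ 0 * s)" using move[of 0 n] by auto
    have "\<phi> c (Y n (2 ^ 0 * s)) = Y n (2 ^ 0 * s)" using c h(1) by (simp only: A.core_iff h(3)[symmetric])
    moreover have "\<phi> c (Y n 0) = Y n 0" using subsetD[OF A.core_sub_S c] by (simp add: A.S_iff Y_0[OF Y])
    moreover obtain j where "w = Y n (2 ^ 0 * j)" using w Y_range[OF Y, of n] by auto
    ultimately show ?thesis
      using A.Y_rigid[OF YA, of c n 0 s n 0 j] A.core_carrier[OF c] h(2) by simp
  qed
  let ?D = "disc_group ?A \<phi> x 0"
  have "infinite (carrier ?D)"
  proof
    assume fin: "finite (carrier ?D)"
    let ?Z = "{g \<in> carrier G. \<forall>n. \<phi> g (x n) = x n}"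
    have "\<exists>h. \<forall>n. h n \<in> H \<and> (\<forall>j\<le>n. \<forall>w\<in>V j. \<phi> (h n) w = \<phi> g w)" if "g \<in> carrier G" for g
      using dense[OF that] by metis
    \<comment> \<open>\<open>h g n\<close> approximates \<open>g\<close> on the levels up to
      \<open>n\<close>; \<open>g\<close> itself need not belong to \<open>H\<close>.\<close>
    then obtain h where h: "\<And>g n. g \<in> carrier G \<Longrightarrow> h g n \<in> H"
      "\<And>g n j w. g \<in> carrier G \<Longrightarrow> j \<le> n \<Longrightarrow> w \<in> V j \<Longrightarrow> \<phi> (h g n) w = \<phi> g w" by metis
    define s where "s g = (\<lambda>n\<in>{0..}. A.C 0 n #>\<^bsub>?A\<^esub> h g n)" for g
    have rep: "A.represents 0 (h g) (s g)" if g: "g \<in> ?Z" for g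
    proof -
      have gG: "g \<in> carrier G" and gx: "\<And>n. \<phi> g (x n) = x n" using g by auto
      have "\<phi> (h g n) (x n) = x n" for n using h(2)[OF gG le_refl A.x_in, of n] gx by simp
      then have "h g n \<in> A.S n" for n using h(1)[OF gG] by (simp add: A.S_iff)
      moreover have "h g (Suc n) \<otimes>\<^bsub>?A\<^esub> inv\<^bsub>?A\<^esub> (h g n) \<in> A.C 0 n" for n
      proof -
        have hA: "h g n \<in> carrier ?A" "h g (Suc n) \<in> carrier ?A" using h(1)[OF gG] by auto
        have "\<phi> (h g (Suc n) \<otimes>\<^bsub>?A\<^esub> inv\<^bsub>?A\<^esub> (h g n)) w = w" if w: "w \<in> V n" for w
        proof -
          have w': "\<phi> (inv\<^bsub>?A\<^esub> (h g n)) w \<in> V n" by (rule A.act_in[OF A.inv_closed[OF hA(1)] w])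
          have "\<phi> (h g (Suc n) \<otimes>\<^bsub>?A\<^esub> inv\<^bsub>?A\<^esub> (h g n)) w = \<phi> (h g (Suc n)) (\<phi> (inv\<^bsub>?A\<^esub> (h g n)) w)"
            by (rule A.act_mult[OF hA(2) A.inv_closed[OF hA(1)] w])
          also have "\<dots> = \<phi> (h g n) (\<phi> (inv\<^bsub>?A\<^esub> (h g n)) w)" using h(2)[OF gG _ w', of "Suc n"] h(2)[OF gG _ w', of n] by simp
          also have "\<dots> = w" by (rule A.act_inv'[OF hA(1) w])
          finally show ?thesis .
        qed
        then show ?thesis using A.gx_in A.m_closed[OF hA(2) A.inv_closed[OF hA(1)]] unfolding A.core_iff by blast
      qed
      ultimately show ?thesis by (simp add: A.represents_def s_def)
    qed
    have sub: "s ` ?Z \<subseteq> carrier ?D" using rep unfolding A.disc_group_carrier by blast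
    \<comment> \<open>Equal cosets differ by an element of the core, which is trivial on level
      \<open>n\<close> by \<open>full\<close>. So two automorphisms with the same sequence agree on
      every level.\<close>
    have inj: "inj_on s ?Z"
    proof (rule inj_onI)
      fix g g' assume g: "g \<in> ?Z" "g' \<in> ?Z" and e: "s g = s g'"
      have gG: "g \<in> carrier G" "g' \<in> carrier G" using g by auto
      have "\<phi> g w = \<phi> g' w" if w: "w \<in> V n" for n w
      proof -
        have hA: "h g n \<in> carrier ?A" "h g' n \<in> carrier ?A" using h(1) gG by auto
        let ?c = "h g n \<otimes>\<^bsub>?A\<^esub> inv\<^bsub>?A\<^esub> (h g' n)"
        have "s g n = s g' n" using e by simp
        then have "A.C 0 n #>\<^bsub>?A\<^esub> h g n = A.C 0 n #>\<^bsub>?A\<^esub> h g' n" by (simp add: s_def)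
        then have c: "?c \<in> A.C 0 n" using A.coset_eq_iff[OF A.core_subgroup hA] by blast
        have w': "\<phi> (h g' n) w \<in> V n" by (rule A.act_in[OF hA(2) w])
        have "\<phi> (h g n) w = \<phi> (h g n) (\<phi> (inv\<^bsub>?A\<^esub> (h g' n)) (\<phi> (h g' n) w))"
          using A.act_inv[OF hA(2) w] by simp
        also have "\<dots> = \<phi> ?c (\<phi> (h g' n) w)" by (rule A.act_mult[OF hA(1) A.inv_closed[OF hA(2)] w', symmetric])
        also have "\<dots> = \<phi> (h g' n) w" by (rule full[OF c w'])
        finally show ?thesis using h(2)[OF gG(1) _ w, of n] h(2)[OF gG(2) _ w, of n] by simp
      qed
      then show "g = g'" using faithful[OF gG] by blast
    qed
    have "finite ?Z" by (rule finite_imageD[OF finite_subset[OF sub fin] inj])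
    then show False using inf[OF x] by contradiction
  qed
  moreover have "has_disc_group ?A \<phi> x ?D" by (rule A.has_disc_group_rigid) (rule rigid)
  ultimately show "\<exists>D :: (nat \<Rightarrow> 'a set) monoid. has_disc_group ?A \<phi> x D \<and> infinite (carrier D)"
    by (intro exI[of _ ?D] conjI)
qed

end

section \<open>Roots of unity of two-power order\<close>

definition zeta :: "nat \<Rightarrow> complex" where
  "zeta n = cis (2 * pi / 2 ^ n)"

text \<open>Equal to \<open>2 cos (2 pi / 2 ^ n)\<close>. In the Chebyshev case it is this sum, not
  \<open>zeta n\<close> itself, that the coordinates exhibit as an element of the tower.\<close>

definition tau :: "nat \<Rightarrow> complex" where
  "tau n = zeta n + inverse (zeta n)"

lemma zeta_nonzero [simp]: "zeta n \<noteq> 0"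
  by (simp add: zeta_def)

lemma zeta_0: "zeta 0 = 1"
  by (simp add: zeta_def)

lemma zeta_Suc: "zeta (Suc n) ^ 2 = zeta n"
  by (simp only: zeta_def Complex.DeMoivre) simp

lemma zeta_pow: "zeta (n + k) ^ 2 ^ k = zeta n"
proof (induction k)
  case (Suc k)
  have "zeta (n + Suc k) ^ 2 ^ Suc k = (zeta (Suc (n + k)) ^ 2) ^ 2 ^ k" by (simp flip: power_mult)
  then show ?case using Suc by (simp add: zeta_Suc)
qed simp

lemma zeta_one: "zeta n ^ 2 ^ n = 1"
  using zeta_pow[of 0 n] by (simp add: zeta_0)

lemma zeta_half: "zeta (Suc n) ^ 2 ^ n = - 1"
  using zeta_pow[of 1 n] by (simp add: zeta_def)

lemma root_of_unity_zeta:
  assumes "z ^ 2 ^ n = 1"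
  shows "\<exists>i::nat. z = zeta n ^ i"
proof -
  have "z \<in> (\<lambda>k. cis (2 * pi * real k / real (2 ^ n))) ` {..<2 ^ n}"
    using Complex.bij_betw_roots_unity[of "2 ^ n"] assms by (auto simp: bij_betw_def)
  then obtain k where "z = cis (2 * pi * real k / real (2 ^ n))" by auto
  then have "z = zeta n ^ k" by (simp add: zeta_def Complex.DeMoivre mult.commute)
  then show ?thesis ..
qed

lemma tau_Suc: "(tau (Suc n))\<^sup>2 - 2 = tau n"
  by (simp add: tau_def power2_sum power_inverse zeta_Suc)

lemma tau_0: "tau 0 = 2" and tau_2: "tau 2 = 0"
  by (simp_all add: tau_def zeta_def complex_eq_iff cos_60 flip: cis_inverse)

lemma tau_iterate: "((\<lambda>y. y\<^sup>2 - 2) ^^ k) (tau (n + k)) = tau n"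
proof (induction k)
  case (Suc k)
  then show ?case by (simp only: funpow_Suc_right comp_apply add_Suc_right tau_Suc)
qed simp

section \<open>Eisenstein's criterion at two\<close>

abbreviation ipoly :: "int poly \<Rightarrow> complex poly" where
  "ipoly \<equiv> map_poly of_int"

lemma coeff_ipoly [simp]: "Polynomial.coeff (ipoly p) i = of_int (Polynomial.coeff p i)"
  by (simp add: coeff_map_poly)

lemma ipoly_mult: "ipoly (p * q) = ipoly p * ipoly q"
  by (rule poly_eqI) (simp add: coeff_mult)

lemma ipoly_pover: "subfld K \<Longrightarrow> ipoly p \<in> pover K"
  by (simp add: pover_def subfld_of_int)

lemma degree_ipoly: "Polynomial.degree (ipoly p) = Polynomial.degree p"
  by (rule degree_map_poly) simp

lemma subfld_Rats: "subfld (\<rat> :: complex set)"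
  by (simp add: subfld_def)

lemma extract_two_power:
  fixes C :: "int poly"
  assumes "C \<noteq> 0"
  shows "\<exists>k B. C = Polynomial.smult (2 ^ k) B \<and> (\<exists>i. odd (Polynomial.coeff B i))"
  using assms
proof (induction "nat \<bar>Polynomial.lead_coeff C\<bar>" arbitrary: C rule: less_induct)
  case less
  show ?case
  proof (cases "\<exists>i. odd (Polynomial.coeff C i)")
    case True
    then show ?thesis by (intro exI[of _ 0] exI[of _ C]) auto
  next
    case False
    define B where "B = map_poly (\<lambda>x. x div 2) C"
    have C: "C = Polynomial.smult 2 B"
      using False by (intro poly_eqI) (simp add: B_def coeff_map_poly)
    then have "B \<noteq> 0" using less.prems by auto
    moreover have "nat \<bar>Polynomial.lead_coeff B\<bar> < nat \<bar>Polynomial.lead_coeff C\<bar>"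
      using \<open>B \<noteq> 0\<close> unfolding C by (simp add: abs_mult)
    ultimately obtain k B' where "B = Polynomial.smult (2 ^ k) B'" "\<exists>i. odd (Polynomial.coeff B' i)"
      using less.hyps by blast
    then show ?thesis using C by (intro exI[of _ "Suc k"] exI[of _ B']) auto
  qed
qed

text \<open>The integer polynomial is made primitive at the prime two only; odd factors may remain
  in its content.\<close>

lemma clear_denominators:
  assumes "P \<in> pover \<rat>" "P \<noteq> 0"
  shows "\<exists>r C. r \<noteq> 0 \<and> ipoly C = Polynomial.smult r P \<and> (\<exists>i. odd (Polynomial.coeff C i))"
proof -
  have "\<exists>n::nat. n > 0 \<and> (\<exists>C. ipoly C = Polynomial.smult (of_nat n) P)"
    using assms(1)
  proof (induction P)
    case 0
    then show ?case by (intro exI[of _ 1] conjI exI[of _ 0]) auto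
  next
    case (pCons a P)
    then obtain n C where n: "n > 0" "ipoly C = Polynomial.smult (of_nat n) P"
      by (auto simp: pover_pCons_iff[OF subfld_Rats])
    have "a \<in> \<rat>" using pCons.prems by (simp add: pover_pCons_iff[OF subfld_Rats])
    then obtain u w where uw: "w > 0" "a = of_int u / of_int w" by (rule Rats_cases')
    have "ipoly (pCons (u * int n) (Polynomial.smult w C)) = Polynomial.smult (of_nat (n * nat w)) (pCons a P)"
    proof (rule poly_eqI)
      fix i
      have "of_int (Polynomial.coeff C j) = of_nat n * Polynomial.coeff P j" for j
        using arg_cong[OF n(2), of "\<lambda>p. Polynomial.coeff p j"] by simp
      then show "Polynomial.coeff (ipoly (pCons (u * int n) (Polynomial.smult w C))) i =
          Polynomial.coeff (Polynomial.smult (of_nat (n * nat w)) (pCons a P)) i"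
        using uw by (simp add: coeff_pCons split: nat.splits)
    qed
    then show ?case using n uw by (intro exI[of _ "n * nat w"]) auto
  qed
  then obtain n C where n: "n > 0" "ipoly C = Polynomial.smult (of_nat n) P" by blast
  have "C \<noteq> 0" using n assms(2) by auto
  then obtain k B where B: "C = Polynomial.smult (2 ^ k) B" "\<exists>i. odd (Polynomial.coeff B i)"
    using extract_two_power by blast
  have "of_nat n * Polynomial.coeff P i = 2 ^ k * of_int (Polynomial.coeff B i)" for i
    using arg_cong[OF n(2), of "\<lambda>p. Polynomial.coeff p i"] by (simp add: B(1))
  then have "ipoly B = Polynomial.smult (of_nat n / 2 ^ k) P" by (intro poly_eqI) (simp add: field_simps)
  then show ?thesis using B(2) n(1) by (intro exI[of _ "of_nat n / 2 ^ k"] exI[of _ B]) auto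
qed

lemma odd_coeff_mult:
  fixes C G :: "int poly"
  assumes i: "odd (Polynomial.coeff C i)" "\<And>l. l < i \<Longrightarrow> even (Polynomial.coeff C l)"
    and j: "odd (Polynomial.coeff G j)" "\<And>l. l < j \<Longrightarrow> even (Polynomial.coeff G l)"
  shows "odd (Polynomial.coeff (C * G) (i + j))"
proof -
  let ?t = "\<lambda>l. Polynomial.coeff C l * Polynomial.coeff G (i + j - l)"
  have "even (\<Sum>l\<in>{..i + j} - {i}. ?t l)"
  proof (rule dvd_sum)
    fix l assume "l \<in> {..i + j} - {i}"
    then have "l < i \<or> i + j - l < j" by auto
    then show "even (?t l)" using i(2) j(2) by auto
  qed
  moreover have "Polynomial.coeff (C * G) (i + j) = ?t i + (\<Sum>l\<in>{..i + j} - {i}. ?t l)"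
    unfolding coeff_mult by (rule sum.remove) auto
  ultimately show ?thesis using i(1) j(1) by simp
qed

text \<open>
  Gauss's lemma is avoided: clearing denominators in a factorisation \<open>E = Q * q\<close> gives
  \<open>C * G = N * E\<close> with odd coefficients in both \<open>C\<close> and \<open>G\<close>, and the lowest of them multiply to
  an odd coefficient of \<open>N * E\<close>, which can only be the leading one.
\<close>

lemma eisenstein_two:
  fixes E :: "int poly"
  assumes E: "Polynomial.degree E = D" "Polynomial.coeff E D = 1" "\<And>i. i < D \<Longrightarrow> even (Polynomial.coeff E i)"
    "\<not> 4 dvd Polynomial.coeff E 0" and \<tau>: "poly (ipoly E) \<tau> = 0"
    and P: "P \<in> pover \<rat>" "P \<noteq> 0" "poly P \<tau> = 0"
  shows "D \<le> Polynomial.degree P"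
proof (rule ccontr)
  assume less: "\<not> D \<le> Polynomial.degree P"
  obtain Q where Q: "Q \<in> pover \<rat>" "Polynomial.lead_coeff Q = 1" "poly Q \<tau> = 0"
    and min: "\<And>R. R \<in> pover \<rat> \<Longrightarrow> poly R \<tau> = 0 \<Longrightarrow> Polynomial.degree R < Polynomial.degree Q \<Longrightarrow> R = 0"
    by (rule minimal_poly_exists[OF subfld_Rats P]) blast
  have Q0: "Q \<noteq> 0" using Q(2) by auto
  have dQ: "Polynomial.degree Q < D" using min[OF P(1,3)] P(2) less by force
  obtain q r where qr: "q \<in> pover \<rat>" "r \<in> pover \<rat>" "ipoly E = Q * q + r"
    "r = 0 \<or> Polynomial.degree r < Polynomial.degree Q"
    using pover_division[OF subfld_Rats ipoly_pover[OF subfld_Rats] Q(1) Q0] by blast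
  have "poly r \<tau> = 0" using qr(3) \<tau> Q(3) by simp
  then have "r = 0" using min[OF qr(2)] qr(4) by blast
  then have fac: "ipoly E = Q * q" using qr(3) by simp
  have "E \<noteq> 0" using E(2) by auto
  then have "ipoly E \<noteq> 0" by (metis coeff_0 coeff_ipoly leading_coeff_0_iff of_int_eq_0_iff)
  then have q0: "q \<noteq> 0" using fac by auto
  have dsum: "Polynomial.degree Q + Polynomial.degree q = D"
    using arg_cong[OF fac, of Polynomial.degree] Q0 q0 E(1) by (simp add: degree_ipoly Polynomial.degree_mult_eq)
  obtain a C where C: "a \<noteq> 0" "ipoly C = Polynomial.smult a Q" "\<exists>i. odd (Polynomial.coeff C i)"
    using clear_denominators[OF Q(1) Q0] by blast
  obtain b G where G: "b \<noteq> 0" "ipoly G = Polynomial.smult b q" "\<exists>i. odd (Polynomial.coeff G i)"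
    using clear_denominators[OF qr(1) q0] by blast
  define N where "N = Polynomial.coeff (C * G) D"
  have prod: "ipoly (C * G) = Polynomial.smult (a * b) (ipoly E)" by (simp add: ipoly_mult C(2) G(2) fac mult.commute)
  have "of_int (Polynomial.coeff (C * G) i) = a * b * of_int (Polynomial.coeff E i)" for i
    using arg_cong[OF prod, of "\<lambda>p. Polynomial.coeff p i"] by simp
  moreover from this[of D] have "a * b = of_int N" by (simp add: N_def E(2))
  ultimately have "(of_int (Polynomial.coeff (C * G) i) :: complex) = of_int (N * Polynomial.coeff E i)" for i by simp
  then have cN: "Polynomial.coeff (C * G) i = N * Polynomial.coeff E i" for i by (simp only: of_int_eq_iff)
  define i where "i = (LEAST i. odd (Polynomial.coeff C i))"
  define j where "j = (LEAST j. odd (Polynomial.coeff G j))"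
  have i: "odd (Polynomial.coeff C i)" "\<And>l. l < i \<Longrightarrow> even (Polynomial.coeff C l)"
    unfolding i_def using LeastI_ex[OF C(3)] not_less_Least by blast+
  have j: "odd (Polynomial.coeff G j)" "\<And>l. l < j \<Longrightarrow> even (Polynomial.coeff G l)"
    unfolding j_def using LeastI_ex[OF G(3)] not_less_Least by blast+
  have "odd (N * Polynomial.coeff E (i + j))" using odd_coeff_mult[OF i j] cN by simp
  then have N: "odd N" and "odd (Polynomial.coeff E (i + j))" by auto
  then have ij: "i + j = D"
    using E(1,3) Polynomial.coeff_eq_0[of E "i + j"] by (metis even_zero linorder_neqE_nat)
  have dC: "Polynomial.degree C = Polynomial.degree Q" "Polynomial.degree G = Polynomial.degree q"
    using arg_cong[OF C(2), of Polynomial.degree] arg_cong[OF G(2), of Polynomial.degree] C(1) G(1)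
    by (simp_all add: degree_ipoly)
  have iC: "i \<le> Polynomial.degree C" and jG: "j \<le> Polynomial.degree G"
    using i(1) j(1) by (metis even_zero le_degree)+
  \<comment> \<open>\<open>i\<close> is at most the degree of \<open>Q\<close>, which is less than
    \<open>D = i + j\<close>.\<close>
  have "j > 0" using iC dC dQ ij by simp
  show False
  proof (cases "i = 0")
    case True
    then have "Polynomial.degree Q = 0" using jG dC dsum ij by simp
    then obtain w where "Q = [:w:]" using degree_eq_zeroE by blast
    then show False using Q(2,3) by auto
  next
    case False
    \<comment> \<open>Now both constant terms are even, so 4 divides \<open>N\<close> times the
      constant term of \<open>E\<close>, although \<open>N\<close> is odd.\<close>
    then have "2 dvd Polynomial.coeff C 0" "2 dvd Polynomial.coeff G 0" using i(2) j(2) \<open>j > 0\<close> by auto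
    then have "2 * 2 dvd Polynomial.coeff C 0 * Polynomial.coeff G 0" by (rule mult_dvd_mono)
    then have "4 dvd N * Polynomial.coeff E 0" using cN[of 0] by (simp add: coeff_mult)
    moreover have "coprime (4::int) N" using N coprime_power_left_iff[of 2 2 N] by simp
    ultimately show False using E(4) by (simp add: coprime_dvd_mult_right_iff)
  qed
qed

text \<open>The \<open>k\<close>-th iterate of \<open>y\<^sup>2 - 2\<close>, that is, the Chebyshev
  polynomial of degree \<open>2 ^ k\<close> in the normalisation with
  \<open>2 cos x \<mapsto> 2 cos (2 ^ k x)\<close>.\<close>

fun chebp :: "nat \<Rightarrow> int poly" where
  "chebp 0 = [:0, 1:]"
| "chebp (Suc k) = (chebp k)\<^sup>2 - 2"

text \<open>Modulo two the recursion is squaring, so only the top monomial survives.\<close>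

lemma chebp_form: "\<exists>R. chebp k = Polynomial.monom 1 (2 ^ k) + Polynomial.smult 2 R \<and> Polynomial.degree R < 2 ^ k"
proof (induction k)
  case 0
  show ?case by (intro exI[of _ 0]) (simp add: Polynomial.monom_Suc Polynomial.monom_0)
next
  case (Suc k)
  then obtain R where R: "chebp k = Polynomial.monom 1 (2 ^ k) + Polynomial.smult 2 R" "Polynomial.degree R < 2 ^ k" by blast
  let ?M = "Polynomial.monom (1::int) (2 ^ k)"
  have "?M * ?M = Polynomial.monom 1 (2 ^ Suc k)" by (simp add: mult_monom mult_2)
  then have e: "chebp (Suc k) = Polynomial.monom 1 (2 ^ Suc k) + Polynomial.smult 2 (Polynomial.smult 2 (?M * R) + Polynomial.smult 2 (R * R) - 1)"
    by (simp add: R(1) power2_eq_square algebra_simps smult_add_right numeral_poly)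
       (simp add: smult_add_right smult_diff_right one_pCons)
  have "Polynomial.degree (?M * R) < 2 ^ Suc k"
    using Polynomial.degree_mult_le[of ?M R] R(2) by (simp add: Polynomial.degree_monom_eq)
  moreover have "Polynomial.degree (R * R) < 2 ^ Suc k"
    using Polynomial.degree_mult_le[of R R] R(2) by simp
  ultimately have "Polynomial.degree (Polynomial.smult 2 (?M * R) + Polynomial.smult 2 (R * R) - 1) < 2 ^ Suc k"
    by (intro degree_diff_less degree_add_less) auto
  then show ?case using e by blast
qed

text \<open>The orbit of 0 under \<open>y\<^sup>2 - 2\<close> is 0, -2, 2, 2, ..., hence the
  \<open>Suc\<close>.\<close>

lemma chebp_0: "Polynomial.coeff (chebp (Suc k)) 0 = 2 \<or> Polynomial.coeff (chebp (Suc k)) 0 = - 2"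
proof -
  have "poly (chebp (Suc k)) 0 = 2 \<or> poly (chebp (Suc k)) 0 = - 2"
    by (induction k) auto
  then show ?thesis by (simp add: poly_0_coeff_0)
qed

lemma poly_chebp: "poly (ipoly (chebp k)) y = ((\<lambda>y. y\<^sup>2 - 2) ^^ k) y"
proof (induction k)
  case (Suc k)
  have "ipoly (chebp (Suc k)) = (ipoly (chebp k))\<^sup>2 - 2"
    by (simp only: chebp.simps power2_eq_square ipoly_mult[symmetric])
      (rule poly_eqI, simp add: numeral_poly coeff_pCons split: nat.splits)
  then show ?case using Suc by simp
qed (simp add: map_poly_pCons)

text \<open>The shift by 3 is 2 + 1: the iterates of \<open>tau (k + 3)\<close> reach
  \<open>tau 2 = 0\<close> after \<open>Suc k\<close> steps, and at least one step is needed for the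
  constant term to be 2 or -2.\<close>

lemma tau_degree:
  assumes "P \<in> pover \<rat>" "P \<noteq> 0" "poly P (tau (k + 3)) = 0"
  shows "2 ^ Suc k \<le> Polynomial.degree P"
proof -
  obtain R where R: "chebp (Suc k) = Polynomial.monom 1 (2 ^ Suc k) + Polynomial.smult 2 R" "Polynomial.degree R < 2 ^ Suc k"
    using chebp_form by blast
  have d: "Polynomial.degree (chebp (Suc k)) = 2 ^ Suc k"
    unfolding R(1) using R(2) by (subst degree_add_eq_left) (auto simp: Polynomial.degree_monom_eq)
  show ?thesis
  proof (rule eisenstein_two[OF d _ _ _ _ assms])
    show "Polynomial.coeff (chebp (Suc k)) (2 ^ Suc k) = 1"
      unfolding R(1) using R(2) by (simp add: Polynomial.coeff_eq_0)
    show "even (Polynomial.coeff (chebp (Suc k)) i)" if "i < 2 ^ Suc k" for i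
      unfolding R(1) using that by simp
    show "\<not> 4 dvd Polynomial.coeff (chebp (Suc k)) 0" using chebp_0[of k] by auto
    have "k + 3 = 2 + Suc k" by simp
    then show "poly (ipoly (chebp (Suc k))) (tau (k + 3)) = 0"
      using tau_iterate[of "Suc k" 2] by (simp only: poly_chebp tau_2)
  qed
qed

lemma tau_algover: "subfld K \<Longrightarrow> algover K (tau n)"
proof -
  assume K: "subfld K"
  have "poly (ipoly (chebp n - 2)) (tau n) = 0"
  proof -
    have "ipoly (chebp n - 2) = ipoly (chebp n) - 2"
      by (rule poly_eqI) (simp add: numeral_poly coeff_pCons split: nat.splits)
    then show ?thesis using tau_iterate[of n 0] by (simp add: poly_chebp tau_0)
  qed
  moreover have "ipoly (chebp n - 2) \<noteq> 0"
  proof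
    assume e: "ipoly (chebp n - 2) = 0"
    obtain R where R: "chebp n = Polynomial.monom 1 (2 ^ n) + Polynomial.smult 2 R" "Polynomial.degree R < 2 ^ n"
      using chebp_form by blast
    have "of_int (Polynomial.coeff (chebp n - 2) (2 ^ n)) = (0::complex)"
      using arg_cong[OF e, of "\<lambda>p. Polynomial.coeff p (2 ^ n)"] by simp
    then show False using R by (simp add: Polynomial.coeff_eq_0 numeral_poly coeff_pCons split: nat.splits)
  qed
  ultimately show ?thesis unfolding algover_def using ipoly_pover[OF K] by blast
qed

text \<open>The \<open>Suc n\<close> lowest powers of \<open>z\<close> are dependent in dimension
  \<open>n\<close>. The degree is bounded crudely by the length of the coefficient list.\<close>

lemma fin_dim_poly:
  assumes K: "subfld K" and E: "subfld E" "ring.dimension CC n K E" and z: "z \<in> E"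
  shows "\<exists>q\<in>pover K. q \<noteq> 0 \<and> poly q z = 0 \<and> Polynomial.degree q \<le> Suc n"
proof -
  interpret field CC by (rule field_CC)
  have KC: "subfield K CC" using K by (simp add: subfield_CC_iff)
  let ?Us = "exp_base z (Suc n)"
  have "set ?Us \<subseteq> E" using z subfld_power[OF E(1)] by (auto simp: exp_base_def)
  then have "dependent K ?Us"
    using independent_length_le_dimension[OF KC E(2), of ?Us] by (auto simp: exp_base_def)
  then obtain Ks where Ks: "length Ks = length ?Us" "combine Ks ?Us = \<zero>\<^bsub>CC\<^esub>" "set Ks \<subseteq> K" "set Ks \<noteq> {\<zero>\<^bsub>CC\<^esub>}"
    using dependent_imp_non_trivial_combine[OF KC, of ?Us] by auto
  have len: "length Ks = Suc n" using Ks(1) by (simp add: exp_base_def)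
  define q where "q = Poly (rev Ks)"
  have "poly q z = 0"
    using combine_eq_eval[of Ks z] Ks(2) len by (simp add: q_def CC_eval)
  moreover have "q \<in> pover K"
    using Ks(3) subfld_0[OF K] by (auto simp: q_def pover_def coeff_Poly_eq nth_default_def)
      (metis length_rev nth_mem set_rev subsetD)
  moreover have "q \<noteq> 0"
  proof
    assume "q = 0"
    then obtain m where "rev Ks = replicate m 0" unfolding q_def by (auto simp: Poly_eq_0)
    then have "set (rev Ks) \<subseteq> {0}" by (simp only: set_replicate_conv_if) auto
    then show False using Ks(4) len by (cases Ks) auto
  qed
  moreover have "Polynomial.degree q \<le> length (rev Ks)" unfolding q_def by (rule degree_Poly)
  ultimately show ?thesis using len by (intro bexI[of _ q]) auto
qed

lemma tau_notin_fin_dim: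
  assumes E: "subfld E" "ring.finite_dimension CC \<rat> E"
  shows "\<exists>M. tau M \<notin> E"
proof (rule ccontr)
  interpret field CC by (rule field_CC)
  assume all: "\<not> ?thesis"
  obtain n where n: "dimension n \<rat> E" using E(2) unfolding finite_dimension_def by blast
  \<comment> \<open>The index \<open>n + 3\<close> makes the degree at least
    \<open>2 ^ Suc n\<close>, which exceeds the bound \<open>Suc n\<close> coming from the
    dimension.\<close>
  obtain q where q: "q \<in> pover \<rat>" "q \<noteq> 0" "poly q (tau (n + 3)) = 0" "Polynomial.degree q \<le> Suc n"
    using fin_dim_poly[OF subfld_Rats E(1) n, of "tau (n + 3)"] all by auto
  have "2 ^ Suc n \<le> Polynomial.degree q" by (rule tau_degree[OF q(1-3)])
  moreover have "Suc n < 2 ^ Suc n" by (rule less_exp)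
  ultimately show False using q(4) by simp
qed

section \<open>Stabilisers of paths\<close>

context quadratic_tower
begin

lemma gal_arith_hom: "\<sigma> \<in> carrier (gal_arith K f t) \<Longrightarrow> fhom (tower_field K f t) \<sigma>"
  and gal_arith_base: "\<sigma> \<in> carrier (gal_arith K f t) \<Longrightarrow> z \<in> base_field K t \<Longrightarrow> \<sigma> z = z"
  and gal_arith_K: "\<sigma> \<in> carrier (gal_arith K f t) \<Longrightarrow> z \<in> K \<Longrightarrow> \<sigma> z = z"
  using base_incl(1)[of t] by (auto simp: gal_arith_carrier)

lemma gal_arith_level:
  assumes "\<sigma> \<in> carrier (gal_arith K f t)" "z \<in> iter_level f t n"
  shows "\<sigma> z \<in> iter_level f t n"
  using hom_level[OF subfld_tower base_tower iter_level_tower gal_arith_hom[OF assms(1)], of n]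
    gal_arith_base[OF assms(1)] assms(2) by blast

lemma gal_arith_poly_f:
  assumes "\<sigma> \<in> carrier (gal_arith K f t)" "z \<in> tower_field K f t"
  shows "\<sigma> (poly f z) = poly f (\<sigma> z)"
  using hom_poly_f[OF subfld_tower K_tower gal_arith_hom[OF assms(1)]] gal_arith_K[OF assms(1)] assms(2) by blast

lemma gal_arith_one: "z \<in> iter_level f t n \<Longrightarrow> \<one>\<^bsub>gal_arith K f t\<^esub> z = z"
  using iter_level_tower[of t n] unfolding gal_arith_def gal_group_simps by auto

lemma gal_arith_mult:
  assumes "\<sigma> \<in> carrier (gal_arith K f t)" "\<rho> \<in> carrier (gal_arith K f t)" "z \<in> iter_level f t n"
  shows "(\<sigma> \<otimes>\<^bsub>gal_arith K f t\<^esub> \<rho>) z = \<sigma> (\<rho> z)"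
  using gal_group_simps(1)[of \<sigma> "tower_field K f t" "base_field K t" \<rho>] assms iter_level_tower[of t n]
  by (auto simp: gal_arith_def compose_def)

lemma tree_act_gal_arith: "tree_act (gal_arith K f t) (iter_level f t) (poly f) (\<lambda>\<sigma>. \<sigma>) t"
proof (intro tree_act.intro tree_act_axioms.intro group_gal_arith)
  fix \<sigma> w n assume "\<sigma> \<in> carrier (gal_arith K f t)" "w \<in> iter_level f t (Suc n)"
  then show "poly f (\<sigma> w) = \<sigma> (poly f w)" using gal_arith_poly_f iter_level_tower by (metis subsetD)
qed (fact iter_level_0 gal_arith_level gal_arith_one gal_arith_mult)+

lemma gal_arith_faithful:
  assumes \<sigma>: "\<sigma> \<in> carrier (gal_arith K f t)" "\<rho> \<in> carrier (gal_arith K f t)"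
    and e: "\<forall>n. \<forall>w\<in>iter_level f t n. \<sigma> w = \<rho> w"
  shows "\<sigma> = \<rho>"
proof -
  let ?L = "tower_field K f t"
  note L = subfld_tower[of t] and h = gal_arith_hom[OF \<sigma>(1)] gal_arith_hom[OF \<sigma>(2)]
  have "subfld {x \<in> ?L. \<sigma> x = \<rho> x}"
    unfolding subfld_def
    using subfld_1[OF L] subfld_diff[OF L] subfld_mult[OF L] subfld_inverse[OF L]
      fhom_1[OF L h(1)] fhom_diff[OF L h(1)] fhom_mult[OF L h(1)] fhom_inverse[OF L h(1)]
      fhom_1[OF L h(2)] fhom_diff[OF L h(2)] fhom_mult[OF L h(2)] fhom_inverse[OF L h(2)] by auto
  moreover have "base_field K t \<subseteq> {x \<in> ?L. \<sigma> x = \<rho> x}"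
    using base_tower[of t] gal_arith_base[OF \<sigma>(1)] gal_arith_base[OF \<sigma>(2)] by auto
  moreover have "iter_level f t n \<subseteq> {x \<in> ?L. \<sigma> x = \<rho> x}" for n
    using iter_level_tower[of t n] e by auto
  ultimately have "?L \<subseteq> {x \<in> ?L. \<sigma> x = \<rho> x}" by (rule tower_least)
  then show ?thesis
    using \<sigma> by (intro extensionalityI[of \<sigma> ?L \<rho>]) (auto simp: gal_arith_carrier Bij_def)
qed

lemma pathD:
  assumes "x \<in> path_space (iter_level f t) (poly f)"
  shows "x n \<in> iter_level f t n" "poly f (x (Suc n)) = x n" "x 0 = t"
proof -
  show "x n \<in> iter_level f t n" "poly f (x (Suc n)) = x n" using assms by (auto simp: path_space_def)
  have "x 0 \<in> iter_level f t 0" using assms by (auto simp: path_space_def)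
  then show "x 0 = t" by (simp add: iter_level_0)
qed

end

context critical_tower
begin

text \<open>\<open>x (Suc k)\<close> is a root of a polynomial over the base field of
  \<open>x k\<close> but does not lie in that field, which contains \<open>t\<close>.\<close>

lemma gal_arith_moves_child:
  assumes t: "\<not> algover K t" and x: "x \<in> path_space (iter_level f t) (poly f)"
  shows "\<exists>\<sigma>\<in>carrier (gal_arith K f t). \<sigma> (x k) = x k \<and> \<sigma> (x (Suc k)) \<noteq> x (Suc k)"
proof -
  note p = pathD[OF x]
  let ?E = "base_field K (x k)"
  have E: "subfld ?E" "K \<subseteq> ?E" "x k \<in> ?E" using subfld_base base_incl by auto
  have "t \<in> ?E" using iter_closed[OF E, of k] p(1)[of k] by (simp add: iter_level_def)
  then have bE: "base_field K t \<subseteq> ?E" using base_least[OF E(1,2)] by blast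
  have xt: "x n \<in> tower_field K f t" for n using p(1) iter_level_tower by blast
  have nE: "x (Suc k) \<notin> ?E"
    by (rule preimage_notin_base[OF iter_transcendental[OF t p(1)] p(2)])
  have P: "iterp f 1 - [:x k:] \<in> pover ?E"
    using pover_iterp[OF E(1), of f 1] fK pover_mono[OF E(2)] by (intro pover_diff[OF E(1)] pover_const[OF E(1) E(3)]) auto
  have "poly (iterp f 1 - [:x k:]) (x (Suc k)) = 0" using p(2) by (simp add: pcompose_pCons)
  then obtain \<sigma> where "\<sigma> \<in> carrier (gal_arith K f t)" "\<forall>z\<in>?E \<inter> tower_field K f t. \<sigma> z = z" "\<sigma> (x (Suc k)) \<noteq> x (Suc k)"
    using gal_exists[OF E(1) bE xt nE P iterp_minus_nonzero] by blast
  then show ?thesis using E(3) xt by blast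
qed

text \<open>A purely transcendental extension has no new constants: after clearing the denominator,
  \<open>p - z q\<close> vanishes at \<open>u\<close>, which is still transcendental over an
  extension containing \<open>z\<close>. So \<open>p = z q\<close>, and \<open>z\<close> is a
  quotient of coefficients.\<close>

lemma algebraic_in_ratfun:
  assumes E: "subfld E" "K \<subseteq> E" "ring.finite_dimension CC K E" and u: "\<not> algover K u"
    and z: "algover E z" "z \<in> ratfun E u"
  shows "z \<in> E"
proof -
  obtain p q where pq: "p \<in> pover E" "q \<in> pover E" "poly q u \<noteq> 0" "z = poly p u / poly q u"
    using z(2) by (auto simp: ratfun_def)
  obtain E' where E': "subfld E'" "E \<subseteq> E'" "z \<in> E'" "ring.finite_dimension CC E E'"
    using fin_dim_adjoin[OF E(1) z(1)] by metis
  have pE': "p \<in> pover E'" "q \<in> pover E'" using pq(1,2) pover_mono[OF E'(2)] by auto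
  have "\<not> algover E' u"
    using u algover_trans[OF K E] algover_trans[OF E(1) E'(1,2,4)] by blast
  moreover have "p - Polynomial.smult z q \<in> pover E'"
    using pE' by (intro pover_diff[OF E'(1)] pover_smult[OF E'(1) E'(3)])
  moreover have "poly (p - Polynomial.smult z q) u = 0" using pq(3,4) by simp
  ultimately have "p - Polynomial.smult z q = 0" by (auto simp: algover_def)
  then have e: "Polynomial.coeff p i = z * Polynomial.coeff q i" for i by simp
  have "q \<noteq> 0" using pq(3) by auto
  then have "Polynomial.lead_coeff q \<noteq> 0" by simp
  then have "z = Polynomial.coeff p (Polynomial.degree q) / Polynomial.lead_coeff q" using e by simp
  then show ?thesis using pq(1,2) subfld_divide[OF E(1)] by (auto simp: pover_def)
qed

text \<open>For each \<open>N\<close> some automorphism fixes the path and \<open>tau N\<close> but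
  moves another \<open>tau M\<close>. If the stabiliser were finite, one \<open>N\<close> would
  bound a moved index for each of its elements; but fixing \<open>tau N\<close> means fixing every
  earlier \<open>tau i\<close>.\<close>

lemma infinite_path_stabiliser:
  assumes t: "\<not> algover K t" and x: "x \<in> path_space (iter_level f t) (poly f)"
    and fin: "ring.finite_dimension CC \<rat> K" and tau: "\<And>n. tau n \<in> tower_field K f t"
  shows "infinite {\<sigma> \<in> carrier (gal_arith K f t). \<forall>n. \<sigma> (x n) = x n}"
proof
  interpret CC: field CC by (rule field_CC)
  let ?L = "tower_field K f t"
  let ?Z = "{\<sigma> \<in> carrier (gal_arith K f t). \<forall>n. \<sigma> (x n) = x n}"
  note p = pathD[OF x]
  have xt: "x n \<in> ?L" for n using p(1) iter_level_tower by blast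
  have it: "(poly f ^^ k) (x (n + k)) = x n" for n k
    by (induction k) (simp_all add: funpow_swap1 p(2))
  have step: "\<exists>M. \<exists>\<sigma>\<in>?Z. \<sigma> (tau N) = tau N \<and> \<sigma> (tau M) \<noteq> tau M" for N
  proof -
    obtain E where E: "subfld E" "K \<subseteq> E" "tau N \<in> E" "CC.finite_dimension K E"
      using fin_dim_adjoin[OF K tau_algover[OF K]] by metis
    have "CC.finite_dimension \<rat> E"
      using CC.telescopic_base_dim(1)[OF _ _ fin E(4)] K subfld_Rats by (simp add: subfield_CC_iff)
    then obtain M where M: "tau M \<notin> E" using tau_notin_fin_dim[OF E(1)] by blast
    \<comment> \<open>The field generated over \<open>E\<close> by the path: \<open>x n\<close> is
      an iterate of \<open>x (n + k)\<close>, so this is an increasing union. The algebraic number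
      \<open>tau M\<close> lies in none of its members.\<close>
    define F where "F = (\<Union>n. ratfun E (x n))"
    have mono: "ratfun E (x n) \<subseteq> ratfun E (x (n + k))" for n k
    proof -
      have Em: "E \<subseteq> ratfun E (x (n + k))" by (rule ratfun_base[OF E(1)])
      have sf: "subfld (ratfun E (x (n + k)))" by (rule subfld_ratfun[OF E(1)])
      have "x n \<in> ratfun E (x (n + k))"
        using iter_closed[OF sf, of "x (n + k)" k] Em E(2) ratfun_mem[OF E(1)] it by auto
      then show ?thesis
        using poly_pover_in[OF sf, of _ "x n"] pover_mono[OF Em]
        by (auto simp: ratfun_def[of E "x n"] intro!: subfld_divide[OF sf])
    qed
    have "ratfun E (x m) \<subseteq> ratfun E (x n)" if "m \<le> n" for m n using mono[of m "n - m"] that by simp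
    then have sF: "subfld F" unfolding F_def by (rule subfld_chain_UN[OF subfld_ratfun[OF E(1)]])
    have EF: "E \<subseteq> F" using ratfun_base[OF E(1)] by (auto simp: F_def)
    have xF: "x n \<in> F" for n using ratfun_mem[OF E(1)] by (auto simp: F_def)
    have bF: "base_field K t \<subseteq> F" using base_least[OF sF] EF E(2) xF[of 0] p(3) by auto
    have algE: "algover E (tau M)" by (rule tau_algover[OF E(1)])
    have "tau M \<notin> F"
    proof
      assume "tau M \<in> F"
      then obtain n where "tau M \<in> ratfun E (x n)" by (auto simp: F_def)
      then show False
        using algebraic_in_ratfun[OF E(1,2,4) iter_transcendental[OF t p(1)] algE] M by blast
    qed
    moreover obtain P where "P \<in> pover F" "P \<noteq> 0" "poly P (tau M) = 0"
      using tau_algover[OF sF] by (auto simp: algover_def)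
    ultimately obtain \<sigma> where "\<sigma> \<in> carrier (gal_arith K f t)" "\<forall>z\<in>F \<inter> ?L. \<sigma> z = z" "\<sigma> (tau M) \<noteq> tau M"
      using gal_exists[OF sF bF tau] by blast
    then show ?thesis using xF xt E(3) EF tau by blast
  qed
  assume finZ: "finite ?Z"
  \<comment> \<open>For an automorphism moving no \<open>tau\<close> the choice is arbitrary; this
    can only enlarge the bound \<open>N\<close>.\<close>
  define j where "j \<sigma> = (SOME j. \<sigma> (tau j) \<noteq> tau j)" for \<sigma>
  have j: "\<sigma> (tau (j \<sigma>)) \<noteq> tau (j \<sigma>)" if "\<sigma> (tau M) \<noteq> tau M" for \<sigma> M
    unfolding j_def by (rule someI[of "\<lambda>j. \<sigma> (tau j) \<noteq> tau j", OF that])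
  define N where "N = Max (j ` ?Z)"
  obtain M \<sigma> where \<sigma>: "\<sigma> \<in> ?Z" "\<sigma> (tau N) = tau N" "\<sigma> (tau M) \<noteq> tau M" using step by blast
  have le: "j \<sigma> \<le> N" unfolding N_def using finZ \<sigma>(1) by (intro Max_ge) auto
  have h: "fhom ?L \<sigma>" using \<sigma>(1) by (auto simp: gal_arith_carrier)
  \<comment> \<open>Downwards from \<open>N\<close>, since \<open>tau i\<close> is a polynomial in
    \<open>tau (Suc i)\<close>.\<close>
  have "\<sigma> (tau i) = tau i" if "i \<le> N" for i
    using that
  proof (induction i rule: inc_induct)
    case (step i)
    note L = subfld_tower[of t]
    have "\<sigma> ((tau (Suc i))\<^sup>2 - 2) = (tau (Suc i))\<^sup>2 - 2"
      using step fhom_diff[OF L h subfld_power[OF L tau] subfld_numeral[OF L]] fhom_power[OF L h tau]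
        fhom_of_nat[OF L h, of 2] by simp
    then show ?case by (simp add: tau_Suc)
  qed (rule \<sigma>(2))
  then show False using j[of \<sigma> M, OF \<sigma>(3)] le by blast
qed

text \<open>This keeps the two children of every vertex distinct, since a point equals its
  reflection only at \<open>c\<close>.\<close>

lemma level_ne_c:
  assumes "\<not> algover K t" "z \<in> iter_level f t n"
  shows "z \<noteq> c"
proof
  assume "z = c"
  then have "t \<in> K" using iter_closed[OF K _ c_in_K, of n] assms(2) by (auto simp: iter_level_def)
  then have "algover K t"
    unfolding algover_def
    by (intro bexI[of _ "[:- t, 1:]"])
      (auto simp: pover_pCons_iff[OF K] pover_0[OF K] subfld_1[OF K] subfld_uminus[OF K])
  then show False using assms(1) by simp
qed

section \<open>Coordinates\<close>

context
  fixes t :: complex and x :: "nat \<Rightarrow> complex" and Y :: "nat \<Rightarrow> int \<Rightarrow> complex"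
  assumes t: "\<not> algover K t" and Y_init: "\<And>i. Y 0 i = t" and Yf: "\<And>n i. poly f (Y (Suc n) i) = Y n i"
    and Yr: "\<And>n i. 2 * c - Y (Suc n) i = Y (Suc n) (i + 2 ^ n)" and Yx: "\<And>n. Y n 0 = x n"
begin

lemma coord_level: "Y n i \<in> iter_level f t n"
  by (induction n) (simp_all add: iter_level_def funpow_swap1 Yf Y_init)

lemma coord_range: "range (Y n) = iter_level f t n"
proof
  show "range (Y n) \<subseteq> iter_level f t n" using coord_level by auto
  show "iter_level f t n \<subseteq> range (Y n)"
  proof (induction n)
    case (Suc n)
    show ?case
    proof
      fix z assume "z \<in> iter_level f t (Suc n)"
      then obtain i where "poly f z = Y n i" using Suc iter_level_image by blast
      then have "poly f z = poly f (Y (Suc n) i)" by (simp add: Yf)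
      then have "z = Y (Suc n) i \<or> z = Y (Suc n) (i + 2 ^ n)" by (simp add: poly_f_eq_iff Yr)
      then show "z \<in> range (Y (Suc n))" by auto
    qed
  qed (auto simp: iter_level_0 Y_init)
qed

text \<open>By \<open>Yr\<close>, a shift by \<open>2 ^ k\<close> on level \<open>Suc k\<close> is a
  reflection, and two reflections cancel.\<close>

lemma coord_period: "Y n (i + 2 ^ n * m) = Y n i"
proof (cases n)
  case 0
  then show ?thesis by (simp add: Y_init)
next
  case (Suc k)
  have s: "Y n (i + 2 ^ n) = Y n i" for i
  proof -
    have "Y n (i + 2 ^ n) = Y (Suc k) ((i + 2 ^ k) + 2 ^ k)" by (simp add: Suc algebra_simps)
    also have "\<dots> = Y n i" by (simp only: Yr[symmetric] Suc) simp
    finally show ?thesis .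
  qed
  show ?thesis
  proof (induction m rule: int_induct[where k = 0])
    case (step1 m)
    have "Y n (i + 2 ^ n * (m + 1)) = Y n ((i + 2 ^ n * m) + 2 ^ n)" by (simp add: algebra_simps)
    then show ?case using s step1 by simp
  next
    case (step2 m)
    have "Y n (i + 2 ^ n * m) = Y n ((i + 2 ^ n * (m - 1)) + 2 ^ n)" by (simp add: algebra_simps)
    then show ?case using s step2 by simp
  qed simp
qed

text \<open>Equal vertices have equal parents, so \<open>i - j\<close> is a multiple
  \<open>2 ^ n * m\<close>. If \<open>m\<close> were odd, the vertex would be its own reflection,
  hence equal to \<open>c\<close>.\<close>

lemma coord_eq: "Y n i = Y n j \<longleftrightarrow> 2 ^ n dvd i - j"
proof
  assume "2 ^ n dvd i - j"
  then obtain m where "i - j = 2 ^ n * m" by (auto elim: dvdE)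
  then have "i = j + 2 ^ n * m" by simp
  then show "Y n i = Y n j" by (simp add: coord_period)
next
  assume "Y n i = Y n j"
  then show "2 ^ n dvd i - j"
  proof (induction n)
    case (Suc n)
    then have "Y n i = Y n j" by (metis Yf)
    then obtain m where m: "i = j + 2 ^ n * m" using Suc.IH by (auto elim!: dvdE simp: algebra_simps)
    show ?case
    proof (cases "even m")
      case True
      then show ?thesis using m by (auto elim!: evenE)
    next
      case False
      then obtain l where "m = 2 * l + 1" by (auto elim: oddE)
      then have "i = (j + 2 ^ n) + 2 ^ Suc n * l" using m by (simp add: algebra_simps)
      then have "Y (Suc n) i = 2 * c - Y (Suc n) j" by (simp only: coord_period Yr)
      then have "Y (Suc n) j = c" using Suc.prems by (simp add: algebra_simps)
      then show ?thesis using level_ne_c[OF t coord_level, of "Suc n" j] by simp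
    qed
  qed simp
qed

lemma coord_affine:
  assumes "\<And>\<sigma> n. \<sigma> \<in> carrier (gal_arith K f t) \<Longrightarrow> \<exists>\<alpha> \<beta>. \<forall>i. \<sigma> (Y n i) = Y n (\<alpha> * i + \<beta>)"
  shows "affine_coords (iter_level f t) (poly f) (gal_arith K f t) (\<lambda>\<sigma>. \<sigma>) x Y"
  unfolding affine_coords_def
  by (intro conjI allI ballI) (fact Yx coord_range coord_eq Yf | rule assms, assumption)+

end

lemma stable_of_coords:
  assumes t: "\<not> algover K t" and fin: "ring.finite_dimension CC \<rat> K"
    and tau: "\<And>n. tau n \<in> tower_field K f t"
    and coords: "\<And>x. x \<in> path_space (iter_level f t) (poly f) \<Longrightarrow>
      \<exists>Y. affine_coords (iter_level f t) (poly f) (gal_arith K f t) (\<lambda>\<sigma>. \<sigma>) x Y"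
  shows "gal_arith_stable K f t \<and> gal_arith_infinite_disc_group K f t"
proof -
  interpret tree_act "gal_arith K f t" "iter_level f t" "poly f" "\<lambda>\<sigma>. \<sigma>" t
    by (rule tree_act_gal_arith)
  interpret affine_tree "gal_arith K f t" "iter_level f t" "poly f" "\<lambda>\<sigma>. \<sigma>" t
    by unfold_locales (rule coords)
  show ?thesis
    unfolding tree_stable_def
    using affine_LQA affine_infinite_disc_group gal_arith_moves_child[OF t]
      infinite_path_stabiliser[OF t _ fin tau] gal_arith_faithful by blast
qed

end

section \<open>Powers of roots of unity and the Joukowski map\<close>

lemma zeta_Suc_powi: "(zeta (Suc n) powi i)\<^sup>2 = zeta n powi i"
proof -
  have "(zeta (Suc n) powi i)\<^sup>2 = (zeta (Suc n))\<^sup>2 powi i"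
    by (simp only: power2_eq_square power_int_mult_distrib)
  then show ?thesis by (simp only: zeta_Suc)
qed

lemma zeta_powi_half: "zeta (Suc n) powi (i + 2 ^ n) = - (zeta (Suc n) powi i)"
proof -
  have "zeta (Suc n) powi (2 ^ n) = zeta (Suc n) ^ 2 ^ n"
    by (metis of_nat_numeral of_nat_power power_int_of_nat)
  then show ?thesis by (simp add: power_int_add zeta_half)
qed

lemma zeta_0_powi: "zeta 0 powi i = 1"
  by (simp add: zeta_0)

lemma sum_prod_determine:
  fixes p q r s :: complex
  assumes "p + q = r + s" "p * q = r * s"
  shows "p = r \<and> q = s \<or> p = s \<and> q = r"
proof -
  have q: "q = r + s - p" using assms(1) by (simp add: algebra_simps)
  have "(p - r) * (p - s) = r * s - p * (r + s - p)" by (simp add: algebra_simps)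
  also have "\<dots> = 0" using assms(2) q by simp
  finally show ?thesis using q by auto
qed

text \<open>Semiconjugates squaring to \<open>y\<^sup>2 - 2\<close>, which reduces roots of the
  Chebyshev iterates to roots of powers.\<close>

definition joukowski :: "complex \<Rightarrow> complex" where
  "joukowski w = w + inverse w"

lemma joukowski_square: "w \<noteq> 0 \<Longrightarrow> (joukowski w)\<^sup>2 - 2 = joukowski (w\<^sup>2)"
  by (simp add: joukowski_def power2_sum power_inverse)

text \<open>The addition formulas for \<open>2 cos\<close>. Sum and product of
  \<open>joukowski (A * B)\<close> and \<open>joukowski (B / A)\<close> depend only on
  \<open>joukowski A\<close> and \<open>joukowski B\<close>, so these determine the unordered
  pair.\<close>

lemma joukowski_add_mult:
  assumes "A \<noteq> 0" "B \<noteq> 0"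
  shows "joukowski (A * B) + joukowski (B / A) = joukowski A * joukowski B"
    and "joukowski (A * B) * joukowski (B / A) = (joukowski B)\<^sup>2 + (joukowski A)\<^sup>2 - 4"
proof -
  define A' B' where "A' = inverse A" and "B' = inverse B"
  have 1: "A * A' = 1" "B * B' = 1" using assms by (simp_all add: A'_def B'_def)
  have j: "joukowski (A * B) = A * B + A' * B'" "joukowski (B / A) = B * A' + B' * A"
    "joukowski A = A + A'" "joukowski B = B + B'"
    by (simp_all add: joukowski_def A'_def B'_def divide_inverse)
  show "joukowski (A * B) + joukowski (B / A) = joukowski A * joukowski B"
    unfolding j by (simp add: algebra_simps)
  show "joukowski (A * B) * joukowski (B / A) = (joukowski B)\<^sup>2 + (joukowski A)\<^sup>2 - 4"
  proof -
    have "(A * B + A' * B') * (B * A' + B' * A) =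
        (A * A') * (B * B) + (B * B') * (A * A) + (B * B') * (A' * A') + (A * A') * (B' * B')"
      by (simp add: algebra_simps)
    moreover have "(B + B')\<^sup>2 + (A + A')\<^sup>2 - 4 =
        B * B + B' * B' + 2 * (B * B') + (A * A + A' * A' + 2 * (A * A')) - 4"
      by (simp add: power2_eq_square algebra_simps)
    ultimately show ?thesis unfolding j 1 by simp
  qed
qed

lemma double_root: "w \<noteq> 0 \<Longrightarrow> joukowski w = 2 \<Longrightarrow> (w - 1)\<^sup>2 = 0"
proof -
  assume w: "w \<noteq> 0" "joukowski w = 2"
  have "(w - 1)\<^sup>2 = w * (w + inverse w) - 2 * w" using w(1) by (simp add: power2_eq_square algebra_simps)
  then show "(w - 1)\<^sup>2 = 0" using w(2) by (simp add: joukowski_def)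
qed

lemma joukowski_uminus: "joukowski (- w) = - joukowski w"
  by (simp add: joukowski_def)

lemma joukowski_surj: "\<exists>w. w \<noteq> 0 \<and> joukowski w = y"
proof -
  define s where "s = csqrt (y\<^sup>2 - 4)"
  define w where "w = (y + s) / 2"
  have "s * s = y * y - 4" unfolding s_def by (simp flip: power2_eq_square)
  moreover have "2 * w = y + s" by (simp add: w_def)
  moreover have "4 * (w * w - y * w + 1) = (2 * w) * (2 * w) - 2 * y * (2 * w) + 4"
    by (simp add: algebra_simps)
  ultimately have "4 * (w * w - y * w + 1) = 0" by (simp add: algebra_simps)
  then have w: "w * w - y * w + 1 = 0" by (metis mult_eq_0_iff zero_neq_numeral)
  then have "w \<noteq> 0" by auto
  moreover have "joukowski w = y" using w \<open>w \<noteq> 0\<close> by (simp add: joukowski_def field_simps)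
  ultimately show ?thesis by blast
qed

context critical_tower
begin

lemma path_exists: "\<exists>x. x \<in> path_space (iter_level f t) (poly f)"
  using path_through[of t t 0] by (auto simp: iter_level_0)

text \<open>Here \<open>a * (x - c)\<close> conjugates \<open>f\<close> to the squaring map.\<close>

lemma stable_fixed_critical_point:
  assumes t: "\<not> algover K t" and fin: "ring.finite_dimension CC \<rat> K" and v: "v = c"
  shows "gal_arith_stable K f t \<and> gal_arith_infinite_disc_group K f t"
proof -
  let ?L = "tower_field K f t"
  note L = subfld_tower[of t]
  \<comment> \<open>In the coordinate \<open>z - c\<close> the map is \<open>a\<close> times
    squaring, so the vertices of level \<open>n\<close> differ by factors that are
    \<open>2 ^ n\<close>-th roots of unity.\<close>
  define Y where "Y x n i = c + zeta n powi i * (x n - c)" for x :: "nat \<Rightarrow> complex" and n i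
  have Y: "Y x 0 i = t" "poly f (Y x (Suc n) i) = Y x n i"
    "2 * c - Y x (Suc n) i = Y x (Suc n) (i + 2 ^ n)" "Y x n 0 = x n"
    if "x \<in> path_space (iter_level f t) (poly f)" for x n i
  proof -
    show "Y x 0 i = t" using pathD(3)[OF that] by (simp add: Y_def zeta_0_powi)
    have "x n = a * (x (Suc n) - c)\<^sup>2 + c" using pathD(2)[OF that, of n] by (simp add: poly_f v)
    then have "x n - c = a * (x (Suc n) - c)\<^sup>2" by simp
    then show "poly f (Y x (Suc n) i) = Y x n i"
      by (simp add: Y_def poly_f v power_mult_distrib zeta_Suc_powi)
    show "2 * c - Y x (Suc n) i = Y x (Suc n) (i + 2 ^ n)" by (simp add: Y_def zeta_powi_half)
  qed (simp add: Y_def)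
  have cL: "c \<in> ?L" using c_in_K K_tower by blast
  have zeta: "zeta n \<in> ?L" for n
  proof -
    obtain x where x: "x \<in> path_space (iter_level f t) (poly f)" using path_exists by blast
    have "Y x n i \<in> ?L" for i
      using coord_level[OF t Y(1-4)[OF x]] iter_level_tower by blast
    \<comment> \<open>The quotient is \<open>zeta n\<close>, as \<open>x n\<close> cancels.\<close>
    then have "(Y x n 1 - c) / (Y x n 0 - c) \<in> ?L" using cL by (intro subfld_divide[OF L] subfld_diff[OF L])
    moreover have "x n \<noteq> c" using level_ne_c[OF t pathD(1)[OF x]] .
    ultimately show ?thesis by (simp add: Y_def)
  qed
  show ?thesis
  proof (rule stable_of_coords[OF t fin])
    show "tau n \<in> ?L" for n unfolding tau_def by (intro subfld_add[OF L] subfld_inverse[OF L] zeta)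
    fix x assume x: "x \<in> path_space (iter_level f t) (poly f)"
    note C = t Y(1-4)[OF x]
    have xL: "x n \<in> ?L" for n using pathD(1)[OF x] iter_level_tower by blast
    have "\<exists>\<alpha> \<beta>. \<forall>i. \<sigma> (Y x n i) = Y x n (\<alpha> * i + \<beta>)" if \<sigma>: "\<sigma> \<in> carrier (gal_arith K f t)" for \<sigma> n
    proof -
      have h: "fhom ?L \<sigma>" using gal_arith_hom[OF \<sigma>] .
      have "\<sigma> (zeta n) ^ 2 ^ n = 1"
        using fhom_power[OF L h zeta[of n], of "2 ^ n"] fhom_1[OF L h] by (simp add: zeta_one)
      then obtain \<alpha> :: nat where \<alpha>: "\<sigma> (zeta n) = zeta n ^ \<alpha>" using root_of_unity_zeta by blast
      have "\<sigma> (x n) \<in> iter_level f t n" using gal_arith_level[OF \<sigma> pathD(1)[OF x]] .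
      then obtain \<beta> where \<beta>: "\<sigma> (x n) = Y x n \<beta>" using coord_range[OF C, of n] by blast
      have "\<sigma> (Y x n i) = Y x n (int \<alpha> * i + \<beta>)" for i
      proof -
        have "\<sigma> (Y x n i) = \<sigma> c + \<sigma> (zeta n) powi i * (\<sigma> (x n) - \<sigma> c)"
          unfolding Y_def using cL xL zeta
          by (simp add: fhom_add[OF L h] fhom_mult[OF L h] fhom_diff[OF L h] fhom_power_int[OF L h]
              subfld_mult[OF L] subfld_diff[OF L] subfld_power_int[OF L])
        also have "\<dots> = c + (zeta n ^ \<alpha>) powi i * (zeta n powi \<beta> * (x n - c))"
          using gal_arith_K[OF \<sigma> c_in_K] \<alpha> \<beta> by (simp add: Y_def)
        also have "\<dots> = Y x n (int \<alpha> * i + \<beta>)" by (simp add: Y_def power_int_add power_int_power)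
        finally show ?thesis .
      qed
      then show ?thesis by blast
    qed
    then show "\<exists>Y. affine_coords (iter_level f t) (poly f) (gal_arith K f t) (\<lambda>\<sigma>. \<sigma>) x Y"
      using coord_affine[OF C] by blast
  qed
qed

text \<open>Here \<open>a * (x - c)\<close> conjugates \<open>f\<close> to the Chebyshev map \<open>y\<^sup>2 - 2\<close>.\<close>

lemma stable_chebyshev:
  assumes t: "\<not> algover K t" and fin: "ring.finite_dimension CC \<rat> K" and v: "a * (v - c) = - 2"
  shows "gal_arith_stable K f t \<and> gal_arith_infinite_disc_group K f t"
proof -
  let ?L = "tower_field K f t"
  note L = subfld_tower[of t]
  have conj: "a * (poly f z - c) = (a * (z - c))\<^sup>2 - 2" for z
  proof -
    have "a * (poly f z - c) = (a * (z - c))\<^sup>2 + a * (v - c)" by (simp add: poly_f power2_eq_square algebra_simps)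
    then show ?thesis using v by simp
  qed
  \<comment> \<open>A compatible lift of the path through \<open>joukowski\<close>. Neither
    \<open>w n\<close> nor \<open>zeta n\<close> need lie in the tower, so an automorphism can be
    applied to the values of \<open>joukowski\<close> only.\<close>
  define W where "W x w \<longleftrightarrow> (\<forall>n. w n \<noteq> 0 \<and> joukowski (w n) = a * (x n - c) \<and> (w (Suc n))\<^sup>2 = w n)"
    for x w :: "nat \<Rightarrow> complex"
  have ex_w: "\<exists>w. W x w" if x: "x \<in> path_space (iter_level f t) (poly f)" for x
  proof -
    have "\<exists>w. \<forall>n. (w n \<noteq> 0 \<and> joukowski (w n) = a * (x n - c)) \<and> (w (Suc n))\<^sup>2 = w n"
    proof (rule dependent_nat_choice)
      show "\<exists>w. w \<noteq> 0 \<and> joukowski w = a * (x 0 - c)" by (rule joukowski_surj)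
      fix w n assume w: "w \<noteq> 0 \<and> joukowski w = a * (x n - c)"
      define u where "u = csqrt w"
      have u: "u\<^sup>2 = w" "u \<noteq> 0" using w by (auto simp: u_def)
      have "(joukowski u)\<^sup>2 = (a * (x (Suc n) - c))\<^sup>2"
        using joukowski_square[OF u(2)] conj[of "x (Suc n)"] pathD(2)[OF x, of n] u(1) w by simp
      \<comment> \<open>The squares agree, and changing the sign of the square root changes the sign
        of \<open>joukowski\<close>.\<close>
      then have "joukowski u = a * (x (Suc n) - c) \<or> joukowski (- u) = a * (x (Suc n) - c)"
        unfolding power2_eq_iff by (auto simp: joukowski_uminus)
      then show "\<exists>w'. (w' \<noteq> 0 \<and> joukowski w' = a * (x (Suc n) - c)) \<and> w'\<^sup>2 = w"
        using u by (metis neg_equal_0_iff_equal power2_minus)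
    qed
    then show ?thesis by (auto simp: W_def)
  qed
  define y where "y w n i = joukowski (zeta n powi i * w n)" for w :: "nat \<Rightarrow> complex" and n i
  define Y where "Y w n i = c + y w n i / a" for w n i
  have yY: "a * (Y w n i - c) = y w n i" for w n i using a_nonzero by (simp add: Y_def)
  have Y: "Y w 0 i = t" "poly f (Y w (Suc n) i) = Y w n i"
    "2 * c - Y w (Suc n) i = Y w (Suc n) (i + 2 ^ n)" "Y w n 0 = x n"
    if x: "x \<in> path_space (iter_level f t) (poly f)" and w: "W x w" for x w n i
  proof -
    have w0: "w n \<noteq> 0" and wj: "joukowski (w n) = a * (x n - c)" and ws: "(w (Suc n))\<^sup>2 = w n" for n
      using w by (auto simp: W_def)
    show "Y w n 0 = x n" for n using wj[of n] a_nonzero by (simp add: Y_def y_def)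
    then show "Y w 0 i = t" using pathD(3)[OF x] by (simp add: Y_def y_def zeta_0_powi)
    have "a * (poly f (Y w (Suc n) i) - c) = (y w (Suc n) i)\<^sup>2 - 2" by (simp only: conj yY)
    also have "\<dots> = y w n i"
      using w0[of "Suc n"] by (simp add: y_def joukowski_square power_mult_distrib zeta_Suc_powi ws)
    finally have "poly f (Y w (Suc n) i) - c = y w n i / a" by (metis a_nonzero nonzero_mult_div_cancel_left)
    then show "poly f (Y w (Suc n) i) = Y w n i" unfolding Y_def by (metis add.commute diff_add_cancel)
    show "2 * c - Y w (Suc n) i = Y w (Suc n) (i + 2 ^ n)"
      by (simp add: Y_def y_def zeta_powi_half joukowski_uminus)
  qed
  define T where "T n k = zeta n powi k + zeta n powi (- k)" for n and k :: int
  \<comment> \<open>For \<open>k = 1\<close> these are relations inside the tower, to which an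
    automorphism can be applied; general \<open>k\<close> is needed to interpret the result.\<close>
  have sum: "y w n (i + k) + y w n (i - k) = T n k * y w n i"
    and prod: "y w n (i + k) * y w n (i - k) = (y w n i)\<^sup>2 + (T n k)\<^sup>2 - 4" if "w n \<noteq> 0" for w n i k
  proof -
    have e: "y w n (i + k) = joukowski (zeta n powi k * (zeta n powi i * w n))"
      "y w n (i - k) = joukowski ((zeta n powi i * w n) / zeta n powi k)"
      "y w n i = joukowski (zeta n powi i * w n)" "T n k = joukowski (zeta n powi k)"
      by (simp_all add: y_def T_def power_int_add power_int_diff power_int_minus joukowski_def)
    have nz: "zeta n powi k \<noteq> 0" "zeta n powi i * w n \<noteq> 0" using that by simp_all
    show "y w n (i + k) + y w n (i - k) = T n k * y w n i"
      unfolding e by (rule joukowski_add_mult(1)[OF nz])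
    show "y w n (i + k) * y w n (i - k) = (y w n i)\<^sup>2 + (T n k)\<^sup>2 - 4"
      unfolding e by (rule joukowski_add_mult(2)[OF nz])
  qed
  have T1: "T n 1 = tau n" for n by (simp add: T_def tau_def power_int_minus)
  have aL: "a \<in> ?L" "c \<in> ?L" using a_in_K c_in_K K_tower by blast+
  have yL: "y w n i \<in> ?L" if "x \<in> path_space (iter_level f t) (poly f)" "W x w" for x w n i
  proof -
    have "Y w n i \<in> ?L" using coord_level[OF t Y(1-4)[OF that]] iter_level_tower by blast
    then show ?thesis unfolding yY[symmetric] using aL by (intro subfld_mult[OF L] subfld_diff[OF L])
  qed
  have tau: "tau n \<in> ?L" for n
  proof -
    obtain x w where x: "x \<in> path_space (iter_level f t) (poly f)" "W x w" using path_exists ex_w by blast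
    have "w n \<noteq> 0" using x(2) by (simp add: W_def)
    have "y w n 0 \<noteq> 0" using level_ne_c[OF t pathD(1)[OF x(1)], of n] Y(4)[OF x, of n] by (auto simp: Y_def)
    then have "tau n = (y w n 1 + y w n (- 1)) / y w n 0"
      using sum[of w n 0 1] \<open>w n \<noteq> 0\<close> T1 by simp
    moreover have "(y w n 1 + y w n (- 1)) / y w n 0 \<in> ?L"
      using yL[OF x] by (intro subfld_divide[OF L] subfld_add[OF L])
    ultimately show ?thesis by simp
  qed
  show ?thesis
  proof (rule stable_of_coords[OF t fin tau])
    fix x assume x: "x \<in> path_space (iter_level f t) (poly f)"
    obtain w where w: "W x w" using ex_w[OF x] by blast
    note C = t Y(1-4)[OF x w]
    have "\<exists>\<alpha> \<beta>. \<forall>i. \<sigma> (Y w n i) = Y w n (\<alpha> * i + \<beta>)" if \<sigma>: "\<sigma> \<in> carrier (gal_arith K f t)" for \<sigma> n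
    proof -
      have h: "fhom ?L \<sigma>" using gal_arith_hom[OF \<sigma>] .
      have w0: "w n \<noteq> 0" using w by (simp add: W_def)
      have two: "\<sigma> 2 = 2" "\<sigma> 4 = 4" using fhom_of_nat[OF L h, of 2] fhom_of_nat[OF L h, of 4] by simp_all
      have "\<exists>j. \<sigma> (Y w n i) = Y w n j" for i
        using gal_arith_level[OF \<sigma> coord_level[OF C, of n i]] coord_range[OF C, of n] by blast
      then obtain \<pi> where \<pi>: "\<And>i. \<sigma> (Y w n i) = Y w n (\<pi> i)" by metis
      have YL: "Y w n i \<in> ?L" for i using coord_level[OF C] iter_level_tower by blast
      have \<sigma>y: "\<sigma> (y w n i) = y w n (\<pi> i)" for i
      proof -
        have "\<sigma> (a * (Y w n i - c)) = a * (\<sigma> (Y w n i) - c)"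
          using fhom_mult[OF L h aL(1) subfld_diff[OF L YL aL(2)]] fhom_diff[OF L h YL aL(2)]
            gal_arith_K[OF \<sigma> a_in_K] gal_arith_K[OF \<sigma> c_in_K] by simp
        then show ?thesis unfolding \<pi> yY .
      qed
      \<comment> \<open>\<open>tau n\<close> reaches 2 after \<open>n\<close> steps of
        \<open>y\<^sup>2 - 2\<close>, and so does its image. Lifted through
        \<open>joukowski\<close>, the image comes from a root of unity whose order divides
        \<open>2 ^ n\<close>.\<close>
      obtain k where k: "\<sigma> (tau n) = T n k"
      proof -
        let ?g = "\<lambda>y::complex. y\<^sup>2 - 2"
        have gL: "?g z \<in> ?L \<and> \<sigma> (?g z) = ?g (\<sigma> z)" if "z \<in> ?L" for z
          using fhom_diff[OF L h subfld_power[OF L that] subfld_numeral[OF L]] fhom_power[OF L h that] two(1)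
            subfld_diff[OF L subfld_power[OF L that] subfld_numeral[OF L]] by simp
        have it: "(?g ^^ m) z \<in> ?L \<and> \<sigma> ((?g ^^ m) z) = (?g ^^ m) (\<sigma> z)" if "z \<in> ?L" for m z
          by (induction m) (use that gL in auto)
        have "(?g ^^ n) (\<sigma> (tau n)) = 2"
          using it[OF tau[of n], of n] tau_iterate[of n 0] two(1) by (simp add: tau_0)
        moreover obtain \<beta> where \<beta>: "\<beta> \<noteq> 0" "joukowski \<beta> = \<sigma> (tau n)" using joukowski_surj by blast
        moreover have "(?g ^^ m) (joukowski \<beta>) = joukowski (\<beta> ^ 2 ^ m)" for m
        proof (induction m)
          case (Suc m)
          then show ?case using joukowski_square[of "\<beta> ^ 2 ^ m"] \<beta>(1) by (simp flip: power_mult add: mult.commute)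
        qed simp
        ultimately have "joukowski (\<beta> ^ 2 ^ n) = 2" by metis
        then have "(\<beta> ^ 2 ^ n - 1)\<^sup>2 = 0"
          using double_root[of "\<beta> ^ 2 ^ n"] \<beta>(1) by simp
        then have "\<beta> ^ 2 ^ n = 1" by simp
        then obtain j :: nat where "\<beta> = zeta n ^ j" using root_of_unity_zeta by blast
        then have "\<sigma> (tau n) = T n (int j)" using \<beta>(2) by (simp add: T_def joukowski_def power_int_minus)
        then show ?thesis by (rule that)
      qed
      \<comment> \<open>The neighbours \<open>i + 1\<close> and \<open>i - 1\<close> go to
        \<open>\<pi> i + k\<close> and \<open>\<pi> i - k\<close> in an order that may depend on
        \<open>i\<close>. Either way the second difference of \<open>\<pi>\<close> vanishes modulo
        \<open>2 ^ n\<close>.\<close>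
      have lin: "2 ^ n dvd (\<pi> (i + 1) - \<pi> i) - (\<pi> i - \<pi> (i - 1))" for i
      proof -
        let ?p = "y w n (\<pi> (i + 1))" and ?q = "y w n (\<pi> (i - 1))"
        let ?r = "y w n (\<pi> i + k)" and ?s = "y w n (\<pi> i - k)"
        note yL = yL[OF x w, of n]
        have "?p + ?q = T n k * y w n (\<pi> i)"
          using arg_cong[OF sum[of w n i 1, OF w0], of \<sigma>] fhom_add[OF L h yL yL] fhom_mult[OF L h tau yL] k
          by (simp add: T1 \<sigma>y)
        then have s: "?p + ?q = ?r + ?s" using sum[of w n "\<pi> i" k, OF w0] by simp
        have "\<sigma> ((y w n i)\<^sup>2 + (tau n)\<^sup>2 - 4) = (\<sigma> (y w n i))\<^sup>2 + (\<sigma> (tau n))\<^sup>2 - 4"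
          using fhom_diff[OF L h subfld_add[OF L subfld_power[OF L yL] subfld_power[OF L tau]] subfld_numeral[OF L]]
            fhom_add[OF L h subfld_power[OF L yL] subfld_power[OF L tau]] fhom_power[OF L h yL] fhom_power[OF L h tau] two(2)
          by simp
        then have "?p * ?q = (y w n (\<pi> i))\<^sup>2 + (T n k)\<^sup>2 - 4"
          using arg_cong[OF prod[of w n i 1, OF w0], of \<sigma>] fhom_mult[OF L h yL yL] k
          by (simp add: T1 \<sigma>y)
        then have "?p * ?q = ?r * ?s" using prod[of w n "\<pi> i" k, OF w0] by simp
        then consider "?p = ?r" "?q = ?s" | "?p = ?s" "?q = ?r" using sum_prod_determine[OF s] by blast
        then have "2 ^ n dvd (\<pi> (i + 1) - (\<pi> i + k)) + (\<pi> (i - 1) - (\<pi> i - k)) \<or>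
          2 ^ n dvd (\<pi> (i + 1) - (\<pi> i - k)) + (\<pi> (i - 1) - (\<pi> i + k))"
        proof cases
          case 1
          then have "Y w n (\<pi> (i + 1)) = Y w n (\<pi> i + k)" "Y w n (\<pi> (i - 1)) = Y w n (\<pi> i - k)"
            by (simp_all add: Y_def)
          then show ?thesis unfolding coord_eq[OF C] by (blast intro: dvd_add)
        next
          case 2
          then have "Y w n (\<pi> (i + 1)) = Y w n (\<pi> i - k)" "Y w n (\<pi> (i - 1)) = Y w n (\<pi> i + k)"
            by (simp_all add: Y_def)
          then show ?thesis unfolding coord_eq[OF C] by (blast intro: dvd_add)
        qed
        then show ?thesis by (simp add: algebra_simps)
      qed
      define \<alpha> where "\<alpha> = \<pi> 1 - \<pi> 0"
      \<comment> \<open>Vanishing second differences make \<open>\<pi>\<close> affine: two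
        consecutive values propagate in both directions.\<close>
      have "2 ^ n dvd \<pi> i - (\<alpha> * i + \<pi> 0) \<and> 2 ^ n dvd \<pi> (i + 1) - (\<alpha> * (i + 1) + \<pi> 0)" for i
      proof (induction i rule: int_induct[where k = 0])
        case base
        show ?case by (simp add: \<alpha>_def)
      next
        case (step1 i)
        have "2 ^ n dvd ((\<pi> (i + 1 + 1) - \<pi> (i + 1)) - (\<pi> (i + 1) - \<pi> (i + 1 - 1)))
            + 2 * (\<pi> (i + 1) - (\<alpha> * (i + 1) + \<pi> 0)) - (\<pi> i - (\<alpha> * i + \<pi> 0))"
          using step1(2) lin[of "i + 1"] by (elim conjE) (rule dvd_diff[OF dvd_add[OF _ dvd_mult]])
        then show ?case using step1(2) by (simp add: algebra_simps)
      next
        case (step2 i)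
        have "2 ^ n dvd ((\<pi> (i + 1) - \<pi> i) - (\<pi> i - \<pi> (i - 1)))
            + 2 * (\<pi> i - (\<alpha> * i + \<pi> 0)) - (\<pi> (i + 1) - (\<alpha> * (i + 1) + \<pi> 0))"
          using step2(2) lin[of i] by (elim conjE) (rule dvd_diff[OF dvd_add[OF _ dvd_mult]])
        then show ?case using step2(2) by (simp add: algebra_simps)
      qed
      then have "\<sigma> (Y w n i) = Y w n (\<alpha> * i + \<pi> 0)" for i unfolding \<pi> coord_eq[OF C] by blast
      then show ?thesis by blast
    qed
    then show "\<exists>Y. affine_coords (iter_level f t) (poly f) (gal_arith K f t) (\<lambda>\<sigma>. \<sigma>) x Y"
      using coord_affine[OF C] by blast
  qed
qed

section \<open>Short critical orbits and the main result\<close>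

lemma fixed_critical_point:
  assumes "c \<in> post_critical f c" "card (post_critical f c) = 1"
  shows "v = c"
proof -
  obtain z where "post_critical f c = {z}" using assms(2) card_1_singletonE by blast
  then show ?thesis using assms(1) v_post_critical by auto
qed

text \<open>Only \<open>c\<close> is mapped to \<open>v\<close>, so the orbit never returns to
  \<open>v\<close> and its second point \<open>f v\<close> is fixed. Thus \<open>f\<close> agrees at
  \<open>v\<close> and at \<open>f v\<close>, so \<open>f v\<close> is the reflection of
  \<open>v\<close>; this is the equation for the parameter.\<close>

lemma chebyshev_parameter:
  assumes c: "c \<notin> post_critical f c" and r: "card (post_critical f c) = 2"
  shows "a * (v - c) = - 2"
proof -
  let ?P = "post_critical f c"
  have v: "v \<in> ?P" by (rule v_post_critical)
  have vc: "v \<noteq> c" using v c by auto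
  let ?w = "poly f v"
  have w: "?w \<in> ?P" by (rule post_critical_forward[OF v])
  have fc: "z = c" if "poly f z = v" for z
    using that poly_f_eq_iff[of z c] by (simp add: v_def)
  have "?w \<noteq> v" using fc[of v] vc by auto
  then have P: "?P = {v, ?w}"
    using v w r card_subset_eq[of ?P "{v, ?w}"] card.infinite[of ?P] by (cases "finite ?P") auto
  have "poly f ?w \<in> {v, ?w}" using post_critical_forward[OF w] P by simp
  moreover have "poly f ?w \<noteq> v" using fc[of ?w] w c by auto
  ultimately have "poly f ?w = poly f v" by simp
  then have "?w = 2 * c - v" using poly_f_eq_iff \<open>?w \<noteq> v\<close> by blast
  then have "a * (v - c)\<^sup>2 + v = 2 * c - v" by (simp add: poly_f)
  then have "(a * (v - c) + 2) * (v - c) = 0" by (simp add: power2_eq_square algebra_simps)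
  then show ?thesis using vc by (simp add: eq_neg_iff_add_eq_0)
qed

end

theorem theorem1p9:
  fixes K :: "complex set" and f :: "complex poly" and c t :: complex and r :: nat
  assumes "number_field K"
    and "Polynomial.degree f = 2"
    and "\<forall>i. Polynomial.coeff f i \<in> ring_of_integers K"
    and "poly (pderiv f) c = 0"
    and "finite (post_critical f c)"
    and "r = card (post_critical f c)"
    and "ring.transcendental CC K t"
  shows "(\<not> (r = 1 \<or> c \<notin> post_critical f c \<and> r = 2) \<longrightarrow> gal_arith_wild K f t) \<and>
    (c \<in> post_critical f c \<and> r = 1 \<longrightarrow>
       gal_arith_stable K f t \<and> gal_arith_infinite_disc_group K f t) \<and>
    (c \<in> post_critical f c \<and> r \<ge> 2 \<longrightarrow>
       \<not> gal_arith_LQA K f t \<and> gal_arith_wild K f t) \<and>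
    (c \<notin> post_critical f c \<and> r = 2 \<longrightarrow>
       gal_arith_stable K f t \<and> gal_arith_infinite_disc_group K f t) \<and>
    (c \<notin> post_critical f c \<and> r \<ge> 3 \<longrightarrow>
       \<not> gal_arith_LQA K f t \<and> gal_arith_wild K f t)"
proof -
  have K: "subfld K" and fin: "ring.finite_dimension CC \<rat> K"
    using assms(1) by (auto simp: number_field_def subfield_CC_iff)
  have fK: "f \<in> pover K" using assms(3) by (simp add: pover_def ring_of_integers_def)
  have t: "\<not> algover K t" using assms(7) algebraic_CC_iff[OF K] by blast
  interpret critical_tower K f c
    by unfold_locales (use K fK assms(2,4) in auto)
  \<comment> \<open>\<open>v\<close> is always post-critical; otherwise \<open>r = 0\<close> would
    fall under the first wildness claim.\<close>
  have r: "r \<noteq> 0" using assms(5,6) v_post_critical by auto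
  have wild: "\<not> gal_arith_LQA K f t \<and> gal_arith_wild K f t"
    if "c \<in> post_critical f c \<and> r \<ge> 2 \<or> c \<notin> post_critical f c \<and> r \<ge> 3"
  proof -
    have "\<not> gal_arith_LQA K f t"
      using not_LQA_of_unsymmetric[OF t] unsymmetric_periodic[OF assms(5)]
        unsymmetric_preperiodic[OF assms(5)] that assms(6) by blast
    then show ?thesis by (simp add: tree_wild_def tree_stable_def)
  qed
  moreover have "gal_arith_stable K f t \<and> gal_arith_infinite_disc_group K f t"
    if "c \<in> post_critical f c" "r = 1"
    by (rule stable_fixed_critical_point[OF t fin fixed_critical_point]) (use that assms(6) in auto)
  moreover have "gal_arith_stable K f t \<and> gal_arith_infinite_disc_group K f t"
    if "c \<notin> post_critical f c" "r = 2"
    by (rule stable_chebyshev[OF t fin chebyshev_parameter]) (use that assms(6) in auto)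
  moreover have "c \<in> post_critical f c \<and> r \<ge> 2 \<or> c \<notin> post_critical f c \<and> r \<ge> 3"
    if "\<not> (r = 1 \<or> c \<notin> post_critical f c \<and> r = 2)"
    using that r by (cases "c \<in> post_critical f c") auto
  ultimately show ?thesis by (intro conjI impI; meson)
qed

end
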